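(* Let $R$ be a commutative Noetherian ring and let $x_1,\dots,x_n$ ($n\ge 1$) be elements of $R$ such that the product $x_1\cdots x_n$ belongs to $\operatorname{ann}\mathsf{D_{sg}}(R)$. Then $$\mathsf{D_{sg}}(R)=\operatorname{smd}(\mathsf{C}(x_1)\ast\cdots\ast\mathsf{C}(x_n)).$$
   Context: All subcategories are strictly full (full and closed under isomorphism). For a commutative Noetherian ring $R$, $\mathsf{D_{sg}}(R)$ denotes the singularity category of $R$: the Verdier quotient of the bounded derived category $\mathsf{D^b}(R)$ of finitely generated $R$-modules by the perfect complexes. For $x\in R$, $\mathsf{C}(x)$ is the subcategory of $\mathsf{D_{sg}}(R)$ consisting of the objects $X$ such that the morphism $X\xrightarrow{x}X$ in $\mathsf{D_{sg}}(R)$ given by multiplication by $x$ is zero. The annihilator of the singularity category is the ideal $\operatorname{ann}\mathsf{D_{sg}}(R)=\{a\in R\mid \mathsf{C}(a)=\mathsf{D_{sg}}(R)\}$ of $R$, i.e. the set of $a$ such that multiplication by $a$ is zero on every object of $\mathsf{D_{sg}}(R)$. For subcategories $\mathcal X,\mathcal Y$ of a triangulated category $\mathcal T$, $\mathcal X\ast\mathcal Y$ is the subcategory of $\mathcal T$ consisting of the objects $E$ for which there is an exact triangle $X\to E\to Y\to X[1]$ in $\mathcal T$ with $X\in\mathcal X$ and $Y\in\mathcal Y$; the operation $\ast$ is associative. $\operatorname{smd}\mathcal X$ is the subcategory of all direct summands of objects of $\mathcal X$. *)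

theory Defs
  imports "HOL-Algebra.Module" "HOL-Algebra.Ring_Divisibility"
begin

section \<open>Categories with shift and triangles\<close>

text \<open>An arrow carries its source and target, so hom-sets of different pairs of objects are disjoint.\<close>

type_synonym ('o, 'e) arr = "'o \<times> 'o \<times> 'e"

definition src :: "('o, 'e) arr \<Rightarrow> 'o" where "src f = fst f"
definition tgt :: "('o, 'e) arr \<Rightarrow> 'o" where "tgt f = fst (snd f)"

text \<open>\<open>Cmp C g f\<close> is the composite \<open>g \<circ> f\<close> (first \<open>f\<close>); it is meaningful only for
  composable arrows, as \<open>Add\<close> is only for parallel ones.\<close>

record ('o, 'e) shiftcat =
  Ob :: "'o set"
  Hom :: "'o \<Rightarrow> 'o \<Rightarrow> ('o, 'e) arr set"
  Cmp :: "('o, 'e) arr \<Rightarrow> ('o, 'e) arr \<Rightarrow> ('o, 'e) arr"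
  Idt :: "'o \<Rightarrow> ('o, 'e) arr"
  Add :: "('o, 'e) arr \<Rightarrow> ('o, 'e) arr \<Rightarrow> ('o, 'e) arr"
  Nul :: "'o \<Rightarrow> 'o \<Rightarrow> ('o, 'e) arr"
  Sh :: "'o \<Rightarrow> 'o"
  ShA :: "('o, 'e) arr \<Rightarrow> ('o, 'e) arr"

text \<open>The tuple \<open>(X, Y, Z, f, g, h)\<close> stands for the triangle
  \<open>X \<rightarrow> Y \<rightarrow> Z \<rightarrow> X[1]\<close> with arrows \<open>f\<close>, \<open>g\<close>, \<open>h\<close>.\<close>

type_synonym ('o, 'e) triangle =
  "'o \<times> 'o \<times> 'o \<times> ('o, 'e) arr \<times> ('o, 'e) arr \<times> ('o, 'e) arr"

record ('o, 'e) tricat = "('o, 'e) shiftcat" +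
  Tri :: "('o, 'e) triangle set"

definition is_iso :: "('o, 'e, 'z) shiftcat_scheme \<Rightarrow> 'o \<Rightarrow> 'o \<Rightarrow> ('o, 'e) arr \<Rightarrow> bool" where
  "is_iso C X Y f \<longleftrightarrow> X \<in> Ob C \<and> Y \<in> Ob C \<and> f \<in> Hom C X Y \<and>
     (\<exists>g\<in>Hom C Y X. Cmp C g f = Idt C X \<and> Cmp C f g = Idt C Y)"

definition isomorphic :: "('o, 'e, 'z) shiftcat_scheme \<Rightarrow> 'o \<Rightarrow> 'o \<Rightarrow> bool" where
  "isomorphic C X Y \<longleftrightarrow> (\<exists>f. is_iso C X Y f)"

definition is_triangle :: "('o, 'e, 'z) shiftcat_scheme \<Rightarrow> ('o, 'e) triangle \<Rightarrow> bool" where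
  "is_triangle C = (\<lambda>(X, Y, Z, f, g, h).
     X \<in> Ob C \<and> Y \<in> Ob C \<and> Z \<in> Ob C \<and>
     f \<in> Hom C X Y \<and> g \<in> Hom C Y Z \<and> h \<in> Hom C Z (Sh C X))"

definition triangle_iso ::
  "('o, 'e, 'z) shiftcat_scheme \<Rightarrow> ('o, 'e) triangle \<Rightarrow> ('o, 'e) triangle \<Rightarrow> bool" where
  "triangle_iso C = (\<lambda>(X, Y, Z, f, g, h) (X', Y', Z', f', g', h').
     \<exists>a b c. is_iso C X X' a \<and> is_iso C Y Y' b \<and> is_iso C Z Z' c \<and>
       Cmp C b f = Cmp C f' a \<and> Cmp C c g = Cmp C g' b \<and> Cmp C (ShA C a) h = Cmp C h' c)"

definition triangle_closure ::
  "('o, 'e, 'z) shiftcat_scheme \<Rightarrow> ('o, 'e) triangle set \<Rightarrow> ('o, 'e) triangle set" where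
  "triangle_closure C T = {t. is_triangle C t \<and> (\<exists>t'\<in>T. is_triangle C t' \<and> triangle_iso C t t')}"

definition with_triangles ::
  "('o, 'e) shiftcat \<Rightarrow> ('o, 'e) triangle set \<Rightarrow> ('o, 'e) tricat" where
  "with_triangles C T = shiftcat.extend C (tricat.fields (triangle_closure C T))"


section \<open>Operations on strictly full subcategories\<close>

text \<open>A strictly full subcategory is given by its set of objects.\<close>

definition star :: "('o, 'e) tricat \<Rightarrow> 'o set \<Rightarrow> 'o set \<Rightarrow> 'o set" where
  "star C A B = {E \<in> Ob C. \<exists>X\<in>A. \<exists>Y\<in>B. \<exists>f g h. (X, E, Y, f, g, h) \<in> Tri C}"

text \<open>Since \<open>star\<close> is associative on triangulated categories, the bracketing is immaterial.
  The empty list is given the neutral element, the zero objects.\<close>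

fun star_list :: "('o, 'e) tricat \<Rightarrow> 'o set list \<Rightarrow> 'o set" where
  "star_list C [] = {X \<in> Ob C. Idt C X = Nul C X X}"
| "star_list C [A] = A"
| "star_list C (A # B # As) = star C A (star_list C (B # As))"

definition biproduct :: "('o, 'e, 'z) shiftcat_scheme \<Rightarrow> 'o \<Rightarrow> 'o \<Rightarrow> 'o \<Rightarrow> bool" where
  "biproduct C X Y E \<longleftrightarrow>
     (\<exists>i\<in>Hom C X E. \<exists>p\<in>Hom C E X. \<exists>j\<in>Hom C Y E. \<exists>q\<in>Hom C E Y.
        Cmp C p i = Idt C X \<and> Cmp C q j = Idt C Y \<and>
        Cmp C p j = Nul C Y X \<and> Cmp C q i = Nul C X Y \<and>
        Add C (Cmp C i p) (Cmp C j q) = Idt C E)"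

definition smd :: "('o, 'e, 'z) shiftcat_scheme \<Rightarrow> 'o set \<Rightarrow> 'o set" where
  "smd C A = {X \<in> Ob C. \<exists>E\<in>A. \<exists>Y\<in>Ob C. biproduct C X Y E}"


section \<open>Verdier quotients\<close>

definition verdier_W :: "('o, 'e) tricat \<Rightarrow> 'o set \<Rightarrow> ('o, 'e) arr set" where
  "verdier_W C N = {s. \<exists>X Y Z g h. (X, Y, Z, s, g, h) \<in> Tri C \<and> Z \<in> N}"

text \<open>The pair \<open>(s, f)\<close> is the roof \<open>X \<leftarrow> V \<rightarrow> Y\<close> with \<open>s : V \<rightarrow> X\<close> in
  \<open>verdier_W\<close> and \<open>f : V \<rightarrow> Y\<close>; it represents \<open>f \<circ> s\<^sup>-\<^sup>1\<close>.\<close>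

type_synonym ('o, 'e) roof = "('o, 'e) arr \<times> ('o, 'e) arr"

definition roofs :: "('o, 'e) tricat \<Rightarrow> 'o set \<Rightarrow> 'o \<Rightarrow> 'o \<Rightarrow> ('o, 'e) roof set" where
  "roofs C N X Y = {(s, f). \<exists>V\<in>Ob C. s \<in> Hom C V X \<and> s \<in> verdier_W C N \<and> f \<in> Hom C V Y}"

definition roof_eq ::
  "('o, 'e) tricat \<Rightarrow> 'o set \<Rightarrow> 'o \<Rightarrow> 'o \<Rightarrow> (('o, 'e) roof \<times> ('o, 'e) roof) set" where
  "roof_eq C N X Y = {((s, f), (s', f')).
     (s, f) \<in> roofs C N X Y \<and> (s', f') \<in> roofs C N X Y \<and>
     (\<exists>V\<in>Ob C. \<exists>u\<in>Hom C V (src s). \<exists>v\<in>Hom C V (src s').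
        Cmp C s u = Cmp C s' v \<and> Cmp C s u \<in> verdier_W C N \<and> Cmp C f u = Cmp C f' v)}"

definition roof_class ::
  "('o, 'e) tricat \<Rightarrow> 'o set \<Rightarrow> 'o \<Rightarrow> 'o \<Rightarrow> ('o, 'e) roof \<Rightarrow> ('o, 'e) roof set" where
  "roof_class C N X Y r = roof_eq C N X Y `` {r}"

text \<open>The operations on classes of roofs are the usual ones on representatives: the composite
  of \<open>(s, f)\<close> and \<open>(t, g)\<close> is the class of \<open>(s s', g f')\<close> for any completion
  \<open>t f' = f s'\<close> with \<open>s'\<close> in \<open>verdier_W\<close>, and classes are added on representatives with a
  common denominator. All choices of representatives give the same class when \<open>N\<close> is a
  triangulated subcategory of a triangulated category, so the unions are over one set.\<close>

definition verdier_shiftcat ::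
  "('o, 'e) tricat \<Rightarrow> 'o set \<Rightarrow> ('o, ('o, 'e) roof set) shiftcat" where
  "verdier_shiftcat C N =
    \<lparr> Ob = Ob C,
      Hom = (\<lambda>X Y. {(X, Y, roof_class C N X Y r) | r. X \<in> Ob C \<and> Y \<in> Ob C \<and> r \<in> roofs C N X Y}),
      Cmp = (\<lambda>(Y', Z, \<gamma>) (X, Y, \<phi>). (X, Z,
        \<Union> {roof_class C N X Z (Cmp C s s', Cmp C g f') | s f t g s' f' V.
             (s, f) \<in> \<phi> \<and> (t, g) \<in> \<gamma> \<and> V \<in> Ob C \<and>
             s' \<in> Hom C V (src f) \<and> s' \<in> verdier_W C N \<and> f' \<in> Hom C V (src g) \<and>
             Cmp C t f' = Cmp C f s'})),
      Idt = (\<lambda>X. (X, X, roof_class C N X X (Idt C X, Idt C X))),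
      Add = (\<lambda>(X, Y, \<phi>) (X', Y', \<psi>). (X, Y,
        \<Union> {roof_class C N X Y (s, Add C f g) | s f g. (s, f) \<in> \<phi> \<and> (s, g) \<in> \<psi>})),
      Nul = (\<lambda>X Y. (X, Y, roof_class C N X Y (Idt C X, Nul C X Y))),
      Sh = Sh C,
      ShA = (\<lambda>(X, Y, \<phi>). (Sh C X, Sh C Y,
        \<Union> {roof_class C N (Sh C X) (Sh C Y) (ShA C s, ShA C f) | s f. (s, f) \<in> \<phi>})) \<rparr>"

definition verdier_functor ::
  "('o, 'e) tricat \<Rightarrow> 'o set \<Rightarrow> ('o, 'e) arr \<Rightarrow> ('o, ('o, 'e) roof set) arr" where
  "verdier_functor C N f =
     (src f, tgt f, roof_class C N (src f) (tgt f) (Idt C (src f), f))"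

definition verdier :: "('o, 'e) tricat \<Rightarrow> 'o set \<Rightarrow> ('o, ('o, 'e) roof set) tricat" where
  "verdier C N = with_triangles (verdier_shiftcat C N)
     {(X, Y, Z, verdier_functor C N f, verdier_functor C N g, verdier_functor C N h)
       | X Y Z f g h. (X, Y, Z, f, g, h) \<in> Tri C}"


section \<open>Finitely generated modules\<close>

definition fin_gen :: "('a, 'b) ring_scheme \<Rightarrow> ('a, 'm, 'c) module_scheme \<Rightarrow> bool" where
  "fin_gen R M \<longleftrightarrow> (\<exists>A. finite A \<and> A \<subseteq> carrier M \<and>
     (\<forall>N. submodule N R M \<and> A \<subseteq> N \<longrightarrow> N = carrier M))"

definition mod_homs :: "('a, 'b) ring_scheme \<Rightarrow> ('a, 'm, 'c) module_scheme \<Rightarrow>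
    ('a, 'n, 'd) module_scheme \<Rightarrow> ('m \<Rightarrow> 'n) set" where
  "mod_homs R M N = {f \<in> carrier M \<rightarrow> carrier N.
     (\<forall>x\<in>carrier M. \<forall>y\<in>carrier M. f (x \<oplus>\<^bsub>M\<^esub> y) = f x \<oplus>\<^bsub>N\<^esub> f y) \<and>
     (\<forall>a\<in>carrier R. \<forall>x\<in>carrier M. f (a \<odot>\<^bsub>M\<^esub> x) = a \<odot>\<^bsub>N\<^esub> f x)}"

text \<open>Carriers of modules are subsets of a fixed type, closed under pairing, which contains an
  isomorphic copy of every quotient of every finite free module over a ring on \<open>'a\<close>: an element
  of a quotient of \<open>R\<^sup>n\<close> is a coset, that is, a set of functions \<open>nat \<Rightarrow> 'a\<close>. Hence every
  finitely generated module has an isomorphic copy with elements in \<open>'a mel\<close>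
  (\<open>fin_gen_iso_mel\<close> below).\<close>

datatype 'a mel = Coset "(nat \<Rightarrow> 'a) set" | Pair (pfst: "'a mel") (psnd: "'a mel")

text \<open>The ring multiplication and unit of a \<open>module\<close> record play no role for modules.\<close>

definition mod_transport ::
  "('a, 'm, 'c) module_scheme \<Rightarrow> ('m \<Rightarrow> 'n) \<Rightarrow> ('a, 'n) module" where
  "mod_transport M \<phi> = (let \<psi> = inv_into (carrier M) \<phi> in
    \<lparr> carrier = \<phi> ` carrier M, mult = undefined, one = undefined,
      zero = \<phi> \<zero>\<^bsub>M\<^esub>,
      add = (\<lambda>p q. \<phi> (\<psi> p \<oplus>\<^bsub>M\<^esub> \<psi> q)),
      smult = (\<lambda>a p. \<phi> (a \<odot>\<^bsub>M\<^esub> \<psi> p)) \<rparr>)"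

lemma mod_transport_iso:
  fixes M :: "('a, 'm, 'c) module_scheme" and \<phi> :: "'m \<Rightarrow> 'n"
  assumes M: "module R M" and inj: "inj_on \<phi> (carrier M)"
  shows "module R (mod_transport M \<phi>)"
    and "\<phi> \<in> mod_homs R M (mod_transport M \<phi>)"
    and "bij_betw \<phi> (carrier M) (carrier (mod_transport M \<phi>))"
    and "fin_gen R M \<Longrightarrow> fin_gen R (mod_transport M \<phi>)"
proof -
  interpret M: module R M by fact
  let ?M = "mod_transport M \<phi>"
  have inv: "inv_into (carrier M) \<phi> (\<phi> x) = x" if "x \<in> carrier M" for x
    using inj that by simp
  have car: "carrier ?M = \<phi> ` carrier M" and zer: "\<zero>\<^bsub>?M\<^esub> = \<phi> \<zero>\<^bsub>M\<^esub>"
    by (simp_all add: mod_transport_def Let_def)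
  have add: "\<phi> x \<oplus>\<^bsub>?M\<^esub> \<phi> y = \<phi> (x \<oplus>\<^bsub>M\<^esub> y)" if "x \<in> carrier M" "y \<in> carrier M" for x y
    using that by (simp add: mod_transport_def Let_def inv)
  have smu: "a \<odot>\<^bsub>?M\<^esub> \<phi> x = \<phi> (a \<odot>\<^bsub>M\<^esub> x)" if "x \<in> carrier M" for a x
    using that by (simp add: mod_transport_def Let_def inv)
  have ab: "abelian_group ?M"
  proof (rule abelian_groupI)
    fix x assume "x \<in> carrier ?M"
    then obtain u where u: "u \<in> carrier M" "x = \<phi> u" by (auto simp: car)
    have "\<phi> (\<ominus>\<^bsub>M\<^esub> u) \<oplus>\<^bsub>?M\<^esub> x = \<zero>\<^bsub>?M\<^esub>" using u by (simp add: add zer M.l_neg)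
    then show "\<exists>y\<in>carrier ?M. y \<oplus>\<^bsub>?M\<^esub> x = \<zero>\<^bsub>?M\<^esub>" using u by (auto simp: car)
  qed (auto simp: car zer add M.a_ac)
  show mod: "module R ?M"
    by (rule moduleI) (use ab in \<open>auto simp: car zer add smu M.is_cring M.smult_l_distr
      M.smult_r_distr M.smult_assoc1\<close>)
  show "\<phi> \<in> mod_homs R M ?M" by (auto simp: mod_homs_def car add smu)
  show "bij_betw \<phi> (carrier M) (carrier ?M)" using inj by (simp add: bij_betw_def car)
  show "fin_gen R ?M" if "fin_gen R M"
  proof -
    interpret M': module R ?M by (fact mod)
    obtain A where A: "finite A" "A \<subseteq> carrier M"
      "\<And>N. submodule N R M \<Longrightarrow> A \<subseteq> N \<Longrightarrow> N = carrier M"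
      using \<open>fin_gen R M\<close> by (auto simp: fin_gen_def)
    have "N = carrier ?M" if N: "submodule N R ?M" "\<phi> ` A \<subseteq> N" for N
    proof -
      let ?N = "{x \<in> carrier M. \<phi> x \<in> N}"
      have "\<zero>\<^bsub>?M\<^esub> \<in> N"
        using subgroup.one_closed[OF submodule.axioms(1)[OF N(1)]] by simp
      have smN: "\<phi> (a \<odot>\<^bsub>M\<^esub> u) \<in> N" if "a \<in> carrier R" "u \<in> carrier M" "\<phi> u \<in> N" for a u
        using M'.submoduleE(4)[OF N(1) that(1,3)] that by (simp add: smu)
      have adN: "\<phi> (u \<oplus>\<^bsub>M\<^esub> v) \<in> N"
        if "u \<in> carrier M" "\<phi> u \<in> N" "v \<in> carrier M" "\<phi> v \<in> N" for u v
        using M'.submoduleE(5)[OF N(1) that(2,4)] that by (simp add: add)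
      have mi: "\<ominus>\<^bsub>M\<^esub> u = (\<ominus>\<^bsub>R\<^esub> \<one>\<^bsub>R\<^esub>) \<odot>\<^bsub>M\<^esub> u" if "u \<in> carrier M" for u
        using that by (simp add: M.smult_l_minus)
      have "submodule ?N R M"
      proof (rule M.submoduleI)
        show "\<zero>\<^bsub>M\<^esub> \<in> ?N" using \<open>\<zero>\<^bsub>?M\<^esub> \<in> N\<close> by (simp add: zer)
        show "\<ominus>\<^bsub>M\<^esub> u \<in> ?N" if "u \<in> ?N" for u
          using that smN[of "\<ominus>\<^bsub>R\<^esub> \<one>\<^bsub>R\<^esub>" u] by (simp add: mi)
      qed (auto intro: smN adN)
      moreover have "A \<subseteq> ?N" using A(2) N(2) by auto
      ultimately have "?N = carrier M" using A(3) by blast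
      moreover have "N \<subseteq> carrier ?M" using M'.submoduleE(1)[OF N(1)] .
      ultimately show ?thesis by (auto simp: car)
    qed
    moreover have "finite (\<phi> ` A)" "\<phi> ` A \<subseteq> carrier ?M" using A by (auto simp: car)
    ultimately show ?thesis unfolding fin_gen_def by blast
  qed
qed

lemma fin_gen_iso_mel:
  fixes R :: "('a, 'b) ring_scheme" and M :: "('a, 'm, 'c) module_scheme"
  assumes M: "module R M" and fg: "fin_gen R M"
  shows "\<exists>(M' :: ('a, 'a mel) module) \<phi>. module R M' \<and> fin_gen R M' \<and>
    \<phi> \<in> mod_homs R M M' \<and> bij_betw \<phi> (carrier M) (carrier M')"
proof -
  interpret M: module R M by fact
  obtain A where A: "finite A" "A \<subseteq> carrier M"
    "\<And>N. submodule N R M \<Longrightarrow> A \<subseteq> N \<Longrightarrow> N = carrier M"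
    using fg by (auto simp: fin_gen_def)
  obtain e n where "bij_betw e {0..<n::nat} A"
    using A(1) by (metis ex_bij_betw_nat_finite)
  then have eA: "e ` {0..<n} = A" by (simp add: bij_betw_def)
  then have e: "e i \<in> carrier M" if "i \<in> {0..<n}" for i using A(2) that by blast
  define S where "S = (\<lambda>c :: nat \<Rightarrow> 'a. finsum M (\<lambda>i. c i \<odot>\<^bsub>M\<^esub> e i) {0..<n})"
  define K where "K = {c :: nat \<Rightarrow> 'a. \<forall>i. c i \<in> carrier R}"
  have fn: "(\<lambda>i. c i \<odot>\<^bsub>M\<^esub> e i) \<in> {0..<n} \<rightarrow> carrier M" if "c \<in> K" for c
    using that e by (auto simp: K_def)
  have Sc: "S c \<in> carrier M" if "c \<in> K" for c
    unfolding S_def using fn[OF that] by (rule M.finsum_closed)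
  have Sadd: "S c \<oplus>\<^bsub>M\<^esub> S d = S (\<lambda>i. c i \<oplus>\<^bsub>R\<^esub> d i)" if "c \<in> K" "d \<in> K" for c d
  proof -
    have "S (\<lambda>i. c i \<oplus>\<^bsub>R\<^esub> d i) =
        finsum M (\<lambda>i. c i \<odot>\<^bsub>M\<^esub> e i \<oplus>\<^bsub>M\<^esub> d i \<odot>\<^bsub>M\<^esub> e i) {0..<n}"
      unfolding S_def by (rule M.finsum_cong') (use that e in \<open>auto simp: K_def M.smult_l_distr\<close>)
    also have "\<dots> = S c \<oplus>\<^bsub>M\<^esub> S d"
      unfolding S_def using fn[OF that(1)] fn[OF that(2)] by (rule M.finsum_addf)
    finally show ?thesis by simp
  qed
  have Ssm: "a \<odot>\<^bsub>M\<^esub> S c = S (\<lambda>i. a \<otimes>\<^bsub>R\<^esub> c i)" if "a \<in> carrier R" "c \<in> K" for a c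
  proof -
    have "a \<odot>\<^bsub>M\<^esub> S c = finsum M (\<lambda>i. a \<odot>\<^bsub>M\<^esub> (c i \<odot>\<^bsub>M\<^esub> e i)) {0..<n}"
      unfolding S_def using that fn[OF that(2)] by (intro M.finsum_smult_ldistr) auto
    also have "\<dots> = S (\<lambda>i. a \<otimes>\<^bsub>R\<^esub> c i)"
      unfolding S_def by (rule M.finsum_cong') (use that e in \<open>auto simp: K_def M.smult_assoc1\<close>)
    finally show ?thesis .
  qed
  have S0: "S (\<lambda>i. \<zero>\<^bsub>R\<^esub>) = \<zero>\<^bsub>M\<^esub>"
  proof -
    have "S (\<lambda>i. \<zero>\<^bsub>R\<^esub>) = finsum M (\<lambda>i. \<zero>\<^bsub>M\<^esub>) {0..<n}"
      unfolding S_def by (rule M.finsum_cong') (use e in auto)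
    then show ?thesis by simp
  qed
  have "submodule (S ` K) R M"
  proof (rule M.submoduleI)
    show "S ` K \<subseteq> carrier M" using Sc by blast
    show "\<zero>\<^bsub>M\<^esub> \<in> S ` K"
      by (rule image_eqI[of _ _ "\<lambda>i. \<zero>\<^bsub>R\<^esub>"]) (auto simp: S0 K_def)
    show sm: "a \<odot>\<^bsub>M\<^esub> y \<in> S ` K" if ay: "a \<in> carrier R" "y \<in> S ` K" for a y
    proof -
      obtain c where c: "c \<in> K" "y = S c" using ay by blast
      then have "(\<lambda>i. a \<otimes>\<^bsub>R\<^esub> c i) \<in> K" using ay by (simp add: K_def)
      then show ?thesis unfolding c(2) Ssm[OF ay(1) c(1)] by (rule imageI)
    qed
    show "y \<oplus>\<^bsub>M\<^esub> z \<in> S ` K" if yz: "y \<in> S ` K" "z \<in> S ` K" for y z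
    proof -
      obtain c d where c: "c \<in> K" "y = S c" "d \<in> K" "z = S d" using yz by blast
      then have "(\<lambda>i. c i \<oplus>\<^bsub>R\<^esub> d i) \<in> K" by (simp add: K_def)
      then show ?thesis unfolding c(2,4) Sadd[OF c(1,3)] by (rule imageI)
    qed
    show "\<ominus>\<^bsub>M\<^esub> y \<in> S ` K" if "y \<in> S ` K" for y
    proof -
      have "y \<in> carrier M" using that Sc by blast
      then have "\<ominus>\<^bsub>M\<^esub> y = (\<ominus>\<^bsub>R\<^esub> \<one>\<^bsub>R\<^esub>) \<odot>\<^bsub>M\<^esub> y" by (simp add: M.smult_l_minus)
      then show ?thesis using sm[of "\<ominus>\<^bsub>R\<^esub> \<one>\<^bsub>R\<^esub>" y] that by simp
    qed
  qed
  moreover have "A \<subseteq> S ` K"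
  proof
    fix y assume "y \<in> A"
    then obtain j where j: "j \<in> {0..<n}" "y = e j" using eA by blast
    let ?c = "\<lambda>i. if i = j then \<one>\<^bsub>R\<^esub> else \<zero>\<^bsub>R\<^esub>"
    have "S ?c = finsum M (\<lambda>i. if j = i then e i else \<zero>\<^bsub>M\<^esub>) {0..<n}"
      unfolding S_def by (rule M.finsum_cong') (use e in auto)
    also have "\<dots> = e j" using j e by (intro M.finsum_singleton) auto
    finally show "y \<in> S ` K" using j by (intro image_eqI[of _ _ ?c]) (auto simp: K_def)
  qed
  ultimately have SK: "S ` K = carrier M" using A(3) by blast
  define \<phi> where "\<phi> = (\<lambda>m. Coset {c \<in> K. S c = m})"
  have "inj_on \<phi> (carrier M)"
  proof (rule inj_onI)
    fix y z assume yz: "y \<in> carrier M" "z \<in> carrier M" "\<phi> y = \<phi> z"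
    obtain c where c: "c \<in> K" "S c = y" using yz(1) unfolding SK[symmetric] by blast
    have "{c \<in> K. S c = y} = {c \<in> K. S c = z}"
      using yz(3) unfolding \<phi>_def by (rule mel.inject(1)[THEN iffD1])
    then have "c \<in> {c \<in> K. S c = z}" using c by blast
    then show "y = z" using c(2) by simp
  qed
  note iso = mod_transport_iso[OF M this]
  show ?thesis
    by (rule exI[of _ "mod_transport M \<phi>"], rule exI[of _ \<phi>])
      (intro conjI iso(1) iso(2) iso(3) iso(4)[OF fg])
qed

definition mod_dsum ::
  "('a, 'a mel) module \<Rightarrow> ('a, 'a mel) module \<Rightarrow> ('a, 'a mel) module" where
  "mod_dsum M N =
    \<lparr> carrier = {Pair x y | x y. x \<in> carrier M \<and> y \<in> carrier N},
      mult = undefined, one = undefined,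
      zero = Pair \<zero>\<^bsub>M\<^esub> \<zero>\<^bsub>N\<^esub>,
      add = (\<lambda>p q. Pair (pfst p \<oplus>\<^bsub>M\<^esub> pfst q) (psnd p \<oplus>\<^bsub>N\<^esub> psnd q)),
      smult = (\<lambda>a p. Pair (a \<odot>\<^bsub>M\<^esub> pfst p) (a \<odot>\<^bsub>N\<^esub> psnd p)) \<rparr>"

text \<open>For finitely generated \<open>P\<close> it suffices to lift along surjections between modules with
  elements in \<open>'a mel\<close>, as these include a surjection from a finite free module onto \<open>P\<close>.\<close>

definition projective_mod :: "('a, 'b) ring_scheme \<Rightarrow> ('a, 'a mel) module \<Rightarrow> bool" where
  "projective_mod R P \<longleftrightarrow> (\<forall>(M :: ('a, 'a mel) module) (N :: ('a, 'a mel) module) g f.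
     module R M \<and> module R N \<and> g \<in> mod_homs R M N \<and> g ` carrier M = carrier N \<and>
     f \<in> mod_homs R P N \<longrightarrow>
     (\<exists>h\<in>mod_homs R P M. \<forall>x\<in>carrier P. g (h x) = f x))"


section \<open>The bounded homotopy category of finitely generated modules\<close>

record 'a cpx =
  cmod :: "int \<Rightarrow> ('a, 'a mel) module"
  cdif :: "int \<Rightarrow> 'a mel \<Rightarrow> 'a mel"

definition bounded_cpx :: "('a, 'b) ring_scheme \<Rightarrow> 'a cpx \<Rightarrow> bool" where
  "bounded_cpx R X \<longleftrightarrow>
     (\<forall>i. module R (cmod X i) \<and> fin_gen R (cmod X i) \<and>
          cdif X i \<in> mod_homs R (cmod X i) (cmod X (i + 1)) \<and>
          (\<forall>x\<in>carrier (cmod X i). cdif X (i + 1) (cdif X i x) = \<zero>\<^bsub>cmod X (i + 2)\<^esub>)) \<and>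
     finite {i. carrier (cmod X i) \<noteq> {\<zero>\<^bsub>cmod X i\<^esub>}}"

definition chain_map ::
  "('a, 'b) ring_scheme \<Rightarrow> 'a cpx \<Rightarrow> 'a cpx \<Rightarrow> (int \<Rightarrow> 'a mel \<Rightarrow> 'a mel) \<Rightarrow> bool" where
  "chain_map R X Y f \<longleftrightarrow>
     (\<forall>i. f i \<in> mod_homs R (cmod X i) (cmod Y i) \<and>
          (\<forall>x\<in>carrier (cmod X i). cdif Y i (f i x) = f (i + 1) (cdif X i x)))"

definition homotopic :: "('a, 'b) ring_scheme \<Rightarrow> 'a cpx \<Rightarrow> 'a cpx \<Rightarrow>
    (int \<Rightarrow> 'a mel \<Rightarrow> 'a mel) \<Rightarrow> (int \<Rightarrow> 'a mel \<Rightarrow> 'a mel) \<Rightarrow> bool" where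
  "homotopic R X Y f g \<longleftrightarrow>
     (\<exists>h. (\<forall>i. h i \<in> mod_homs R (cmod X i) (cmod Y (i - 1))) \<and>
          (\<forall>i. \<forall>x\<in>carrier (cmod X i). f i x =
             g i x \<oplus>\<^bsub>cmod Y i\<^esub> (cdif Y (i - 1) (h i x) \<oplus>\<^bsub>cmod Y i\<^esub> h (i + 1) (cdif X i x))))"

text \<open>A homotopy class contains all functions that agree with one of its members on the
  carriers, so values outside the carriers do not distinguish morphisms.\<close>

definition htpy_class :: "('a, 'b) ring_scheme \<Rightarrow> 'a cpx \<Rightarrow> 'a cpx \<Rightarrow>
    (int \<Rightarrow> 'a mel \<Rightarrow> 'a mel) \<Rightarrow> (int \<Rightarrow> 'a mel \<Rightarrow> 'a mel) set" where
  "htpy_class R X Y f = {g. chain_map R X Y g \<and> homotopic R X Y f g}"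

definition shift_cpx :: "'a cpx \<Rightarrow> 'a cpx" where
  "shift_cpx X =
    \<lparr> cmod = (\<lambda>i. cmod X (i + 1)),
      cdif = (\<lambda>i x. \<ominus>\<^bsub>cmod X (i + 2)\<^esub> cdif X (i + 1) x) \<rparr>"

definition cone_cpx :: "'a cpx \<Rightarrow> 'a cpx \<Rightarrow> (int \<Rightarrow> 'a mel \<Rightarrow> 'a mel) \<Rightarrow> 'a cpx" where
  "cone_cpx X Y f =
    \<lparr> cmod = (\<lambda>i. mod_dsum (cmod X (i + 1)) (cmod Y i)),
      cdif = (\<lambda>i p. Pair (\<ominus>\<^bsub>cmod X (i + 2)\<^esub> cdif X (i + 1) (pfst p))
                         (f (i + 1) (pfst p) \<oplus>\<^bsub>cmod Y (i + 1)\<^esub> cdif Y i (psnd p))) \<rparr>"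

definition Kb_shiftcat ::
  "('a, 'b) ring_scheme \<Rightarrow> ('a cpx, (int \<Rightarrow> 'a mel \<Rightarrow> 'a mel) set) shiftcat" where
  "Kb_shiftcat R =
    \<lparr> Ob = {X. bounded_cpx R X},
      Hom = (\<lambda>X Y. {(X, Y, htpy_class R X Y f) | f.
                bounded_cpx R X \<and> bounded_cpx R Y \<and> chain_map R X Y f}),
      Cmp = (\<lambda>(Y', Z, \<gamma>) (X, Y, \<phi>). (X, Z,
                \<Union> {htpy_class R X Z (\<lambda>i x. g i (f i x)) | f g. f \<in> \<phi> \<and> g \<in> \<gamma>})),
      Idt = (\<lambda>X. (X, X, htpy_class R X X (\<lambda>i x. x))),
      Add = (\<lambda>(X, Y, \<phi>) (X', Y', \<psi>). (X, Y,
                \<Union> {htpy_class R X Y (\<lambda>i x. f i x \<oplus>\<^bsub>cmod Y i\<^esub> g i x) | f g. f \<in> \<phi> \<and> g \<in> \<psi>})),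
      Nul = (\<lambda>X Y. (X, Y, htpy_class R X Y (\<lambda>i x. \<zero>\<^bsub>cmod Y i\<^esub>))),
      Sh = shift_cpx,
      ShA = (\<lambda>(X, Y, \<phi>). (shift_cpx X, shift_cpx Y,
                \<Union> {htpy_class R (shift_cpx X) (shift_cpx Y) (\<lambda>i. f (i + 1)) | f. f \<in> \<phi>})) \<rparr>"

definition Kb ::
  "('a, 'b) ring_scheme \<Rightarrow> ('a cpx, (int \<Rightarrow> 'a mel \<Rightarrow> 'a mel) set) tricat" where
  "Kb R = with_triangles (Kb_shiftcat R)
     {(X, Y, cone_cpx X Y f,
       (X, Y, htpy_class R X Y f),
       (Y, cone_cpx X Y f,
          htpy_class R Y (cone_cpx X Y f) (\<lambda>i y. Pair \<zero>\<^bsub>cmod X (i + 1)\<^esub> y)),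
       (cone_cpx X Y f, shift_cpx X,
          htpy_class R (cone_cpx X Y f) (shift_cpx X) (\<lambda>i. pfst)))
      | X Y f. bounded_cpx R X \<and> bounded_cpx R Y \<and> chain_map R X Y f}"


section \<open>The bounded derived category and the singularity category\<close>

definition acyclic_cpx :: "('a, 'b) ring_scheme \<Rightarrow> 'a cpx \<Rightarrow> bool" where
  "acyclic_cpx R X \<longleftrightarrow> (\<forall>i. \<forall>x\<in>carrier (cmod X i).
     cdif X i x = \<zero>\<^bsub>cmod X (i + 1)\<^esub> \<longrightarrow> (\<exists>y\<in>carrier (cmod X (i - 1)). cdif X (i - 1) y = x))"

definition Acyc :: "('a, 'b) ring_scheme \<Rightarrow> 'a cpx set" where
  "Acyc R = {X. bounded_cpx R X \<and> acyclic_cpx R X}"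

type_synonym 'a db_mor = "('a cpx, (int \<Rightarrow> 'a mel \<Rightarrow> 'a mel) set) roof set"
type_synonym 'a dsg_mor = "('a cpx, 'a db_mor) roof set"

definition Db :: "('a, 'b) ring_scheme \<Rightarrow> ('a cpx, 'a db_mor) tricat" where
  "Db R = verdier (Kb R) (Acyc R)"

definition Perf :: "('a, 'b) ring_scheme \<Rightarrow> 'a cpx set" where
  "Perf R = {X. \<exists>P. bounded_cpx R P \<and> (\<forall>i. projective_mod R (cmod P i)) \<and> isomorphic (Db R) X P}"

definition Dsg :: "('a, 'b) ring_scheme \<Rightarrow> ('a cpx, 'a dsg_mor) tricat" where
  "Dsg R = verdier (Db R) (Perf R)"

definition Dsg_mult :: "('a, 'b) ring_scheme \<Rightarrow> 'a \<Rightarrow> 'a cpx \<Rightarrow> ('a cpx, 'a dsg_mor) arr" where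
  "Dsg_mult R a X =
     verdier_functor (Db R) (Perf R) (verdier_functor (Kb R) (Acyc R)
       (X, X, htpy_class R X X (\<lambda>i v. a \<odot>\<^bsub>cmod X i\<^esub> v)))"

definition Csub :: "('a, 'b) ring_scheme \<Rightarrow> 'a \<Rightarrow> 'a cpx set" where
  "Csub R x = {X \<in> Ob (Dsg R). Dsg_mult R x X = Nul (Dsg R) X X}"

definition ann_Dsg :: "('a, 'b) ring_scheme \<Rightarrow> 'a set" where
  "ann_Dsg R = {a \<in> carrier R. Csub R a = Ob (Dsg R)}"

end

theory Submission
  imports Defs
begin

text \<open>
  Let \<open>x\<^sub>1, \<dots>, x\<^sub>n\<close> have product \<open>a\<close>, and let \<open>X\<close> be a bounded complex. The proof compares \<open>X\<close>
  with the cone of the multiplication \<open>a : X \<rightarrow> X\<close>.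

  The cone lies in the star of the classes \<open>C(x\<^sub>i)\<close>. If \<open>c = a b\<close>, then the cone of \<open>c\<close> is an
  extension of the cone of \<open>b\<close> by the cone of \<open>a\<close> (\<open>cone_factor_qis\<close>), and the multiplication by
  \<open>a\<close> is null-homotopic on the cone of \<open>a\<close>, as on every Koszul complex (\<open>cone_mult_Csub\<close>).
  Splitting off one factor at a time gives \<open>cone_mult_star_list\<close>.

  The object \<open>X\<close> is a direct summand of the cone. That \<open>a\<close> acts as zero on \<open>X\<close> in the singularity
  category means that there is a chain map \<open>w : V \<rightarrow> X\<close> with perfect cone and \<open>a w\<close> null-homotopic
  (\<open>dsg_arr_eq_NulD\<close>). The cone of \<open>a w\<close> is then the direct sum of \<open>X\<close> and the shift of \<open>V\<close>, and it
  maps to the cone of \<open>a\<close> by a chain map whose cone is again perfect (\<open>N_cone_map\<close>); so the two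
  cones are isomorphic in the singularity category (\<open>Dsg_eq_smd_star_list\<close>).

  The bulk of the text makes this argument legitimate: morphisms of the singularity category are
  classes of roofs of classes of roofs of homotopy classes, and composing them requires a calculus
  of fractions at both levels. The first two sections treat calculi of right fractions abstractly.
  Localising at a set of arrows gives a category with shift in which all choices in the
  composition of roofs are immaterial (\<open>verdier_shift_category\<close>); and if \<open>WP\<close> is a larger set of
  arrows with a calculus of fractions, the fractions with numerator in \<open>WP\<close> have one in the first
  localisation (\<open>WP_fracs_right_fractions\<close>). This avoids proving that the derived category is
  triangulated: everything about cones is checked for chain complexes, where cones are functorial
  and the axioms become explicit formulas.

  For complexes, the arrows with cone in a class \<open>N\<close> that is stable under quasi-isomorphisms, cones
  and shifts have a calculus of right fractions (\<open>cone_arrows_right_fractions\<close>). It is used for the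
  acyclic complexes and for those quasi-isomorphic to bounded complexes of projectives
  (\<open>perfect_cone_class\<close>, which rests on lifting along quasi-isomorphisms). The isomorphisms of the
  derived category are the fractions of two quasi-isomorphisms (\<open>Db_iso_numerator\<close>), and therefore
  the arrows inverted in the second localisation are the fractions whose numerator has a perfect
  cone (\<open>verdier_W_Perf\<close>).
\<close>

text \<open>Arrows are triples; without these two rules quantified arrows would be taken apart into
  source, target and class.\<close>

declare split_paired_Ex [simp del] split_paired_All [simp del]

section \<open>Categories with shift and triangles\<close>

lemma Union_same: "A \<noteq> {} \<Longrightarrow> (\<And>x. x \<in> A \<Longrightarrow> x = y) \<Longrightarrow> \<Union> A = y"
  by blast

lemma with_triangles_simps [simp]:
  "Ob (with_triangles C T) = Ob C" "Hom (with_triangles C T) = Hom C"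
  "Cmp (with_triangles C T) = Cmp C" "Idt (with_triangles C T) = Idt C"
  "Add (with_triangles C T) = Add C" "Nul (with_triangles C T) = Nul C"
  "Sh (with_triangles C T) = Sh C" "ShA (with_triangles C T) = ShA C"
  "Tri (with_triangles C T) = triangle_closure C T"
  by (simp_all add: with_triangles_def shiftcat.defs tricat.defs)

definition inverse_arrows :: "('o, 'e, 'z) shiftcat_scheme \<Rightarrow> 'o \<Rightarrow> 'o \<Rightarrow> ('o, 'e) arr \<Rightarrow> ('o, 'e) arr \<Rightarrow> bool" where
  "inverse_arrows C X Y a b \<longleftrightarrow> a \<in> Hom C X Y \<and> b \<in> Hom C Y X \<and> Cmp C b a = Idt C X \<and> Cmp C a b = Idt C Y"

lemma is_triangle_with_triangles [simp]: "is_triangle (with_triangles C T) = is_triangle C"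
  by (simp add: is_triangle_def)

lemma triangle_iso_with_triangles [simp]: "triangle_iso (with_triangles C T) = triangle_iso C"
  by (simp add: triangle_iso_def is_iso_def)

text \<open>A category with a shift functor, a zero arrow and an addition of parallel arrows. Of the addition
  only closure and distributivity over precomposition are recorded: these two properties pass to
  localisations by an argument about denominators alone, and with them the localisation functor is
  additive.\<close>

locale shift_category =
  fixes C :: "('o, 'e, 'z) shiftcat_scheme"
  assumes hom_ends: "f \<in> Hom C X Y \<Longrightarrow> X \<in> Ob C \<and> Y \<in> Ob C \<and> src f = X \<and> tgt f = Y"
    and Idt_hom: "X \<in> Ob C \<Longrightarrow> Idt C X \<in> Hom C X X"
    and Cmp_hom: "f \<in> Hom C X Y \<Longrightarrow> g \<in> Hom C Y Z \<Longrightarrow> Cmp C g f \<in> Hom C X Z"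
    and Cmp_assoc_hom: "f \<in> Hom C X Y \<Longrightarrow> g \<in> Hom C Y Z \<Longrightarrow> h \<in> Hom C Z T \<Longrightarrow>
      Cmp C (Cmp C h g) f = Cmp C h (Cmp C g f)"
    and Idt_left_hom: "f \<in> Hom C X Y \<Longrightarrow> Cmp C (Idt C Y) f = f"
    and Idt_right_hom: "f \<in> Hom C X Y \<Longrightarrow> Cmp C f (Idt C X) = f"
    and Add_hom: "f \<in> Hom C X Y \<Longrightarrow> g \<in> Hom C X Y \<Longrightarrow> Add C f g \<in> Hom C X Y"
    and Add_Cmp_hom: "h \<in> Hom C X Y \<Longrightarrow> f \<in> Hom C Y Z \<Longrightarrow> g \<in> Hom C Y Z \<Longrightarrow>
      Cmp C (Add C f g) h = Add C (Cmp C f h) (Cmp C g h)"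
    and Nul_hom: "X \<in> Ob C \<Longrightarrow> Y \<in> Ob C \<Longrightarrow> Nul C X Y \<in> Hom C X Y"
    and Sh_Ob: "X \<in> Ob C \<Longrightarrow> Sh C X \<in> Ob C"
    and ShA_hom: "f \<in> Hom C X Y \<Longrightarrow> ShA C f \<in> Hom C (Sh C X) (Sh C Y)"
    and ShA_Idt: "X \<in> Ob C \<Longrightarrow> ShA C (Idt C X) = Idt C (Sh C X)"
    and ShA_Cmp_hom: "f \<in> Hom C X Y \<Longrightarrow> g \<in> Hom C Y Z \<Longrightarrow>
      ShA C (Cmp C g f) = Cmp C (ShA C g) (ShA C f)"
begin

text \<open>Rules with premise \<open>f \<in> Hom C X Y\<close> leave \<open>X\<close> and \<open>Y\<close> to be guessed by the simplifier. As arrows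
  know their ends, typing can be expressed by \<open>arr\<close>, \<open>src\<close> and \<open>tgt\<close>, which it computes.\<close>

definition arr :: "('o, 'e) arr \<Rightarrow> bool" where
  "arr f \<longleftrightarrow> f \<in> Hom C (src f) (tgt f)"

lemma hom_iff: "f \<in> Hom C X Y \<longleftrightarrow> arr f \<and> src f = X \<and> tgt f = Y"
  unfolding arr_def using hom_ends by blast

lemma arr_Ob [simp]: "arr f \<Longrightarrow> src f \<in> Ob C" "arr f \<Longrightarrow> tgt f \<in> Ob C"
  unfolding arr_def using hom_ends by blast+

lemma arr_Idt [simp]:
  assumes "X \<in> Ob C" shows "arr (Idt C X)" "src (Idt C X) = X" "tgt (Idt C X) = X"
  using Idt_hom[OF assms] by (auto simp: hom_iff)

lemma arr_Cmp [simp]: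
  assumes "arr f" "arr g" "src g = tgt f"
  shows "arr (Cmp C g f)" "src (Cmp C g f) = src f" "tgt (Cmp C g f) = tgt g"
  using Cmp_hom[of f "src f" "tgt f" g "tgt g"] assms by (auto simp: hom_iff)

lemma Cmp_assoc [simp]:
  assumes "arr f" "arr g" "arr h" "src g = tgt f" "src h = tgt g"
  shows "Cmp C (Cmp C h g) f = Cmp C h (Cmp C g f)"
  using Cmp_assoc_hom[of f "src f" "tgt f" g "tgt g" h "tgt h"] assms by (auto simp: hom_iff)

lemma Idt_left [simp]: "arr f \<Longrightarrow> tgt f = Y \<Longrightarrow> Cmp C (Idt C Y) f = f"
  using Idt_left_hom[of f "src f"] by (auto simp: hom_iff)

lemma Idt_right [simp]: "arr f \<Longrightarrow> src f = X \<Longrightarrow> Cmp C f (Idt C X) = f"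
  using Idt_right_hom[of f _ "tgt f"] by (auto simp: hom_iff)

lemma arr_Add [simp]:
  assumes "arr f" "arr g" "src f = src g" "tgt f = tgt g"
  shows "arr (Add C f g)" "src (Add C f g) = src g" "tgt (Add C f g) = tgt g"
  using Add_hom[of f "src f" "tgt f" g] assms by (auto simp: hom_iff)

lemma Add_Cmp:
  assumes "arr f" "arr g" "arr h" "src f = tgt h" "src g = tgt h" "tgt f = tgt g"
  shows "Cmp C (Add C f g) h = Add C (Cmp C f h) (Cmp C g h)"
  using Add_Cmp_hom[of h "src h" "tgt h" f "tgt f" g] assms by (auto simp: hom_iff)

lemma arr_Nul [simp]:
  assumes "X \<in> Ob C" "Y \<in> Ob C"
  shows "arr (Nul C X Y)" "src (Nul C X Y) = X" "tgt (Nul C X Y) = Y"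
  using Nul_hom[OF assms] by (auto simp: hom_iff)

lemma arr_ShA [simp]:
  assumes "arr f" shows "arr (ShA C f)" "src (ShA C f) = Sh C (src f)" "tgt (ShA C f) = Sh C (tgt f)"
  using ShA_hom[of f "src f" "tgt f"] assms by (auto simp: hom_iff)

lemma ShA_Cmp [simp]:
  assumes "arr f" "arr g" "src g = tgt f"
  shows "ShA C (Cmp C g f) = Cmp C (ShA C g) (ShA C f)"
  using ShA_Cmp_hom[of f "src f" "tgt f" g "tgt g"] assms by (auto simp: hom_iff)

declare ShA_Idt [simp] Sh_Ob [simp]

lemma Cmp_eq_extend:
  assumes "Cmp C a b = Cmp C c d" "arr a" "arr b" "arr c" "arr d" "arr w"
    "src a = tgt b" "src c = tgt d" "src b = tgt w" "src d = tgt w"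
  shows "Cmp C a (Cmp C b w) = Cmp C c (Cmp C d w)"
  using assms Cmp_assoc[of w b a] Cmp_assoc[of w d c] by simp

lemma is_iso_iff:
  "is_iso C X Y f \<longleftrightarrow> f \<in> Hom C X Y \<and>
     (\<exists>g\<in>Hom C Y X. Cmp C g f = Idt C X \<and> Cmp C f g = Idt C Y)"
  unfolding is_iso_def using hom_ends by blast

lemma is_iso_Idt: "X \<in> Ob C \<Longrightarrow> is_iso C X X (Idt C X)"
  unfolding is_iso_iff using Idt_hom by (auto intro!: bexI[of _ "Idt C X"])

lemma is_iso_inverse_arrows: "is_iso C X Y a \<longleftrightarrow> (\<exists>b. inverse_arrows C X Y a b)"
  unfolding is_iso_iff inverse_arrows_def by blast

lemma inverse_arrows_Idt: "X \<in> Ob C \<Longrightarrow> inverse_arrows C X X (Idt C X) (Idt C X)"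
  using Idt_hom by (auto simp: inverse_arrows_def)

lemma inverse_arrows_sym: "inverse_arrows C X Y a b \<Longrightarrow> inverse_arrows C Y X b a"
  by (auto simp: inverse_arrows_def)

text \<open>The generating triangles belong to the closure because identities give an isomorphism of
  triangles; this uses that the shift is a functor.\<close>

lemma triangle_closureI:
  assumes "t \<in> T" "is_triangle C t" shows "t \<in> triangle_closure C T"
proof -
  obtain X Y Z f g h where t: "t = (X, Y, Z, f, g, h)" by (metis surj_pair)
  note h = assms(2)[unfolded t is_triangle_def prod.case hom_iff]
  have "triangle_iso C t t" unfolding t triangle_iso_def prod.case
    by (rule exI[of _ "Idt C X"], rule exI[of _ "Idt C Y"], rule exI[of _ "Idt C Z"])
      (use h is_iso_Idt in auto)
  then show ?thesis using assms by (auto simp: triangle_closure_def)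
qed

lemma is_iso_Cmp:
  assumes "is_iso C X Y f" "is_iso C Y Z g" shows "is_iso C X Z (Cmp C g f)"
proof -
  from assms obtain f' g' where
    "f \<in> Hom C X Y" "f' \<in> Hom C Y X" "Cmp C f' f = Idt C X" "Cmp C f f' = Idt C Y"
    "g \<in> Hom C Y Z" "g' \<in> Hom C Z Y" "Cmp C g' g = Idt C Y" "Cmp C g g' = Idt C Z"
    by (auto simp: is_iso_iff)
  note h = this[unfolded hom_iff]
  have 1: "Cmp C g' (Cmp C g f) = f"
    using h Cmp_assoc[of f g g'] by (metis Idt_left)
  have 2: "Cmp C f (Cmp C f' g') = g'"
    using h Cmp_assoc[of g' f' f] by (metis Idt_left)
  show ?thesis unfolding is_iso_iff
    by (intro conjI bexI[of _ "Cmp C f' g'"]) (use h 1 2 in \<open>auto simp: hom_iff\<close>)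
qed

lemma isomorphic_trans: "isomorphic C X Y \<Longrightarrow> isomorphic C Y Z \<Longrightarrow> isomorphic C X Z"
  unfolding isomorphic_def using is_iso_Cmp by blast

lemma isomorphic_sym: "isomorphic C X Y \<Longrightarrow> isomorphic C Y X"
  unfolding isomorphic_def is_iso_iff by blast

end

section \<open>Localisation at a calculus of right fractions\<close>

locale right_fractions = shift_category C
  for C :: "('o, 'e, 'z) shiftcat_scheme" +
  fixes W :: "('o, 'e) arr set"
  assumes W_Idt: "X \<in> Ob C \<Longrightarrow> Idt C X \<in> W"
    and W_Cmp: "f \<in> W \<Longrightarrow> g \<in> W \<Longrightarrow> arr f \<Longrightarrow> arr g \<Longrightarrow> src g = tgt f \<Longrightarrow> Cmp C g f \<in> W"
    and W_ore: "s \<in> W \<Longrightarrow> arr s \<Longrightarrow> arr f \<Longrightarrow> tgt f = tgt s \<Longrightarrow>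
      \<exists>u t. arr u \<and> arr t \<and> t \<in> W \<and> src u = src t \<and> tgt t = src f \<and> tgt u = src s \<and>
        Cmp C s u = Cmp C f t"
    and W_cancel: "s \<in> W \<Longrightarrow> arr s \<Longrightarrow> arr f \<Longrightarrow> arr g \<Longrightarrow> tgt f = src s \<Longrightarrow> tgt g = src s \<Longrightarrow>
      src f = src g \<Longrightarrow> Cmp C s f = Cmp C s g \<Longrightarrow>
      \<exists>t. arr t \<and> t \<in> W \<and> tgt t = src g \<and> Cmp C f t = Cmp C g t"
    and W_ShA: "s \<in> W \<Longrightarrow> arr s \<Longrightarrow> ShA C s \<in> W"

locale verdier_fractions = right_fractions C "verdier_W C N"
  for C :: "('o, 'e) tricat" and N :: "'o set"
begin

abbreviation "W \<equiv> verdier_W C N"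
abbreviation "D \<equiv> verdier C N"

definition roof :: "'o \<Rightarrow> 'o \<Rightarrow> ('o, 'e) arr \<Rightarrow> ('o, 'e) arr \<Rightarrow> bool" where
  "roof X Y s f \<longleftrightarrow> arr s \<and> arr f \<and> s \<in> W \<and> src f = src s \<and> tgt s = X \<and> tgt f = Y"

definition frac :: "'o \<Rightarrow> 'o \<Rightarrow> ('o, 'e) arr \<Rightarrow> ('o, 'e) arr \<Rightarrow> ('o, ('o, 'e) roof set) arr" where
  "frac X Y s f = (X, Y, roof_class C N X Y (s, f))"

lemma roof_Ob: "roof X Y s f \<Longrightarrow> X \<in> Ob C \<and> Y \<in> Ob C"
  by (auto simp: roof_def)

lemma roofs_iff: "(s, f) \<in> roofs C N X Y \<longleftrightarrow> roof X Y s f"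
  by (auto simp: roofs_def roof_def hom_iff)

definition refines where
  "refines s f s' f' u v \<longleftrightarrow> arr u \<and> arr v \<and> src u = src v \<and> tgt u = src s \<and> tgt v = src s' \<and>
        Cmp C s u = Cmp C s' v \<and> Cmp C s u \<in> W \<and> Cmp C f u = Cmp C f' v"

lemma roof_eq_iff:
  "((s, f), (s', f')) \<in> roof_eq C N X Y \<longleftrightarrow> roof X Y s f \<and> roof X Y s' f' \<and>
     (\<exists>u v. refines s f s' f' u v)"
proof -
  have "(\<exists>V\<in>Ob C. \<exists>u\<in>Hom C V (src s). \<exists>v\<in>Hom C V (src s').
        Cmp C s u = Cmp C s' v \<and> Cmp C s u \<in> W \<and> Cmp C f u = Cmp C f' v) \<longleftrightarrow>
      (\<exists>u v. refines s f s' f' u v)"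
    unfolding refines_def Bex_def hom_iff
    by (rule iffI; elim exE conjE; metis arr_Ob(1))
  then show ?thesis by (simp add: roof_eq_def roofs_iff)
qed

lemma roof_eq_refine:
  assumes "roof X Y s f" "arr w" "tgt w = src s" "Cmp C s w \<in> W"
  shows "((s, f), (Cmp C s w, Cmp C f w)) \<in> roof_eq C N X Y"
  unfolding roof_eq_iff
  by (intro conjI exI[of _ w] exI[of _ "Idt C (src w)"])
    (use assms in \<open>auto simp: roof_def refines_def\<close>)

lemma roof_eq_refl: "roof X Y s f \<Longrightarrow> ((s, f), (s, f)) \<in> roof_eq C N X Y"
  using roof_eq_refine[of X Y s f "Idt C (src s)"] by (simp add: roof_def)

lemma roof_eq_sym: "(r, r') \<in> roof_eq C N X Y \<Longrightarrow> (r', r) \<in> roof_eq C N X Y"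
proof (cases r, cases r')
  fix s f s' f' assume *: "(r, r') \<in> roof_eq C N X Y" "r = (s, f)" "r' = (s', f')"
  then obtain u v where "refines s f s' f' u v" by (auto simp: roof_eq_iff)
  then have "refines s' f' s f v u" by (auto simp: refines_def)
  with * show ?thesis by (auto simp: roof_eq_iff)
qed

text \<open>Two refinements \<open>s v\<close> and \<open>s v'\<close> of a denominator have a common refinement: an Ore square makes
  them agree after composition with \<open>s\<close>, and then \<open>s\<close> is cancelled.\<close>

lemma common_refinement:
  assumes s: "arr s" "arr v" "arr v'" "tgt v = src s" "tgt v' = src s" "s \<in> W"
    and "Cmp C s v \<in> W" "Cmp C s v' \<in> W"
  shows "\<exists>a b. arr a \<and> arr b \<and> src a = src b \<and> tgt a = src v \<and> tgt b = src v' \<and>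
    Cmp C v a = Cmp C v' b \<and> Cmp C s (Cmp C v' b) \<in> W \<and> b \<in> W"
proof -
  obtain a b where ab: "arr a" "arr b" "b \<in> W" "src a = src b" "tgt b = src v'" "tgt a = src v"
    "Cmp C (Cmp C s v) a = Cmp C (Cmp C s v') b"
    using W_ore[of "Cmp C s v" "Cmp C s v'"] assms by auto
  then have "Cmp C s (Cmp C v a) = Cmp C s (Cmp C v' b)" using s by simp
  then obtain c where c: "arr c" "c \<in> W" "tgt c = src b" "Cmp C (Cmp C v a) c = Cmp C (Cmp C v' b) c"
    using W_cancel[of s "Cmp C v a" "Cmp C v' b"] s ab by auto
  have "Cmp C (Cmp C s v') (Cmp C b c) \<in> W"
    by (rule W_Cmp) (use assms ab c W_Cmp in auto)
  then show ?thesis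
    by (intro exI[of _ "Cmp C a c"] exI[of _ "Cmp C b c"]) (use s ab c W_Cmp in auto)
qed

lemma roof_eq_trans:
  assumes "(r, r') \<in> roof_eq C N X Y" "(r', r'') \<in> roof_eq C N X Y"
  shows "(r, r'') \<in> roof_eq C N X Y"
proof -
  obtain s f s' f' s'' f'' where r: "r = (s, f)" "r' = (s', f')" "r'' = (s'', f'')"
    by (metis surj_pair)
  obtain u v u' v' where uv: "refines s f s' f' u v" "refines s' f' s'' f'' u' v'"
    and ro: "roof X Y s f" "roof X Y s' f'" "roof X Y s'' f''"
    using assms by (auto simp: r roof_eq_iff)
  note h = uv[unfolded refines_def] ro[unfolded roof_def]
  obtain a b where ab: "arr a" "arr b" "src a = src b" "tgt a = src v" "tgt b = src u'"
      "Cmp C v a = Cmp C u' b" "Cmp C s' (Cmp C u' b) \<in> W"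
    using common_refinement[of s' v u'] h by auto
  have "Cmp C s (Cmp C u a) = Cmp C s' (Cmp C v a)" "Cmp C f (Cmp C u a) = Cmp C f' (Cmp C v a)"
    "Cmp C s' (Cmp C u' b) = Cmp C s'' (Cmp C v' b)" "Cmp C f' (Cmp C u' b) = Cmp C f'' (Cmp C v' b)"
    by (rule Cmp_eq_extend; use h ab in simp)+
  then have "refines s f s'' f'' (Cmp C u a) (Cmp C v' b)"
    using h ab by (auto simp: refines_def)
  then show ?thesis using ro by (auto simp: r roof_eq_iff)
qed

lemma roof_class_eq_iff:
  assumes "roof X Y s f"
  shows "roof_class C N X Y (s, f) = roof_class C N X Y (s', f') \<longleftrightarrow>
    ((s, f), (s', f')) \<in> roof_eq C N X Y"
  unfolding roof_class_def Image_singleton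
  using roof_eq_refl[OF assms] roof_eq_sym roof_eq_trans by blast

lemma frac_eq_iff:
  assumes "roof X Y s f"
  shows "frac X Y s f = frac X Y s' f' \<longleftrightarrow> roof X Y s' f' \<and> (\<exists>u v. refines s f s' f' u v)"
  unfolding frac_def using roof_class_eq_iff[OF assms] assms by (auto simp: roof_eq_iff)

lemma frac_eqI: "((s, f), (s', f')) \<in> roof_eq C N X Y \<Longrightarrow> frac X Y s f = frac X Y s' f'"
  by (simp add: frac_eq_iff roof_eq_iff)

lemma frac_refine:
  assumes "roof X Y s f" "arr w" "tgt w = src s" "Cmp C s w \<in> W"
  shows "frac X Y (Cmp C s w) (Cmp C f w) = frac X Y s f"
  using frac_eqI[OF roof_eq_refine[OF assms]] by simp

text \<open>The Ore squares that enter the composition of a roof ending in \<open>f\<close> with one starting in \<open>t\<close>.\<close>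

definition completes where
  "completes f t s' f' \<longleftrightarrow> arr s' \<and> arr f' \<and> s' \<in> W \<and> src s' = src f' \<and> tgt s' = src f \<and>
     tgt f' = src t \<and> Cmp C t f' = Cmp C f s'"

lemma completes_exists:
  assumes "roof X Y s f" "roof Y Z t g" shows "\<exists>s' f'. completes f t s' f'"
  using W_ore[of t f] assms by (auto simp: completes_def roof_def) metis

lemma roof_comp:
  assumes "roof X Y s f" "roof Y Z t g" "completes f t s' f'"
  shows "roof X Z (Cmp C s s') (Cmp C g f')"
  using assms W_Cmp by (auto simp: roof_def completes_def)

text \<open>Two Ore squares on the same cospan have a common refinement of their denominators, after which
  their other legs agree once composed with \<open>t\<close>; cancelling \<open>t\<close> refines both composites to one
  roof.\<close>

lemma comp_indep_completion:
  assumes r: "roof X Y s f" "roof Y Z t g" and c: "completes f t s' f'" "completes f t s'' f''"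
  shows "frac X Z (Cmp C s s') (Cmp C g f') = frac X Z (Cmp C s s'') (Cmp C g f'')"
proof -
  note h = r[unfolded roof_def] c[unfolded completes_def]
  obtain a b where ab: "arr a" "arr b" "src a = src b" "tgt a = src s'" "tgt b = src s''"
    "Cmp C s' a = Cmp C s'' b" "b \<in> W"
    using W_ore[of s' s''] h by metis
  have "Cmp C t (Cmp C f' a) = Cmp C f (Cmp C s' a)"
    by (rule Cmp_eq_extend) (use h ab in auto)
  moreover have "Cmp C t (Cmp C f'' b) = Cmp C f (Cmp C s'' b)"
    by (rule Cmp_eq_extend) (use h ab in auto)
  ultimately have "Cmp C t (Cmp C f' a) = Cmp C t (Cmp C f'' b)" using ab by simp
  then obtain w where w: "arr w" "w \<in> W" "tgt w = src b" "Cmp C (Cmp C f' a) w = Cmp C (Cmp C f'' b) w"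
    using W_cancel[of t "Cmp C f' a" "Cmp C f'' b"] h ab by auto
  have sw: "Cmp C s' (Cmp C a w) = Cmp C s'' (Cmp C b w)"
    using h ab w by (auto intro!: Cmp_eq_extend)
  have "Cmp C s'' (Cmp C b w) \<in> W" using W_Cmp h ab w by auto
  then have "Cmp C s (Cmp C s'' (Cmp C b w)) \<in> W" using W_Cmp h ab w by auto
  then have "refines (Cmp C s s') (Cmp C g f') (Cmp C s s'') (Cmp C g f'') (Cmp C a w) (Cmp C b w)"
    using h ab w sw by (auto simp: refines_def)
  then show ?thesis
    using frac_eq_iff[OF roof_comp[OF r c(1)]] roof_comp[OF r c(2)] by blast
qed

text \<open>Equivalent roofs have a common refinement, so independence of representatives reduces to
  refining one of the two factors. Here an Ore square for the refined factor is, after composition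
  with \<open>w\<close>, one for the original factor.\<close>

lemma comp_indep_left:
  assumes r: "roof X Y s f" "roof Y Z t g" "arr w" "tgt w = src t" "Cmp C t w \<in> W"
    and c: "completes f t s' f'" "completes f (Cmp C t w) s'' f''"
  shows "frac X Z (Cmp C s s') (Cmp C g f') = frac X Z (Cmp C s s'') (Cmp C (Cmp C g w) f'')"
proof -
  have "completes f t s'' (Cmp C w f'')" using c r by (auto simp: completes_def roof_def)
  from comp_indep_completion[OF r(1,2) c(1) this] show ?thesis
    using c r by (auto simp: completes_def roof_def)
qed

text \<open>An Ore square for \<open>f\<close> is turned into one for \<open>f w\<close> by another Ore square, of \<open>s'\<close> and \<open>w\<close>;
  the composites then differ by a refinement.\<close>

lemma comp_indep_right:
  assumes r: "roof X Y s f" "roof Y Z t g" "arr w" "tgt w = src s" "Cmp C s w \<in> W"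
    and c: "completes f t s' f'" "completes (Cmp C f w) t s'' f''"
  shows "frac X Z (Cmp C s s') (Cmp C g f') = frac X Z (Cmp C (Cmp C s w) s'') (Cmp C g f'')"
proof -
  note h = r[unfolded roof_def] c[unfolded completes_def]
  have r': "roof X Y (Cmp C s w) (Cmp C f w)" using h by (auto simp: roof_def)
  obtain w' v where v: "arr w'" "arr v" "v \<in> W" "src w' = src v" "tgt w' = src s'" "tgt v = src w"
    "Cmp C s' w' = Cmp C w v" using W_ore[of s' w] h by metis
  have "Cmp C t (Cmp C f' w') = Cmp C f (Cmp C s' w')"
    by (rule Cmp_eq_extend) (use h v in auto)
  then have c': "completes (Cmp C f w) t v (Cmp C f' w')" using h v by (auto simp: completes_def)
  have W: "Cmp C (Cmp C s w) v \<in> W" by (rule W_Cmp) (use h v r(3-5) in auto)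
  have e: "Cmp C (Cmp C s w) v = Cmp C (Cmp C s s') w'" using h v by auto
  have "frac X Z (Cmp C s s') (Cmp C g f') =
      frac X Z (Cmp C (Cmp C s s') w') (Cmp C (Cmp C g f') w')"
    by (rule frac_refine[symmetric]) (use roof_comp[OF r(1,2) c(1)] h v W e in auto)
  also have "\<dots> = frac X Z (Cmp C (Cmp C s w) v) (Cmp C g (Cmp C f' w'))"
    using e h v by simp
  also have "\<dots> = frac X Z (Cmp C (Cmp C s w) s'') (Cmp C g f'')"
    by (rule comp_indep_completion[OF r' r(2) c' c(2)])
  finally show ?thesis .
qed

lemma comp_well_defined:
  assumes e: "((s, f), (s1, f1)) \<in> roof_eq C N X Y" "((t, g), (t1, g1)) \<in> roof_eq C N Y Z"
    and c: "completes f t s' f'" "completes f1 t1 s1' f1'"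
  shows "frac X Z (Cmp C s s') (Cmp C g f') = frac X Z (Cmp C s1 s1') (Cmp C g1 f1')"
proof -
  obtain u v where uv: "refines s f s1 f1 u v" and r: "roof X Y s f" "roof X Y s1 f1"
    using e(1) by (auto simp: roof_eq_iff)
  obtain u' v' where uv': "refines t g t1 g1 u' v'" and r': "roof Y Z t g" "roof Y Z t1 g1"
    using e(2) by (auto simp: roof_eq_iff)
  have ru: "roof X Y (Cmp C s u) (Cmp C f u)" "roof Y Z (Cmp C t u') (Cmp C g u')"
    using r r' uv uv' by (auto simp: roof_def refines_def)
  obtain a b where ab: "completes (Cmp C f u) t a b" using completes_exists[OF ru(1) r'(1)] by blast
  obtain a' b' where ab': "completes (Cmp C f u) (Cmp C t u') a' b'"
    using completes_exists[OF ru(1) ru(2)] by blast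
  obtain a1 b1 where ab1: "completes (Cmp C f u) t1 a1 b1"
    using completes_exists[OF ru(1) r'(2)] by blast
  have "frac X Z (Cmp C s s') (Cmp C g f') = frac X Z (Cmp C (Cmp C s u) a) (Cmp C g b)"
    by (rule comp_indep_right[OF r(1) r'(1) _ _ _ c(1) ab]) (use uv in \<open>auto simp: refines_def\<close>)
  also have "\<dots> = frac X Z (Cmp C (Cmp C s u) a') (Cmp C (Cmp C g u') b')"
    by (rule comp_indep_left[OF ru(1) r'(1) _ _ _ ab ab']) (use uv' in \<open>auto simp: refines_def\<close>)
  also have "\<dots> = frac X Z (Cmp C (Cmp C s u) a1) (Cmp C g1 b1)"
  proof -
    have e': "Cmp C t u' = Cmp C t1 v'" "Cmp C g u' = Cmp C g1 v'" using uv' by (auto simp: refines_def)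
    show ?thesis unfolding e'
      by (rule comp_indep_left[OF ru(1) r'(2) _ _ _ ab1 ab'[unfolded e'], symmetric])
        (use uv' in \<open>auto simp: refines_def\<close>)
  qed
  also have "\<dots> = frac X Z (Cmp C s1 s1') (Cmp C g1 f1')"
  proof -
    have e': "Cmp C s u = Cmp C s1 v" "Cmp C f u = Cmp C f1 v" using uv by (auto simp: refines_def)
    show ?thesis unfolding e'
      by (rule comp_indep_right[OF r(2) r'(2) _ _ _ c(2) ab1[unfolded e'], symmetric])
        (use uv in \<open>auto simp: refines_def\<close>)
  qed
  finally show ?thesis .
qed

lemma verdier_simps [simp]:
  "Ob D = Ob C" "Sh D = Sh C"
  "Nul D X Y = frac X Y (Idt C X) (Nul C X Y)"
  "Idt D X = frac X X (Idt C X) (Idt C X)"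
  by (simp_all add: verdier_def verdier_shiftcat_def frac_def)

lemma verdier_functor_frac: "verdier_functor C N f = frac (src f) (tgt f) (Idt C (src f)) f"
  by (simp add: verdier_functor_def frac_def)

lemma Hom_verdier: "Hom D X Y = {frac X Y s f | s f. roof X Y s f}"
proof -
  have 1: "Hom D X Y = {(X, Y, roof_class C N X Y r) | r. X \<in> Ob C \<and> Y \<in> Ob C \<and> r \<in> roofs C N X Y}"
    by (simp add: verdier_def verdier_shiftcat_def)
  show ?thesis unfolding 1 frac_def
    by (rule Collect_cong) (metis roof_Ob roofs_iff surj_pair)
qed

lemma mem_roof_class: "r' \<in> roof_class C N X Y r \<longleftrightarrow> (r, r') \<in> roof_eq C N X Y"
  by (simp add: roof_class_def)

lemma Cmp_frac:
  assumes r: "roof X Y s f" "roof Y Z t g" and c: "completes f t s' f'"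
  shows "Cmp D (frac Y Z t g) (frac X Y s f) = frac X Z (Cmp C s s') (Cmp C g f')"
proof -
  have "\<Union> {roof_class C N X Z (Cmp C s1 s', Cmp C g1 f') | s1 f1 t1 g1 s' f' V.
             (s1, f1) \<in> roof_class C N X Y (s, f) \<and> (t1, g1) \<in> roof_class C N Y Z (t, g) \<and> V \<in> Ob C \<and>
             s' \<in> Hom C V (src f1) \<and> s' \<in> W \<and> f' \<in> Hom C V (src g1) \<and> Cmp C t1 f' = Cmp C f1 s'}
     = roof_class C N X Z (Cmp C s s', Cmp C g f')" (is "\<Union>?A = ?B")
  proof (rule Union_same)
    have "?B \<in> ?A"
      by (rule CollectI, rule exI[of _ s], rule exI[of _ f], rule exI[of _ t], rule exI[of _ g],
          rule exI[of _ s'], rule exI[of _ f'], rule exI[of _ "src s'"])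
        (use r c roof_eq_refl[OF r(1)] roof_eq_refl[OF r(2)] in
          \<open>auto simp: mem_roof_class completes_def hom_iff roof_def\<close>)
    then show "?A \<noteq> {}" by blast
    fix B assume "B \<in> ?A"
    then obtain s1 f1 t1 g1 s1' f1' V where B: "B = roof_class C N X Z (Cmp C s1 s1', Cmp C g1 f1')"
      and m: "((s, f), (s1, f1)) \<in> roof_eq C N X Y" "((t, g), (t1, g1)) \<in> roof_eq C N Y Z"
      "s1' \<in> Hom C V (src f1)" "s1' \<in> W" "f1' \<in> Hom C V (src g1)" "Cmp C t1 f1' = Cmp C f1 s1'"
      by (auto simp: mem_roof_class)
    have "completes f1 t1 s1' f1'" using m by (auto simp: completes_def hom_iff roof_eq_iff roof_def)
    from comp_well_defined[OF m(1,2) c this] show "B = ?B" by (simp add: B frac_def)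
  qed
  then show ?thesis
    by (simp add: verdier_def verdier_shiftcat_def frac_def)
qed

text \<open>The refinements that identify the two numerators with their counterparts are different in
  general. They are first made equal over \<open>s\<close> by \<open>common_refinement\<close>, then over \<open>s1\<close> by cancellation.\<close>

lemma Add_well_defined:
  assumes e: "((s, f), (s1, f1)) \<in> roof_eq C N X Y" "((s, g), (s1, g1)) \<in> roof_eq C N X Y"
  shows "frac X Y s (Add C f g) = frac X Y s1 (Add C f1 g1)"
proof -
  obtain u v u' v' where uv: "refines s f s1 f1 u v" "refines s g s1 g1 u' v'"
    and ro: "roof X Y s f" "roof X Y s g" "roof X Y s1 f1" "roof X Y s1 g1"
    using e by (auto simp: roof_eq_iff)
  note h = uv[unfolded refines_def] ro[unfolded roof_def]
  obtain a b where ab: "arr a" "arr b" "src a = src b" "tgt a = src u" "tgt b = src u'"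
      "Cmp C u a = Cmp C u' b" "Cmp C s (Cmp C u' b) \<in> W" "b \<in> W"
    using common_refinement[of s u u'] h by auto
  have e: "Cmp C s (Cmp C u a) = Cmp C s1 (Cmp C v a)" "Cmp C s (Cmp C u' b) = Cmp C s1 (Cmp C v' b)"
    "Cmp C f (Cmp C u a) = Cmp C f1 (Cmp C v a)" "Cmp C g (Cmp C u' b) = Cmp C g1 (Cmp C v' b)"
    by (rule Cmp_eq_extend; use h ab in simp)+
  then have *: "Cmp C s1 (Cmp C v a) = Cmp C s1 (Cmp C v' b)" using ab by simp
  obtain c where c: "arr c" "c \<in> W" "tgt c = src b" "Cmp C (Cmp C v a) c = Cmp C (Cmp C v' b) c"
  proof -
    have "arr (Cmp C v a)" "arr (Cmp C v' b)" "tgt (Cmp C v a) = src s1" "tgt (Cmp C v' b) = src s1"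
      "src (Cmp C v a) = src (Cmp C v' b)" "src (Cmp C v' b) = src b" "s1 \<in> W" "arr s1"
      using h ab(1-5) by simp_all
    with W_cancel[of s1 "Cmp C v a" "Cmp C v' b"] *
    show ?thesis using that by metis
  qed
  define u1 v1 where "u1 = Cmp C u (Cmp C a c)" and "v1 = Cmp C v (Cmp C a c)"
  have ty: "arr u1" "arr v1" "src u1 = src c" "src v1 = src c" "tgt u1 = src s" "tgt v1 = src s1"
    unfolding u1_def v1_def using h ab(1-5) c(1-3) by simp_all
  have "u1 = Cmp C u' (Cmp C b c)" unfolding u1_def
    by (rule Cmp_eq_extend[OF ab(6)]) (use h ab(1-5) c(1-3) in simp_all)
  moreover have "v1 = Cmp C (Cmp C v a) c" "Cmp C v' (Cmp C b c) = Cmp C (Cmp C v' b) c"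
    unfolding v1_def using h ab(1-5) c(1-3) by simp_all
  ultimately have uu: "u1 = Cmp C u' (Cmp C b c)" "v1 = Cmp C v' (Cmp C b c)" using c(4) by simp_all
  have "Cmp C s u1 = Cmp C (Cmp C s (Cmp C u' b)) c" "arr (Cmp C s (Cmp C u' b))"
    "src (Cmp C s (Cmp C u' b)) = tgt c"
    unfolding uu using h ab(1-5) c(1-3) by simp_all
  then have W: "Cmp C s u1 \<in> W" using W_Cmp[of c "Cmp C s (Cmp C u' b)"] ab(7) c by simp
  have e2: "Cmp C s u1 = Cmp C s1 v1" "Cmp C f u1 = Cmp C f1 v1" unfolding u1_def v1_def
    by (rule Cmp_eq_extend; use h ab(1-5) c(1-3) in simp)+
  have e3: "Cmp C g u1 = Cmp C g1 v1"
    unfolding uu by (rule Cmp_eq_extend; use h ab(1-5) c(1-3) in simp)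
  have "Cmp C (Add C f g) u1 = Cmp C (Add C f1 g1) v1"
    using e2 e3 ty ro by (simp add: Add_Cmp roof_def)
  then have "refines s (Add C f g) s1 (Add C f1 g1) u1 v1"
    using ty W e2 unfolding refines_def by simp
  moreover have "roof X Y s (Add C f g)" "roof X Y s1 (Add C f1 g1)" using h by (auto simp: roof_def)
  ultimately show ?thesis using frac_eq_iff by blast
qed

lemma Add_frac:
  assumes r: "roof X Y s f" "roof X Y s g"
  shows "Add D (frac X Y s f) (frac X Y s g) = frac X Y s (Add C f g)"
proof -
  have "\<Union> {roof_class C N X Y (s1, Add C f1 g1) | s1 f1 g1.
      (s1, f1) \<in> roof_class C N X Y (s, f) \<and> (s1, g1) \<in> roof_class C N X Y (s, g)}
     = roof_class C N X Y (s, Add C f g)" (is "\<Union>?A = ?B")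
  proof (rule Union_same)
    have "?B \<in> ?A"
      by (rule CollectI, rule exI[of _ s], rule exI[of _ f], rule exI[of _ g])
        (use roof_eq_refl[OF r(1)] roof_eq_refl[OF r(2)] in \<open>auto simp: mem_roof_class\<close>)
    then show "?A \<noteq> {}" by blast
    fix B assume "B \<in> ?A"
    then obtain s1 f1 g1 where B: "B = roof_class C N X Y (s1, Add C f1 g1)"
      and "((s, f), (s1, f1)) \<in> roof_eq C N X Y" "((s, g), (s1, g1)) \<in> roof_eq C N X Y"
      unfolding mem_roof_class by blast
    from Add_well_defined[OF this(2,3)] show "B = ?B" by (simp add: B frac_def)
  qed
  then show ?thesis
    by (simp add: verdier_def verdier_shiftcat_def frac_def)
qed

lemma ShA_frac:
  assumes r: "roof X Y s f"
  shows "ShA D (frac X Y s f) = frac (Sh C X) (Sh C Y) (ShA C s) (ShA C f)"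
proof -
  have "\<Union> {roof_class C N (Sh C X) (Sh C Y) (ShA C s1, ShA C f1) | s1 f1.
      (s1, f1) \<in> roof_class C N X Y (s, f)}
     = roof_class C N (Sh C X) (Sh C Y) (ShA C s, ShA C f)" (is "\<Union>?A = ?B")
  proof (rule Union_same)
    have "?B \<in> ?A"
      by (rule CollectI, rule exI[of _ s], rule exI[of _ f])
        (use roof_eq_refl[OF r] in \<open>auto simp: mem_roof_class\<close>)
    then show "?A \<noteq> {}" by blast
    fix B assume "B \<in> ?A"
    then obtain s1 f1 where B: "B = roof_class C N (Sh C X) (Sh C Y) (ShA C s1, ShA C f1)"
      and "((s, f), (s1, f1)) \<in> roof_eq C N X Y" by (auto simp: mem_roof_class)
    then obtain u v where uv: "refines s f s1 f1 u v" and r1: "roof X Y s1 f1"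
      by (auto simp: roof_eq_iff)
    note h = uv[unfolded refines_def] r[unfolded roof_def] r1[unfolded roof_def]
    have "Cmp C (ShA C s) (ShA C u) = Cmp C (ShA C s1) (ShA C v)"
      "Cmp C (ShA C f) (ShA C u) = Cmp C (ShA C f1) (ShA C v)"
      using h by (metis ShA_Cmp)+
    moreover have "Cmp C (ShA C s) (ShA C u) \<in> W"
    proof -
      have "Cmp C s u \<in> W" "arr (Cmp C s u)" using h by (blast, simp)
      then have "ShA C (Cmp C s u) \<in> W" by (rule W_ShA)
      moreover have "ShA C (Cmp C s u) = Cmp C (ShA C s) (ShA C u)" using h by (intro ShA_Cmp) simp_all
      ultimately show ?thesis by simp
    qed
    ultimately have "refines (ShA C s) (ShA C f) (ShA C s1) (ShA C f1) (ShA C u) (ShA C v)"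
      using h by (auto simp: refines_def)
    moreover have "roof (Sh C X) (Sh C Y) (ShA C s) (ShA C f)"
      "roof (Sh C X) (Sh C Y) (ShA C s1) (ShA C f1)"
      using r r1 W_ShA by (auto simp: roof_def)
    ultimately have "frac (Sh C X) (Sh C Y) (ShA C s) (ShA C f) = frac (Sh C X) (Sh C Y) (ShA C s1) (ShA C f1)"
      using frac_eq_iff by blast
    then show "B = ?B" by (simp add: B frac_def)
  qed
  then show ?thesis
    by (simp add: verdier_def verdier_shiftcat_def frac_def)
qed

text \<open>An Ore square of the two denominators.\<close>

lemma common_denominator:
  assumes "\<phi> \<in> Hom D X Y" "\<psi> \<in> Hom D X Z"
  shows "\<exists>s f g. roof X Y s f \<and> roof X Z s g \<and> \<phi> = frac X Y s f \<and> \<psi> = frac X Z s g"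
proof -
  obtain s f t g where r: "roof X Y s f" "roof X Z t g" and e: "\<phi> = frac X Y s f" "\<psi> = frac X Z t g"
    using assms by (auto simp: Hom_verdier)
  obtain u v where uv: "arr u" "arr v" "v \<in> W" "src u = src v" "tgt v = src t" "tgt u = src s"
    "Cmp C s u = Cmp C t v"
    using W_ore[of s t] r unfolding roof_def by metis
  have W: "Cmp C t v \<in> W" using W_Cmp[of v t] r uv by (auto simp: roof_def)
  have "\<phi> = frac X Y (Cmp C t v) (Cmp C f u)" "\<psi> = frac X Z (Cmp C t v) (Cmp C g v)"
    using frac_refine[OF r(1), of u] frac_refine[OF r(2), of v] uv W e by auto
  moreover have "roof X Y (Cmp C t v) (Cmp C f u)" "roof X Z (Cmp C t v) (Cmp C g v)"
    using r uv W by (auto simp: roof_def)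
  ultimately show ?thesis by blast
qed

theorem verdier_shift_category: "shift_category D"
proof
  fix X Y Z T f g h
  show "f \<in> Hom D X Y \<Longrightarrow> X \<in> Ob D \<and> Y \<in> Ob D \<and> src f = X \<and> tgt f = Y"
    by (auto simp: Hom_verdier frac_def src_def tgt_def dest: roof_Ob)
  show "X \<in> Ob D \<Longrightarrow> Idt D X \<in> Hom D X X"
    by (auto simp: Hom_verdier roof_def W_Idt intro!: exI[of _ "Idt C X"])
  show "g \<in> Hom D Y Z \<Longrightarrow> Cmp D g f \<in> Hom D X Z" if f: "f \<in> Hom D X Y"
  proof -
    assume "g \<in> Hom D Y Z"
    with f obtain s a t b where r: "roof X Y s a" "roof Y Z t b" and e: "f = frac X Y s a" "g = frac Y Z t b"
      by (auto simp: Hom_verdier)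
    obtain s' a' where c: "completes a t s' a'" using completes_exists[OF r] by blast
    show "Cmp D g f \<in> Hom D X Z"
      unfolding e Cmp_frac[OF r c] Hom_verdier using roof_comp[OF r c] by blast
  qed
  show "Cmp D (Cmp D h g) f = Cmp D h (Cmp D g f)"
    if "f \<in> Hom D X Y" "g \<in> Hom D Y Z" "h \<in> Hom D Z T"
  proof -
    from that obtain s a t b r c where ro: "roof X Y s a" "roof Y Z t b" "roof Z T r c"
      and e: "f = frac X Y s a" "g = frac Y Z t b" "h = frac Z T r c"
      by (auto simp: Hom_verdier)
    obtain s' a' where 1: "completes a t s' a'" using completes_exists[OF ro(1,2)] by blast
    obtain t' b' where 2: "completes b r t' b'" using completes_exists[OF ro(2,3)] by blast
    note h = ro[unfolded roof_def] 1[unfolded completes_def] 2[unfolded completes_def]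
    obtain s'' a'' where 3: "arr s''" "s'' \<in> W" "arr a''" "src a'' = src s''" "tgt s'' = src a'"
      "tgt a'' = src t'" "Cmp C t' a'' = Cmp C a' s''"
      using W_ore[of t' a'] h by metis
    have 4: "Cmp C r (Cmp C b' a'') = Cmp C b (Cmp C a' s'')"
      using Cmp_eq_extend[of r b' b t' a''] h 3 by auto
    then have c1: "completes (Cmp C b a') r s'' (Cmp C b' a'')"
      using h 3 by (auto simp: completes_def)
    have "Cmp C t (Cmp C a' s'') = Cmp C a (Cmp C s' s'')"
      by (rule Cmp_eq_extend) (use h 3 in auto)
    moreover have "Cmp C s' s'' \<in> W" using W_Cmp h 3 by auto
    ultimately have c2: "completes a (Cmp C t t') (Cmp C s' s'') a''"
      using h 3 by (auto simp: completes_def)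
    show ?thesis unfolding e
      unfolding Cmp_frac[OF ro(1,2) 1] Cmp_frac[OF ro(2,3) 2] Cmp_frac[OF ro(1) roof_comp[OF ro(2,3) 2] c2]
        Cmp_frac[OF roof_comp[OF ro(1,2) 1] ro(3) c1]
      using h 3 by simp
  qed
  show "f \<in> Hom D X Y \<Longrightarrow> Cmp D (Idt D Y) f = f"
  proof -
    assume "f \<in> Hom D X Y"
    then obtain s a where r: "roof X Y s a" and e: "f = frac X Y s a" by (auto simp: Hom_verdier)
    have r2: "roof Y Y (Idt C Y) (Idt C Y)" using r by (auto simp: roof_def W_Idt)
    have c: "completes a (Idt C Y) (Idt C (src a)) a" using r by (auto simp: roof_def completes_def W_Idt)
    show ?thesis unfolding e verdier_simps Cmp_frac[OF r r2 c] using r by (auto simp: roof_def)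
  qed
  show "f \<in> Hom D X Y \<Longrightarrow> Cmp D f (Idt D X) = f"
  proof -
    assume "f \<in> Hom D X Y"
    then obtain s a where r: "roof X Y s a" and e: "f = frac X Y s a" by (auto simp: Hom_verdier)
    have r2: "roof X X (Idt C X) (Idt C X)" using r by (auto simp: roof_def W_Idt)
    have c: "completes (Idt C X) s s (Idt C (src s))" using r by (auto simp: roof_def completes_def W_Idt)
    show ?thesis unfolding e verdier_simps Cmp_frac[OF r2 r c] using r by (auto simp: roof_def)
  qed
  show "g \<in> Hom D X Y \<Longrightarrow> Add D f g \<in> Hom D X Y" if f: "f \<in> Hom D X Y"
  proof -
    assume "g \<in> Hom D X Y"
    from common_denominator[OF f this] obtain s a b where r: "roof X Y s a" "roof X Y s b"
      and e: "f = frac X Y s a" "g = frac X Y s b" by blast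
    have "roof X Y s (Add C a b)" using r by (auto simp: roof_def)
    then show ?thesis unfolding e Add_frac[OF r] Hom_verdier by blast
  qed
  show "Cmp D (Add D f g) h = Add D (Cmp D f h) (Cmp D g h)"
    if h: "h \<in> Hom D X Y" "f \<in> Hom D Y Z" "g \<in> Hom D Y Z"
  proof -
    from common_denominator[OF h(2,3)] obtain s a b where r: "roof Y Z s a" "roof Y Z s b"
      and e: "f = frac Y Z s a" "g = frac Y Z s b" by blast
    obtain t c where r3: "roof X Y t c" and e3: "h = frac X Y t c" using h by (auto simp: Hom_verdier)
    obtain s' c' where c: "completes c s s' c'" using completes_exists[OF r3 r(1)] by blast
    have r4: "roof Y Z s (Add C a b)" using r by (auto simp: roof_def)
    show ?thesis
      unfolding e e3 Add_frac[OF r] Cmp_frac[OF r3 r4 c] Cmp_frac[OF r3 r(1) c] Cmp_frac[OF r3 r(2) c]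
        Add_frac[OF roof_comp[OF r3 r(1) c] roof_comp[OF r3 r(2) c]]
      using r c by (auto simp: Add_Cmp roof_def completes_def)
  qed
  show "X \<in> Ob D \<Longrightarrow> Y \<in> Ob D \<Longrightarrow> Nul D X Y \<in> Hom D X Y"
  proof -
    assume "X \<in> Ob D" "Y \<in> Ob D"
    then have "roof X Y (Idt C X) (Nul C X Y)" by (auto simp: roof_def W_Idt)
    then show ?thesis unfolding Hom_verdier by auto
  qed
  show "X \<in> Ob D \<Longrightarrow> Sh D X \<in> Ob D" by simp
  show "f \<in> Hom D X Y \<Longrightarrow> ShA D f \<in> Hom D (Sh D X) (Sh D Y)"
  proof -
    assume "f \<in> Hom D X Y"
    then obtain s a where r: "roof X Y s a" and e: "f = frac X Y s a" by (auto simp: Hom_verdier)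
    have "roof (Sh C X) (Sh C Y) (ShA C s) (ShA C a)" using r W_ShA by (auto simp: roof_def)
    then show ?thesis unfolding e ShA_frac[OF r] verdier_simps Hom_verdier by blast
  qed
  show "ShA D (Idt D X) = Idt D (Sh D X)" if "X \<in> Ob D"
  proof -
    have "roof X X (Idt C X) (Idt C X)" using that by (auto simp: roof_def W_Idt)
    from ShA_frac[OF this] show ?thesis using that by simp
  qed
  show "g \<in> Hom D Y Z \<Longrightarrow> ShA D (Cmp D g f) = Cmp D (ShA D g) (ShA D f)" if f: "f \<in> Hom D X Y"
  proof -
    assume "g \<in> Hom D Y Z"
    with f obtain s a t b where r: "roof X Y s a" "roof Y Z t b" and e: "f = frac X Y s a" "g = frac Y Z t b"
      by (auto simp: Hom_verdier)
    obtain s' a' where c: "completes a t s' a'" using completes_exists[OF r] by blast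
    note h = r[unfolded roof_def] c[unfolded completes_def]
    have r': "roof (Sh C X) (Sh C Y) (ShA C s) (ShA C a)" "roof (Sh C Y) (Sh C Z) (ShA C t) (ShA C b)"
      using r W_ShA by (auto simp: roof_def)
    have "Cmp C (ShA C t) (ShA C a') = Cmp C (ShA C a) (ShA C s')"
      using h by (metis ShA_Cmp)
    then have c': "completes (ShA C a) (ShA C t) (ShA C s') (ShA C a')"
      using h W_ShA by (auto simp: completes_def)
    show ?thesis
      unfolding e Cmp_frac[OF r c] ShA_frac[OF roof_comp[OF r c]] ShA_frac[OF r(1)] ShA_frac[OF r(2)]
        Cmp_frac[OF r' c'] using h by simp
  qed
qed

sublocale D: shift_category D by (rule verdier_shift_category)

abbreviation "Q \<equiv> verdier_functor C N"

lemma roof_Idt: "arr f \<Longrightarrow> roof (src f) (tgt f) (Idt C (src f)) f"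
  by (auto simp: roof_def W_Idt)

lemma Q_arr [simp]:
  assumes "arr f" shows "D.arr (Q f)" "src (Q f) = src f" "tgt (Q f) = tgt f"
proof -
  have "Q f \<in> Hom D (src f) (tgt f)"
    unfolding Hom_verdier verdier_functor_frac using roof_Idt[OF assms] by blast
  then show "D.arr (Q f)" "src (Q f) = src f" "tgt (Q f) = tgt f" by (auto simp: D.hom_iff)
qed

lemma Q_Idt: "X \<in> Ob C \<Longrightarrow> Q (Idt C X) = Idt D X"
  by (simp add: verdier_functor_frac)

lemma Q_Nul: "X \<in> Ob C \<Longrightarrow> Y \<in> Ob C \<Longrightarrow> Q (Nul C X Y) = Nul D X Y"
  by (simp add: verdier_functor_frac)

lemma Cmp_Q_frac:
  assumes "roof X Y s f" "arr g" "src g = Y"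
  shows "Cmp D (Q g) (frac X Y s f) = frac X (tgt g) s (Cmp C g f)"
proof -
  have c: "completes f (Idt C (src g)) (Idt C (src f)) f"
    using assms by (auto simp: completes_def roof_def W_Idt)
  show ?thesis
    using Cmp_frac[OF assms(1) _ c, of "tgt g" g] roof_Idt[OF assms(2)] assms
    by (auto simp: verdier_functor_frac roof_def)
qed

lemma Q_Cmp: "arr f \<Longrightarrow> arr g \<Longrightarrow> src g = tgt f \<Longrightarrow> Q (Cmp C g f) = Cmp D (Q g) (Q f)"
  using Cmp_Q_frac[OF roof_Idt, of f g] by (simp add: verdier_functor_frac)

lemma Q_Add: "arr f \<Longrightarrow> arr g \<Longrightarrow> src f = src g \<Longrightarrow> tgt f = tgt g \<Longrightarrow>
    Q (Add C f g) = Add D (Q f) (Q g)"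
  using Add_frac[OF roof_Idt, of f g] roof_Idt[of g] by (simp add: verdier_functor_frac)

lemma Q_eq_iff:
  assumes "arr f" "arr g" "src f = src g" "tgt f = tgt g"
  shows "Q f = Q g \<longleftrightarrow> (\<exists>t. arr t \<and> t \<in> W \<and> tgt t = src g \<and> Cmp C f t = Cmp C g t)"
proof -
  let ?i = "Idt C (src f)"
  have r: "roof (src f) (tgt f) ?i f" "roof (src f) (tgt f) ?i g" using assms by (auto simp: roof_def W_Idt)
  have "Q f = Q g \<longleftrightarrow> (\<exists>u v. refines ?i f ?i g u v)"
    using frac_eq_iff[OF r(1), of ?i g] r assms by (simp add: verdier_functor_frac)
  also have "\<dots> \<longleftrightarrow> (\<exists>t. arr t \<and> t \<in> W \<and> tgt t = src g \<and> Cmp C f t = Cmp C g t)"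
    (is "?L \<longleftrightarrow> ?R")
  proof
    assume ?L
    then obtain u v where "refines ?i f ?i g u v" by blast
    then show ?R by (intro exI[of _ v]) (use assms in \<open>auto simp: refines_def\<close>)
  next
    assume ?R
    then obtain t where "arr t" "t \<in> W" "tgt t = src g" "Cmp C f t = Cmp C g t" by blast
    then have "refines ?i f ?i g t t" using assms by (auto simp: refines_def)
    then show ?L by blast
  qed
  finally show ?thesis .
qed

lemma frac_Idt_inverse:
  assumes "arr s" "s \<in> W"
  shows "Cmp D (frac (tgt s) (src s) s (Idt C (src s))) (Q s) = Idt D (src s)"
    and "Cmp D (Q s) (frac (tgt s) (src s) s (Idt C (src s))) = Idt D (tgt s)"
    and "frac (tgt s) (src s) s (Idt C (src s)) \<in> Hom D (tgt s) (src s)"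
proof -
  have r: "roof (tgt s) (src s) s (Idt C (src s))" using assms by (auto simp: roof_def)
  then show "frac (tgt s) (src s) s (Idt C (src s)) \<in> Hom D (tgt s) (src s)"
    unfolding Hom_verdier by blast
  have c: "completes s s (Idt C (src s)) (Idt C (src s))" using assms by (auto simp: completes_def W_Idt)
  show "Cmp D (frac (tgt s) (src s) s (Idt C (src s))) (Q s) = Idt D (src s)"
    using Cmp_frac[OF roof_Idt[OF assms(1)] r c] assms by (simp add: verdier_functor_frac)
  have "Cmp D (Q s) (frac (tgt s) (src s) s (Idt C (src s))) = frac (tgt s) (tgt s) s s"
    using Cmp_Q_frac[OF r, of s] assms by simp
  also have "\<dots> = Idt D (tgt s)"
    using frac_refine[of "tgt s" "tgt s" "Idt C (tgt s)" "Idt C (tgt s)" s] assms W_Idt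
    by (simp add: roof_def)
  finally show "Cmp D (Q s) (frac (tgt s) (src s) s (Idt C (src s))) = Idt D (tgt s)" .
qed

lemma Q_iso:
  assumes "arr s" "s \<in> W" shows "is_iso D (src s) (tgt s) (Q s)"
  unfolding D.is_iso_iff
  using frac_Idt_inverse[OF assms] Q_arr[OF assms(1)] D.hom_iff by blast

lemma Q_is_iso:
  assumes "is_iso C X Y f" shows "is_iso D X Y (Q f)"
proof -
  from assms obtain g where g: "f \<in> Hom C X Y" "g \<in> Hom C Y X" "Cmp C g f = Idt C X" "Cmp C f g = Idt C Y"
    by (auto simp: is_iso_iff)
  note h = g[unfolded hom_iff]
  have "Cmp D (Q g) (Q f) = Idt D X" "Cmp D (Q f) (Q g) = Idt D Y"
    using Q_Cmp[of f g] Q_Cmp[of g f] h Q_Idt by auto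
  then show ?thesis unfolding D.is_iso_iff D.hom_iff
    by (intro conjI bexI[of _ "Q g"]) (use h in \<open>auto simp: D.hom_iff\<close>)
qed

text \<open>The triangles of the quotient are closed under isomorphisms at all three vertices. This allows
  replacing objects by isomorphic ones in the definition of the star, and the denominator of a
  fraction to be absorbed into an isomorphism.\<close>

lemma Tri_verdierI:
  assumes t: "(X, Y, Z, f, g, h) \<in> Tri C" "is_triangle C (X, Y, Z, f, g, h)"
    and a: "inverse_arrows D X' X a a'" and b: "inverse_arrows D Y' Y b b'" and c: "inverse_arrows D Z' Z c c'"
  shows "(X', Y', Z', Cmp D b' (Cmp D (Q f) a), Cmp D c' (Cmp D (Q g) b),
      Cmp D (ShA D a') (Cmp D (Q h) c)) \<in> Tri D"
proof -
  note i = a[unfolded inverse_arrows_def D.hom_iff] b[unfolded inverse_arrows_def D.hom_iff]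
    c[unfolded inverse_arrows_def D.hom_iff]
  have h: "arr f" "arr g" "arr h" "src f = X" "tgt f = Y" "src g = Y" "tgt g = Z" "src h = Z"
    "tgt h = Sh C X"
    using t(2) by (auto simp: is_triangle_def hom_iff)
  let ?f = "Cmp D b' (Cmp D (Q f) a)" and ?g = "Cmp D c' (Cmp D (Q g) b)"
    and ?h = "Cmp D (ShA D a') (Cmp D (Q h) c)"
  have 1: "is_triangle D (X', Y', Z', ?f, ?g, ?h)"
    unfolding is_triangle_def prod.case D.hom_iff
    using i h D.arr_Ob[of a] D.arr_Ob[of b] D.arr_Ob[of c] by auto
  have 2: "is_triangle D (X, Y, Z, Q f, Q g, Q h)"
    unfolding is_triangle_def prod.case D.hom_iff
    using h arr_Ob[of f] arr_Ob[of g] by auto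
  have ci: "Cmp D v (Cmp D v' w) = w"
    if "D.arr w" "D.arr v" "D.arr v'" "tgt w = src v'" "src v = tgt v'" "Cmp D v v' = Idt D (tgt w)" for v v' w
    using that D.Cmp_assoc[of w v' v] D.Idt_left[of w "tgt w"] by auto
  have sa: "Cmp D (ShA D a) (ShA D a') = Idt D (Sh D X)"
    using D.ShA_Cmp[of a' a] D.ShA_Idt[of X] i D.arr_Ob[of a] by auto
  have 3: "triangle_iso D (X', Y', Z', ?f, ?g, ?h) (X, Y, Z, Q f, Q g, Q h)"
    unfolding triangle_iso_def prod.case
  proof (intro exI conjI)
    show "is_iso D X' X a" "is_iso D Y' Y b" "is_iso D Z' Z c"
      using a b c by (auto simp: inverse_arrows_def D.is_iso_iff)
    show "Cmp D b ?f = Cmp D (Q f) a" by (rule ci) (use i h in auto)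
    show "Cmp D c ?g = Cmp D (Q g) b" by (rule ci) (use i h in auto)
    show "Cmp D (ShA D a) ?h = Cmp D (Q h) c" by (rule ci) (use i h sa in auto)
  qed
  show ?thesis
    using 1 2 3 t(1) unfolding verdier_def with_triangles_simps is_triangle_with_triangles
      triangle_iso_with_triangles triangle_closure_def by blast
qed

lemma Tri_verdierE:
  assumes "(X, Y, Z, \<alpha>, \<beta>, \<gamma>) \<in> Tri D"
  obtains X' Y' Z' f g h a b c where "(X', Y', Z', f, g, h) \<in> Tri C"
    "is_iso D X X' a" "is_iso D Y Y' b" "is_iso D Z Z' c" "Cmp D b \<alpha> = Cmp D (Q f) a"
    "\<alpha> \<in> Hom D X Y" "Q f \<in> Hom D X' Y'"
proof -
  obtain t where t: "t \<in> {(X, Y, Z, Q f, Q g, Q h) | X Y Z f g h. (X, Y, Z, f, g, h) \<in> Tri C}"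
    "is_triangle D (X, Y, Z, \<alpha>, \<beta>, \<gamma>)" "is_triangle D t" "triangle_iso D (X, Y, Z, \<alpha>, \<beta>, \<gamma>) t"
    using assms unfolding verdier_def with_triangles_simps is_triangle_with_triangles
      triangle_iso_with_triangles triangle_closure_def by blast
  then obtain X' Y' Z' f g h where e: "t = (X', Y', Z', Q f, Q g, Q h)" "(X', Y', Z', f, g, h) \<in> Tri C"
    by blast
  obtain a b c where "is_iso D X X' a" "is_iso D Y Y' b" "is_iso D Z Z' c" "Cmp D b \<alpha> = Cmp D (Q f) a"
    using t(4) unfolding e triangle_iso_def prod.case by (elim exE conjE)
  moreover have "\<alpha> \<in> Hom D X Y" "Q f \<in> Hom D X' Y'"
    using t(2,3) unfolding e is_triangle_def prod.case by simp_all
  ultimately show thesis using that e(2) by blast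
qed

end

section \<open>Localising in two steps\<close>

context verdier_fractions
begin

lemma frac_Cmp_denominator:
  assumes "roof X Y s f" shows "Cmp D (frac X Y s f) (Q s) = Q f"
proof -
  note h = assms[unfolded roof_def]
  have r: "roof X (src s) s (Idt C (src s))" using h by (auto simp: roof_def)
  have e: "frac X Y s f = Cmp D (Q f) (frac X (src s) s (Idt C (src s)))"
    using Cmp_Q_frac[OF r, of f] h by simp
  have "frac X (src s) s (Idt C (src s)) \<in> Hom D X (src s)" unfolding Hom_verdier using r by blast
  then show ?thesis unfolding e
    using frac_Idt_inverse(1)[of s] h D.Idt_right[of "Q f"] by (auto simp: D.hom_iff)
qed

end

text \<open>For the localisation at the arrows with cone in a subcategory \<open>N\<close> followed by the localisation at
  those with cone in a larger subcategory. The last axiom lets membership in \<open>WP\<close> descend along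
  elements of \<open>W\<close> at both ends.\<close>

locale two_step_fractions = verdier_fractions C N + P: right_fractions C WP
  for C :: "('o, 'e) tricat" and N :: "'o set" and WP :: "('o, 'e) arr set" +
  assumes W_sub_WP: "s \<in> W \<Longrightarrow> arr s \<Longrightarrow> s \<in> WP"
    and WP_descend: "s \<in> W \<Longrightarrow> s' \<in> W \<Longrightarrow> g \<in> WP \<Longrightarrow> arr s \<Longrightarrow> arr s' \<Longrightarrow> arr g \<Longrightarrow> arr g' \<Longrightarrow>
      src s = tgt g' \<Longrightarrow> src g = tgt s' \<Longrightarrow> src s' = src g' \<Longrightarrow> Cmp C s g' = Cmp C g s' \<Longrightarrow> g' \<in> WP"
begin

definition WP_fracs :: "('o, ('o, 'e) roof set) arr set" where
  "WP_fracs = {frac X Y s f | X Y s f. roof X Y s f \<and> f \<in> WP}"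

lemma WP_fracsI: "roof X Y s f \<Longrightarrow> f \<in> WP \<Longrightarrow> frac X Y s f \<in> WP_fracs"
  unfolding WP_fracs_def by blast

lemma Q_WP_fracs: "arr f \<Longrightarrow> f \<in> WP \<Longrightarrow> Q f \<in> WP_fracs"
  using WP_fracsI[OF roof_Idt] by (simp add: verdier_functor_frac)

lemma frac_ends [simp]: "src (frac X Y s f) = X" "tgt (frac X Y s f) = Y"
  by (simp_all add: frac_def src_def tgt_def)

text \<open>All four axioms are reduced to those of \<open>WP\<close> by multiplying a fraction with its denominator on the
  right, which turns it into the image of its numerator. So the arrows of \<open>WP_fracs\<close> that the Ore
  and cancellation axioms ask for may be taken to be images of arrows in \<open>WP\<close>.\<close>

theorem WP_fracs_right_fractions: "right_fractions D WP_fracs"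
proof unfold_locales
  show "Idt D X \<in> WP_fracs" if "X \<in> Ob D" for X
    using Q_WP_fracs[of "Idt C X"] Q_Idt[of X] P.W_Idt[of X] that by simp
next
  fix \<phi> \<psi> assume *: "\<phi> \<in> WP_fracs" "\<psi> \<in> WP_fracs" "src \<psi> = tgt \<phi>"
  then obtain X Y Z s f t g where r: "roof X Y s f" "roof Y Z t g" "f \<in> WP" "g \<in> WP"
    and e: "\<phi> = frac X Y s f" "\<psi> = frac Y Z t g"
    by (fastforce simp: WP_fracs_def)
  obtain s' f' where c: "completes f t s' f'" using completes_exists[OF r(1,2)] by blast
  note h = r[unfolded roof_def] c[unfolded completes_def]
  have "f' \<in> WP" by (rule WP_descend[of t s' f]) (use h in auto)
  then have "Cmp C g f' \<in> WP" using P.W_Cmp[of f' g] h by auto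
  then show "Cmp D \<psi> \<phi> \<in> WP_fracs"
    unfolding e Cmp_frac[OF r(1,2) c] using WP_fracsI[OF roof_comp[OF r(1,2) c]] by blast
next
  fix \<sigma> \<phi> assume *: "\<sigma> \<in> WP_fracs" "D.arr \<phi>" "tgt \<phi> = tgt \<sigma>"
  then obtain X Z s f where r: "roof X Z s f" "f \<in> WP" and e: "\<sigma> = frac X Z s f"
    by (auto simp: WP_fracs_def)
  have "\<phi> \<in> Hom D (src \<phi>) Z" using * e by (auto simp: D.hom_iff)
  then obtain Y t g where r2: "roof Y Z t g" and e2: "\<phi> = frac Y Z t g"
    by (auto simp: Hom_verdier)
  note h = r[unfolded roof_def] r2[unfolded roof_def]
  obtain u p where up: "arr u" "arr p" "p \<in> WP" "src u = src p" "tgt p = src g" "tgt u = src f"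
    "Cmp C f u = Cmp C g p"
    using P.W_ore[of f g] h by metis
  have t: "D.arr \<sigma>" using r WP_fracs_def e Hom_verdier D.hom_iff by blast
  have "Cmp D \<sigma> (Q (Cmp C s u)) = Q (Cmp C f u)"
    using frac_Cmp_denominator[OF r(1)] up(1-6) h D.Cmp_assoc[of "Q u" "Q s" \<sigma>] t e
    by (simp add: Q_Cmp)
  moreover have "Cmp D \<phi> (Q (Cmp C t p)) = Q (Cmp C g p)"
    using frac_Cmp_denominator[OF r2] up h D.Cmp_assoc[of "Q p" "Q t" \<phi>] * e2
    by (simp add: Q_Cmp)
  moreover have "Q (Cmp C t p) \<in> WP_fracs"
    using Q_WP_fracs P.W_Cmp[of p t] W_sub_WP[of t] up h by auto
  ultimately show "\<exists>u t. D.arr u \<and> D.arr t \<and> t \<in> WP_fracs \<and> src u = src t \<and> tgt t = src \<phi> \<and> tgt u = src \<sigma> \<and>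
        Cmp D \<sigma> u = Cmp D \<phi> t"
    by (intro exI[of _ "Q (Cmp C s u)"] exI[of _ "Q (Cmp C t p)"]) (use up h e e2 in auto)
next
  fix \<sigma> \<alpha> \<beta>
  assume *: "\<sigma> \<in> WP_fracs" "D.arr \<sigma>" "D.arr \<alpha>" "D.arr \<beta>" "tgt \<alpha> = src \<sigma>" "tgt \<beta> = src \<sigma>"
    "src \<alpha> = src \<beta>" and eq: "Cmp D \<sigma> \<alpha> = Cmp D \<sigma> \<beta>"
  then obtain X Z s f where r: "roof X Z s f" "f \<in> WP" and e: "\<sigma> = frac X Z s f"
    by (auto simp: WP_fracs_def)
  have "\<alpha> \<in> Hom D (src \<beta>) X" "\<beta> \<in> Hom D (src \<beta>) X" using * e by (auto simp: D.hom_iff)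
  then obtain Y t a b where r2: "roof Y X t a" "roof Y X t b" and e2: "\<alpha> = frac Y X t a" "\<beta> = frac Y X t b"
    using common_denominator by metis
  note h = r[unfolded roof_def] r2[unfolded roof_def]
  obtain r1 a1 where 1: "arr r1" "r1 \<in> W" "arr a1" "src r1 = src a1" "tgt r1 = src a" "tgt a1 = src s"
    "Cmp C s a1 = Cmp C a r1" using W_ore[of s a] h by metis
  obtain r2 b1 where 2: "arr r2" "r2 \<in> W" "arr b1" "src r2 = src b1" "tgt r2 = src r1" "tgt b1 = src s"
    "Cmp C s b1 = Cmp C (Cmp C b r1) r2"
    using W_ore[of s "Cmp C b r1"] h 1 by (metis arr_Cmp)
  define r' where "r' = Cmp C r1 r2"
  define a' where "a' = Cmp C a1 r2"
  have tr: "arr r'" "src r' = src b1" "tgt r' = src t" "r' \<in> W" "arr a'" "src a' = src b1" "tgt a' = src s"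
    using W_Cmp[of r2 r1] 1 2 h by (auto simp: r'_def a'_def)
  have ea: "Cmp C s a' = Cmp C a r'" unfolding a'_def r'_def
    by (rule Cmp_eq_extend) (use 1 2 h in auto)
  have eb: "Cmp C s b1 = Cmp C b r'" unfolding r'_def using 1 2 h by auto
  have n: "Cmp D \<alpha> (Q (Cmp C t w)) = Q (Cmp C a w)" "Cmp D \<beta> (Q (Cmp C t w)) = Q (Cmp C b w)"
    if "arr w" "tgt w = src t" for w
    using frac_Cmp_denominator[OF r2(1)] frac_Cmp_denominator[OF r2(2)] h that
      D.Cmp_assoc[of "Q w" "Q t" \<alpha>] D.Cmp_assoc[of "Q w" "Q t" \<beta>] * e2
    by (simp_all add: Q_Cmp)
  have m: "Cmp D \<sigma> (Q (Cmp C s w)) = Q (Cmp C f w)" if "arr w" "tgt w = src s" for w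
    using frac_Cmp_denominator[OF r(1)] h that D.Cmp_assoc[of "Q w" "Q s" \<sigma>] * e
    by (simp add: Q_Cmp)
  have "Cmp D \<sigma> (Cmp D \<alpha> (Q (Cmp C t r'))) = Cmp D \<sigma> (Cmp D \<beta> (Q (Cmp C t r')))"
    by (rule D.Cmp_eq_extend[OF eq]) (use * e2 tr h in simp_all)
  then have "Q (Cmp C f a') = Q (Cmp C f b1)"
    using n[of r'] tr m[of a'] m[of b1] ea eb 2 by simp
  then obtain q where q: "arr q" "q \<in> W" "tgt q = src b1" "Cmp C (Cmp C f a') q = Cmp C (Cmp C f b1) q"
    using Q_eq_iff[of "Cmp C f a'" "Cmp C f b1"] tr 2 h by auto
  obtain p where p: "arr p" "p \<in> WP" "tgt p = src q" "Cmp C (Cmp C a' q) p = Cmp C (Cmp C b1 q) p"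
    using P.W_cancel[of f "Cmp C a' q" "Cmp C b1 q"] q tr 2 h by auto
  \<comment> \<open>\<open>r'\<close> brings both numerators over \<open>s\<close>, \<open>q\<close> undoes the first localisation, \<open>p\<close> cancels \<open>f\<close>.\<close>
  define w where "w = Cmp C r' (Cmp C q p)"
  have w: "arr w" "tgt w = src t" "w \<in> WP" unfolding w_def
    using q p tr h W_sub_WP[of r'] W_sub_WP[of q] P.W_Cmp[of "Cmp C q p" r'] P.W_Cmp[of p q] by auto
  have "Cmp C a w = Cmp C s (Cmp C a' (Cmp C q p))" unfolding w_def
    by (rule Cmp_eq_extend[OF ea[symmetric]]) (use q p tr h in auto)
  also have "Cmp C a' (Cmp C q p) = Cmp C b1 (Cmp C q p)" using p(4) q p(1-3) tr 2 by simp
  also have "Cmp C s (Cmp C b1 (Cmp C q p)) = Cmp C b w" unfolding w_def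
    by (rule Cmp_eq_extend[OF eb]) (use q p tr 2 h in auto)
  finally have "Cmp C a w = Cmp C b w" .
  then have "Cmp D \<alpha> (Q (Cmp C t w)) = Cmp D \<beta> (Q (Cmp C t w))" using n w by simp
  moreover have "Q (Cmp C t w) \<in> WP_fracs"
    using Q_WP_fracs P.W_Cmp[of w t] W_sub_WP[of t] w h by auto
  ultimately show "\<exists>t. D.arr t \<and> t \<in> WP_fracs \<and> tgt t = src \<beta> \<and> Cmp D \<alpha> t = Cmp D \<beta> t"
    by (intro exI[of _ "Q (Cmp C t w)"]) (use w h e2 in auto)
next
  fix \<sigma> assume "\<sigma> \<in> WP_fracs"
  then obtain X Z s f where r: "roof X Z s f" "f \<in> WP" and e: "\<sigma> = frac X Z s f"
    by (auto simp: WP_fracs_def)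
  have "roof (Sh C X) (Sh C Z) (ShA C s) (ShA C f)" "ShA C f \<in> WP"
    using r W_ShA P.W_ShA by (auto simp: roof_def)
  then show "ShA D \<sigma> \<in> WP_fracs" unfolding e ShA_frac[OF r(1)] by (rule WP_fracsI)
qed

end

section \<open>Modules and complexes\<close>

context cring begin

lemma module_simps:
  assumes "module R M"
  shows "\<zero>\<^bsub>M\<^esub> \<in> carrier M"
    and "x \<in> carrier M \<Longrightarrow> \<ominus>\<^bsub>M\<^esub> x \<in> carrier M"
    and "x \<in> carrier M \<Longrightarrow> y \<in> carrier M \<Longrightarrow> x \<oplus>\<^bsub>M\<^esub> y \<in> carrier M"
    and "a \<in> carrier R \<Longrightarrow> x \<in> carrier M \<Longrightarrow> a \<odot>\<^bsub>M\<^esub> x \<in> carrier M"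
    and "x \<in> carrier M \<Longrightarrow> \<zero>\<^bsub>M\<^esub> \<oplus>\<^bsub>M\<^esub> x = x" "x \<in> carrier M \<Longrightarrow> x \<oplus>\<^bsub>M\<^esub> \<zero>\<^bsub>M\<^esub> = x"
    and "x \<in> carrier M \<Longrightarrow> \<ominus>\<^bsub>M\<^esub> x \<oplus>\<^bsub>M\<^esub> x = \<zero>\<^bsub>M\<^esub>" "x \<in> carrier M \<Longrightarrow> x \<oplus>\<^bsub>M\<^esub> \<ominus>\<^bsub>M\<^esub> x = \<zero>\<^bsub>M\<^esub>"
    and "x \<in> carrier M \<Longrightarrow> \<ominus>\<^bsub>M\<^esub> (\<ominus>\<^bsub>M\<^esub> x) = x" "\<ominus>\<^bsub>M\<^esub> \<zero>\<^bsub>M\<^esub> = \<zero>\<^bsub>M\<^esub>"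
    and "x \<in> carrier M \<Longrightarrow> y \<in> carrier M \<Longrightarrow> \<ominus>\<^bsub>M\<^esub> (x \<oplus>\<^bsub>M\<^esub> y) = \<ominus>\<^bsub>M\<^esub> x \<oplus>\<^bsub>M\<^esub> \<ominus>\<^bsub>M\<^esub> y"
    and "x \<in> carrier M \<Longrightarrow> y \<in> carrier M \<Longrightarrow> (\<ominus>\<^bsub>M\<^esub> x = \<ominus>\<^bsub>M\<^esub> y) = (x = y)"
    and "a \<in> carrier R \<Longrightarrow> x \<in> carrier M \<Longrightarrow> y \<in> carrier M \<Longrightarrow>
      a \<odot>\<^bsub>M\<^esub> (x \<oplus>\<^bsub>M\<^esub> y) = a \<odot>\<^bsub>M\<^esub> x \<oplus>\<^bsub>M\<^esub> a \<odot>\<^bsub>M\<^esub> y"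
    and "a \<in> carrier R \<Longrightarrow> x \<in> carrier M \<Longrightarrow> a \<odot>\<^bsub>M\<^esub> (\<ominus>\<^bsub>M\<^esub> x) = \<ominus>\<^bsub>M\<^esub> (a \<odot>\<^bsub>M\<^esub> x)"
    and "a \<in> carrier R \<Longrightarrow> a \<odot>\<^bsub>M\<^esub> \<zero>\<^bsub>M\<^esub> = \<zero>\<^bsub>M\<^esub>"
    and "x \<in> carrier M \<Longrightarrow> (\<ominus>\<^bsub>M\<^esub> x = \<zero>\<^bsub>M\<^esub>) = (x = \<zero>\<^bsub>M\<^esub>)"
    and "x \<in> carrier M \<Longrightarrow> (\<zero>\<^bsub>M\<^esub> = \<ominus>\<^bsub>M\<^esub> x) = (x = \<zero>\<^bsub>M\<^esub>)"
proof -
  interpret M: module R M by fact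
  show "\<zero>\<^bsub>M\<^esub> \<in> carrier M" by simp
  show "x \<in> carrier M \<Longrightarrow> \<ominus>\<^bsub>M\<^esub> x \<in> carrier M" by simp
  show "x \<in> carrier M \<Longrightarrow> y \<in> carrier M \<Longrightarrow> x \<oplus>\<^bsub>M\<^esub> y \<in> carrier M" by simp
  show "a \<in> carrier R \<Longrightarrow> x \<in> carrier M \<Longrightarrow> a \<odot>\<^bsub>M\<^esub> x \<in> carrier M" by simp
  show "x \<in> carrier M \<Longrightarrow> \<zero>\<^bsub>M\<^esub> \<oplus>\<^bsub>M\<^esub> x = x" "x \<in> carrier M \<Longrightarrow> x \<oplus>\<^bsub>M\<^esub> \<zero>\<^bsub>M\<^esub> = x" by simp_all
  show "x \<in> carrier M \<Longrightarrow> \<ominus>\<^bsub>M\<^esub> x \<oplus>\<^bsub>M\<^esub> x = \<zero>\<^bsub>M\<^esub>" "x \<in> carrier M \<Longrightarrow> x \<oplus>\<^bsub>M\<^esub> \<ominus>\<^bsub>M\<^esub> x = \<zero>\<^bsub>M\<^esub>"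
    by (simp_all add: M.l_neg M.r_neg)
  show mm: "x \<in> carrier M \<Longrightarrow> \<ominus>\<^bsub>M\<^esub> (\<ominus>\<^bsub>M\<^esub> x) = x" and m0: "\<ominus>\<^bsub>M\<^esub> \<zero>\<^bsub>M\<^esub> = \<zero>\<^bsub>M\<^esub>" by simp_all
  show "x \<in> carrier M \<Longrightarrow> y \<in> carrier M \<Longrightarrow> \<ominus>\<^bsub>M\<^esub> (x \<oplus>\<^bsub>M\<^esub> y) = \<ominus>\<^bsub>M\<^esub> x \<oplus>\<^bsub>M\<^esub> \<ominus>\<^bsub>M\<^esub> y"
    by (simp add: M.minus_add)
  show "x \<in> carrier M \<Longrightarrow> y \<in> carrier M \<Longrightarrow> (\<ominus>\<^bsub>M\<^esub> x = \<ominus>\<^bsub>M\<^esub> y) = (x = y)"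
    by (metis M.minus_minus)
  show "a \<in> carrier R \<Longrightarrow> x \<in> carrier M \<Longrightarrow> y \<in> carrier M \<Longrightarrow>
      a \<odot>\<^bsub>M\<^esub> (x \<oplus>\<^bsub>M\<^esub> y) = a \<odot>\<^bsub>M\<^esub> x \<oplus>\<^bsub>M\<^esub> a \<odot>\<^bsub>M\<^esub> y" by (simp add: M.smult_r_distr)
  show "a \<in> carrier R \<Longrightarrow> x \<in> carrier M \<Longrightarrow> a \<odot>\<^bsub>M\<^esub> (\<ominus>\<^bsub>M\<^esub> x) = \<ominus>\<^bsub>M\<^esub> (a \<odot>\<^bsub>M\<^esub> x)"
    by (simp add: M.smult_r_minus)
  show "a \<in> carrier R \<Longrightarrow> a \<odot>\<^bsub>M\<^esub> \<zero>\<^bsub>M\<^esub> = \<zero>\<^bsub>M\<^esub>" by simp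
  show "x \<in> carrier M \<Longrightarrow> (\<ominus>\<^bsub>M\<^esub> x = \<zero>\<^bsub>M\<^esub>) = (x = \<zero>\<^bsub>M\<^esub>)"
    "x \<in> carrier M \<Longrightarrow> (\<zero>\<^bsub>M\<^esub> = \<ominus>\<^bsub>M\<^esub> x) = (x = \<zero>\<^bsub>M\<^esub>)"
    by (metis mm m0)+
qed

lemma module_ac:
  assumes "module R M"
  shows "x \<in> carrier M \<Longrightarrow> y \<in> carrier M \<Longrightarrow> z \<in> carrier M \<Longrightarrow>
      (x \<oplus>\<^bsub>M\<^esub> y) \<oplus>\<^bsub>M\<^esub> z = x \<oplus>\<^bsub>M\<^esub> (y \<oplus>\<^bsub>M\<^esub> z)"
    and "x \<in> carrier M \<Longrightarrow> y \<in> carrier M \<Longrightarrow> x \<oplus>\<^bsub>M\<^esub> y = y \<oplus>\<^bsub>M\<^esub> x"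
    and "x \<in> carrier M \<Longrightarrow> y \<in> carrier M \<Longrightarrow> z \<in> carrier M \<Longrightarrow>
      x \<oplus>\<^bsub>M\<^esub> (y \<oplus>\<^bsub>M\<^esub> z) = y \<oplus>\<^bsub>M\<^esub> (x \<oplus>\<^bsub>M\<^esub> z)"
proof -
  interpret M: module R M by fact
  show "x \<in> carrier M \<Longrightarrow> y \<in> carrier M \<Longrightarrow> z \<in> carrier M \<Longrightarrow>
      (x \<oplus>\<^bsub>M\<^esub> y) \<oplus>\<^bsub>M\<^esub> z = x \<oplus>\<^bsub>M\<^esub> (y \<oplus>\<^bsub>M\<^esub> z)"
    "x \<in> carrier M \<Longrightarrow> y \<in> carrier M \<Longrightarrow> x \<oplus>\<^bsub>M\<^esub> y = y \<oplus>\<^bsub>M\<^esub> x"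
    "x \<in> carrier M \<Longrightarrow> y \<in> carrier M \<Longrightarrow> z \<in> carrier M \<Longrightarrow>
      x \<oplus>\<^bsub>M\<^esub> (y \<oplus>\<^bsub>M\<^esub> z) = y \<oplus>\<^bsub>M\<^esub> (x \<oplus>\<^bsub>M\<^esub> z)"
    by (simp_all add: M.a_ac)
qed

text \<open>Sorting a sum by associativity and commutativity need not make \<open>x\<close> and \<open>\<ominus> x\<close> adjacent. These rules
  cancel them across up to three other summands, which suffices for all sums below.\<close>

lemma module_cancel:
  assumes "module R M"
  shows "x \<in> carrier M \<Longrightarrow> a \<in> carrier M \<Longrightarrow> x \<oplus>\<^bsub>M\<^esub> (\<ominus>\<^bsub>M\<^esub> x \<oplus>\<^bsub>M\<^esub> a) = a"
    and "x \<in> carrier M \<Longrightarrow> a \<in> carrier M \<Longrightarrow> \<ominus>\<^bsub>M\<^esub> x \<oplus>\<^bsub>M\<^esub> (x \<oplus>\<^bsub>M\<^esub> a) = a"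
    and "x \<in> carrier M \<Longrightarrow> a \<in> carrier M \<Longrightarrow> x \<oplus>\<^bsub>M\<^esub> (a \<oplus>\<^bsub>M\<^esub> \<ominus>\<^bsub>M\<^esub> x) = a"
    and "x \<in> carrier M \<Longrightarrow> a \<in> carrier M \<Longrightarrow> b \<in> carrier M \<Longrightarrow> x \<oplus>\<^bsub>M\<^esub> (a \<oplus>\<^bsub>M\<^esub> (\<ominus>\<^bsub>M\<^esub> x \<oplus>\<^bsub>M\<^esub> b)) = a \<oplus>\<^bsub>M\<^esub> b"
    and "x \<in> carrier M \<Longrightarrow> a \<in> carrier M \<Longrightarrow> b \<in> carrier M \<Longrightarrow> x \<oplus>\<^bsub>M\<^esub> (a \<oplus>\<^bsub>M\<^esub> (b \<oplus>\<^bsub>M\<^esub> \<ominus>\<^bsub>M\<^esub> x)) = a \<oplus>\<^bsub>M\<^esub> b"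
    and "x \<in> carrier M \<Longrightarrow> a \<in> carrier M \<Longrightarrow> b \<in> carrier M \<Longrightarrow> c \<in> carrier M \<Longrightarrow>
      x \<oplus>\<^bsub>M\<^esub> (a \<oplus>\<^bsub>M\<^esub> (b \<oplus>\<^bsub>M\<^esub> (\<ominus>\<^bsub>M\<^esub> x \<oplus>\<^bsub>M\<^esub> c))) = a \<oplus>\<^bsub>M\<^esub> (b \<oplus>\<^bsub>M\<^esub> c)"
    and "x \<in> carrier M \<Longrightarrow> a \<in> carrier M \<Longrightarrow> b \<in> carrier M \<Longrightarrow> c \<in> carrier M \<Longrightarrow>
      x \<oplus>\<^bsub>M\<^esub> (a \<oplus>\<^bsub>M\<^esub> (b \<oplus>\<^bsub>M\<^esub> (c \<oplus>\<^bsub>M\<^esub> \<ominus>\<^bsub>M\<^esub> x))) = a \<oplus>\<^bsub>M\<^esub> (b \<oplus>\<^bsub>M\<^esub> c)"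
proof -
  note * [simp] = module_simps[OF assms] and ac = module_ac[OF assms]
  show 1: "x \<oplus>\<^bsub>M\<^esub> (\<ominus>\<^bsub>M\<^esub> x \<oplus>\<^bsub>M\<^esub> a) = a" "\<ominus>\<^bsub>M\<^esub> x \<oplus>\<^bsub>M\<^esub> (x \<oplus>\<^bsub>M\<^esub> a) = a"
    if "x \<in> carrier M" "a \<in> carrier M" for x a
    using that ac(1)[of x "\<ominus>\<^bsub>M\<^esub> x" a] ac(1)[of "\<ominus>\<^bsub>M\<^esub> x" x a] by simp_all
  show "x \<in> carrier M \<Longrightarrow> a \<in> carrier M \<Longrightarrow> x \<oplus>\<^bsub>M\<^esub> (a \<oplus>\<^bsub>M\<^esub> \<ominus>\<^bsub>M\<^esub> x) = a"
    using ac(3)[of x a "\<ominus>\<^bsub>M\<^esub> x"] by simp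
  show 2: "x \<in> carrier M \<Longrightarrow> a \<in> carrier M \<Longrightarrow> b \<in> carrier M \<Longrightarrow> x \<oplus>\<^bsub>M\<^esub> (a \<oplus>\<^bsub>M\<^esub> (\<ominus>\<^bsub>M\<^esub> x \<oplus>\<^bsub>M\<^esub> b)) = a \<oplus>\<^bsub>M\<^esub> b" for a b
    using ac(3)[of x a "\<ominus>\<^bsub>M\<^esub> x \<oplus>\<^bsub>M\<^esub> b"] 1[of x b] by simp
  show 3: "x \<in> carrier M \<Longrightarrow> a \<in> carrier M \<Longrightarrow> b \<in> carrier M \<Longrightarrow> x \<oplus>\<^bsub>M\<^esub> (a \<oplus>\<^bsub>M\<^esub> (b \<oplus>\<^bsub>M\<^esub> \<ominus>\<^bsub>M\<^esub> x)) = a \<oplus>\<^bsub>M\<^esub> b" for a b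
    using ac(2)[of b "\<ominus>\<^bsub>M\<^esub> x"] 2[of a b] by simp
  show "x \<in> carrier M \<Longrightarrow> a \<in> carrier M \<Longrightarrow> b \<in> carrier M \<Longrightarrow> c \<in> carrier M \<Longrightarrow>
      x \<oplus>\<^bsub>M\<^esub> (a \<oplus>\<^bsub>M\<^esub> (b \<oplus>\<^bsub>M\<^esub> (\<ominus>\<^bsub>M\<^esub> x \<oplus>\<^bsub>M\<^esub> c))) = a \<oplus>\<^bsub>M\<^esub> (b \<oplus>\<^bsub>M\<^esub> c)"
    using ac(3)[of x a "b \<oplus>\<^bsub>M\<^esub> (\<ominus>\<^bsub>M\<^esub> x \<oplus>\<^bsub>M\<^esub> c)"] 2[of b c] by simp
  show "x \<in> carrier M \<Longrightarrow> a \<in> carrier M \<Longrightarrow> b \<in> carrier M \<Longrightarrow> c \<in> carrier M \<Longrightarrow>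
      x \<oplus>\<^bsub>M\<^esub> (a \<oplus>\<^bsub>M\<^esub> (b \<oplus>\<^bsub>M\<^esub> (c \<oplus>\<^bsub>M\<^esub> \<ominus>\<^bsub>M\<^esub> x))) = a \<oplus>\<^bsub>M\<^esub> (b \<oplus>\<^bsub>M\<^esub> c)"
    using ac(3)[of x a "b \<oplus>\<^bsub>M\<^esub> (c \<oplus>\<^bsub>M\<^esub> \<ominus>\<^bsub>M\<^esub> x)"] 3[of b c] by simp
qed

lemma module_cancel':
  assumes "module R M"
  shows "x \<in> carrier M \<Longrightarrow> a \<in> carrier M \<Longrightarrow> \<ominus>\<^bsub>M\<^esub> x \<oplus>\<^bsub>M\<^esub> (a \<oplus>\<^bsub>M\<^esub> x) = a"
    and "x \<in> carrier M \<Longrightarrow> a \<in> carrier M \<Longrightarrow> b \<in> carrier M \<Longrightarrow> \<ominus>\<^bsub>M\<^esub> x \<oplus>\<^bsub>M\<^esub> (a \<oplus>\<^bsub>M\<^esub> (x \<oplus>\<^bsub>M\<^esub> b)) = a \<oplus>\<^bsub>M\<^esub> b"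
    and "x \<in> carrier M \<Longrightarrow> a \<in> carrier M \<Longrightarrow> b \<in> carrier M \<Longrightarrow> \<ominus>\<^bsub>M\<^esub> x \<oplus>\<^bsub>M\<^esub> (a \<oplus>\<^bsub>M\<^esub> (b \<oplus>\<^bsub>M\<^esub> x)) = a \<oplus>\<^bsub>M\<^esub> b"
    and "x \<in> carrier M \<Longrightarrow> a \<in> carrier M \<Longrightarrow> b \<in> carrier M \<Longrightarrow> c \<in> carrier M \<Longrightarrow>
      \<ominus>\<^bsub>M\<^esub> x \<oplus>\<^bsub>M\<^esub> (a \<oplus>\<^bsub>M\<^esub> (b \<oplus>\<^bsub>M\<^esub> (x \<oplus>\<^bsub>M\<^esub> c))) = a \<oplus>\<^bsub>M\<^esub> (b \<oplus>\<^bsub>M\<^esub> c)"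
    and "x \<in> carrier M \<Longrightarrow> a \<in> carrier M \<Longrightarrow> b \<in> carrier M \<Longrightarrow> c \<in> carrier M \<Longrightarrow>
      \<ominus>\<^bsub>M\<^esub> x \<oplus>\<^bsub>M\<^esub> (a \<oplus>\<^bsub>M\<^esub> (b \<oplus>\<^bsub>M\<^esub> (c \<oplus>\<^bsub>M\<^esub> x))) = a \<oplus>\<^bsub>M\<^esub> (b \<oplus>\<^bsub>M\<^esub> c)"
  using module_cancel(3-7)[OF assms, of "\<ominus>\<^bsub>M\<^esub> x"] by (simp_all add: module_simps[OF assms])

lemma mod_homsD:
  assumes "f \<in> mod_homs R M N" "module R M" "module R N"
  shows "x \<in> carrier M \<Longrightarrow> f x \<in> carrier N"
    and "x \<in> carrier M \<Longrightarrow> y \<in> carrier M \<Longrightarrow> f (x \<oplus>\<^bsub>M\<^esub> y) = f x \<oplus>\<^bsub>N\<^esub> f y"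
    and "a \<in> carrier R \<Longrightarrow> x \<in> carrier M \<Longrightarrow> f (a \<odot>\<^bsub>M\<^esub> x) = a \<odot>\<^bsub>N\<^esub> f x"
    and "f \<zero>\<^bsub>M\<^esub> = \<zero>\<^bsub>N\<^esub>"
    and "x \<in> carrier M \<Longrightarrow> f (\<ominus>\<^bsub>M\<^esub> x) = \<ominus>\<^bsub>N\<^esub> f x"
proof -
  interpret M: module R M by fact
  interpret N: module R N by fact
  show c: "x \<in> carrier M \<Longrightarrow> f x \<in> carrier N" for x using assms(1) by (auto simp: mod_homs_def)
  show "x \<in> carrier M \<Longrightarrow> y \<in> carrier M \<Longrightarrow> f (x \<oplus>\<^bsub>M\<^esub> y) = f x \<oplus>\<^bsub>N\<^esub> f y"
    using assms(1) by (auto simp: mod_homs_def)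
  show s: "a \<in> carrier R \<Longrightarrow> x \<in> carrier M \<Longrightarrow> f (a \<odot>\<^bsub>M\<^esub> x) = a \<odot>\<^bsub>N\<^esub> f x" for a x
    using assms(1) by (auto simp: mod_homs_def)
  show "f \<zero>\<^bsub>M\<^esub> = \<zero>\<^bsub>N\<^esub>" using s[of \<zero> "\<zero>\<^bsub>M\<^esub>"] c by simp
  show "x \<in> carrier M \<Longrightarrow> f (\<ominus>\<^bsub>M\<^esub> x) = \<ominus>\<^bsub>N\<^esub> f x"
    using s[of "\<ominus> \<one>" x] c by (simp add: M.smult_l_minus N.smult_l_minus)
qed

lemma mod_homsI:
  assumes "\<And>x. x \<in> carrier M \<Longrightarrow> f x \<in> carrier N"
    and "\<And>x y. x \<in> carrier M \<Longrightarrow> y \<in> carrier M \<Longrightarrow> f (x \<oplus>\<^bsub>M\<^esub> y) = f x \<oplus>\<^bsub>N\<^esub> f y"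
    and "\<And>a x. a \<in> carrier R \<Longrightarrow> x \<in> carrier M \<Longrightarrow> f (a \<odot>\<^bsub>M\<^esub> x) = a \<odot>\<^bsub>N\<^esub> f x"
  shows "f \<in> mod_homs R M N"
  using assms by (auto simp: mod_homs_def)

lemma mod_dsum_simps [simp]:
  "Pair x y \<in> carrier (mod_dsum M N) \<longleftrightarrow> x \<in> carrier M \<and> y \<in> carrier N"
  "\<zero>\<^bsub>mod_dsum M N\<^esub> = Pair \<zero>\<^bsub>M\<^esub> \<zero>\<^bsub>N\<^esub>"
  "Pair x y \<oplus>\<^bsub>mod_dsum M N\<^esub> Pair x' y' = Pair (x \<oplus>\<^bsub>M\<^esub> x') (y \<oplus>\<^bsub>N\<^esub> y')"
  "a \<odot>\<^bsub>mod_dsum M N\<^esub> Pair x y = Pair (a \<odot>\<^bsub>M\<^esub> x) (a \<odot>\<^bsub>N\<^esub> y)"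
  by (auto simp: mod_dsum_def)

lemma mod_dsum_cases:
  assumes "p \<in> carrier (mod_dsum M N)"
  obtains x y where "p = Pair x y" "x \<in> carrier M" "y \<in> carrier N"
  using assms by (auto simp: mod_dsum_def)

lemma mod_dsum_ball [simp]:
  "(\<forall>p\<in>carrier (mod_dsum M N). P p) \<longleftrightarrow> (\<forall>x\<in>carrier M. \<forall>y\<in>carrier N. P (Pair x y))"
  by (auto simp: mod_dsum_def)

lemma mod_dsum_bex [simp]:
  "(\<exists>p\<in>carrier (mod_dsum M N). P p) \<longleftrightarrow> (\<exists>x\<in>carrier M. \<exists>y\<in>carrier N. P (Pair x y))"
  by (auto simp: mod_dsum_def)

lemma mod_dsum_module:
  assumes M: "module R M" and N: "module R N" shows "module R (mod_dsum M N)"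
proof -
  interpret M: module R M by fact
  interpret N: module R N by fact
  have ab: "abelian_group (mod_dsum M N)"
  proof (rule abelian_groupI)
    fix p assume "p \<in> carrier (mod_dsum M N)"
    then obtain x y where p: "p = Pair x y" "x \<in> carrier M" "y \<in> carrier N" by (rule mod_dsum_cases)
    then show "\<exists>q\<in>carrier (mod_dsum M N). q \<oplus>\<^bsub>mod_dsum M N\<^esub> p = \<zero>\<^bsub>mod_dsum M N\<^esub>"
      using M.l_neg[of x] N.l_neg[of y] by auto
  qed (auto elim!: mod_dsum_cases simp: M.a_ac N.a_ac)
  show ?thesis
    by (rule moduleI) (use ab in \<open>auto elim!: mod_dsum_cases simp: is_cring M.smult_l_distr N.smult_l_distr
      M.smult_r_distr N.smult_r_distr M.smult_assoc1 N.smult_assoc1\<close>)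
qed

lemma mod_dsum_minus [simp]:
  assumes M: "module R M" and N: "module R N" and x: "x \<in> carrier M" and y: "y \<in> carrier N"
  shows "\<ominus>\<^bsub>mod_dsum M N\<^esub> Pair x y = Pair (\<ominus>\<^bsub>M\<^esub> x) (\<ominus>\<^bsub>N\<^esub> y)"
proof -
  interpret S: module R "mod_dsum M N" using mod_dsum_module[OF M N] .
  have "Pair (\<ominus>\<^bsub>M\<^esub> x) (\<ominus>\<^bsub>N\<^esub> y) \<oplus>\<^bsub>mod_dsum M N\<^esub> Pair x y = \<zero>\<^bsub>mod_dsum M N\<^esub>"
    using module_simps(7)[OF M x] module_simps(7)[OF N y] by simp
  then show ?thesis
    using S.minus_equality module_simps(2)[OF M x] module_simps(2)[OF N y] x y by simp
qed

text \<open>A submodule containing the images of generators of both summands meets each summand in all of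
  it.\<close>

lemma mod_dsum_fin_gen:
  assumes M: "module R M" and N: "module R N" and "fin_gen R M" "fin_gen R N"
  shows "fin_gen R (mod_dsum M N)"
proof -
  interpret M: module R M by fact
  interpret N: module R N by fact
  interpret S: module R "mod_dsum M N" using mod_dsum_module[OF M N] .
  obtain A where A: "finite A" "A \<subseteq> carrier M" "\<And>L. submodule L R M \<Longrightarrow> A \<subseteq> L \<Longrightarrow> L = carrier M"
    using assms(3) by (auto simp: fin_gen_def)
  obtain B where B: "finite B" "B \<subseteq> carrier N" "\<And>L. submodule L R N \<Longrightarrow> B \<subseteq> L \<Longrightarrow> L = carrier N"
    using assms(4) by (auto simp: fin_gen_def)
  let ?G = "(\<lambda>x. Pair x \<zero>\<^bsub>N\<^esub>) ` A \<union> (\<lambda>y. Pair \<zero>\<^bsub>M\<^esub> y) ` B"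
  have "L = carrier (mod_dsum M N)" if L: "submodule L R (mod_dsum M N)" "?G \<subseteq> L" for L
  proof
    note sub = S.submoduleE[OF L(1)]
    show "L \<subseteq> carrier (mod_dsum M N)" by (rule sub(1))
    have z: "\<zero>\<^bsub>mod_dsum M N\<^esub> \<in> L"
      using subgroup.one_closed[OF submodule.axioms(1)[OF L(1)]] by simp
    let ?L1 = "{x \<in> carrier M. Pair x \<zero>\<^bsub>N\<^esub> \<in> L}"
    have "submodule ?L1 R M"
    proof (rule M.submoduleI)
      show "\<ominus>\<^bsub>M\<^esub> x \<in> ?L1" if "x \<in> ?L1" for x
        using that sub(3)[of "Pair x \<zero>\<^bsub>N\<^esub>"] M N by (simp add: module_simps(10)[OF N])
      show "x \<oplus>\<^bsub>M\<^esub> y \<in> ?L1" if "x \<in> ?L1" "y \<in> ?L1" for x y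
        using that sub(5)[of "Pair x \<zero>\<^bsub>N\<^esub>" "Pair y \<zero>\<^bsub>N\<^esub>"] by simp
      show "a \<odot>\<^bsub>M\<^esub> x \<in> ?L1" if "a \<in> carrier R" "x \<in> ?L1" for a x
        using that sub(4)[of a "Pair x \<zero>\<^bsub>N\<^esub>"] by simp
    qed (use z in auto)
    then have 1: "?L1 = carrier M" using A(2,3) L(2) by blast
    let ?L2 = "{y \<in> carrier N. Pair \<zero>\<^bsub>M\<^esub> y \<in> L}"
    have "submodule ?L2 R N"
    proof (rule N.submoduleI)
      show "\<ominus>\<^bsub>N\<^esub> x \<in> ?L2" if "x \<in> ?L2" for x
        using that sub(3)[of "Pair \<zero>\<^bsub>M\<^esub> x"] M N by (simp add: module_simps(10)[OF M])
      show "x \<oplus>\<^bsub>N\<^esub> y \<in> ?L2" if "x \<in> ?L2" "y \<in> ?L2" for x y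
        using that sub(5)[of "Pair \<zero>\<^bsub>M\<^esub> x" "Pair \<zero>\<^bsub>M\<^esub> y"] by simp
      show "a \<odot>\<^bsub>N\<^esub> x \<in> ?L2" if "a \<in> carrier R" "x \<in> ?L2" for a x
        using that sub(4)[of a "Pair \<zero>\<^bsub>M\<^esub> x"] by simp
    qed (use z in auto)
    then have 2: "?L2 = carrier N" using B(2,3) L(2) by blast
    show "carrier (mod_dsum M N) \<subseteq> L"
    proof
      fix p assume "p \<in> carrier (mod_dsum M N)"
      then obtain x y where p: "p = Pair x y" "x \<in> carrier M" "y \<in> carrier N" by (rule mod_dsum_cases)
      then have "Pair x \<zero>\<^bsub>N\<^esub> \<in> L" "Pair \<zero>\<^bsub>M\<^esub> y \<in> L" using 1 2 by auto
      then show "p \<in> L" using sub(5)[of "Pair x \<zero>\<^bsub>N\<^esub>" "Pair \<zero>\<^bsub>M\<^esub> y"] p by simp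
    qed
  qed
  moreover have "finite ?G" "?G \<subseteq> carrier (mod_dsum M N)" using A(1,2) B(1,2) by auto
  ultimately show ?thesis unfolding fin_gen_def by (intro exI[of _ ?G]) simp
qed

lemma projective_lift:
  fixes P M N :: "('a, 'a mel) module"
  assumes "projective_mod R P" "module R M" "module R N" "g \<in> mod_homs R M N"
    "g ` carrier M = carrier N" "f \<in> mod_homs R P N"
  shows "\<exists>h\<in>mod_homs R P M. \<forall>x\<in>carrier P. g (h x) = f x"
  by (rule assms(1)[unfolded projective_mod_def, THEN spec[of _ M], THEN spec[of _ N],
      THEN spec[of _ g], THEN spec[of _ f], THEN mp]) (intro conjI assms(2-6))

lemma mod_dsum_projective:
  assumes M: "module R M" and N: "module R N" and "projective_mod R M" "projective_mod R N"
  shows "projective_mod R (mod_dsum M N)"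
  unfolding projective_mod_def
proof (intro allI impI, elim conjE)
  fix A B :: "('a, 'a mel) module" and g f
  assume A: "module R A" and B: "module R B" and g: "g \<in> mod_homs R A B" "g ` carrier A = carrier B"
    and f: "f \<in> mod_homs R (mod_dsum M N) B"
  note * = mod_homsD[OF f mod_dsum_module[OF M N] B]
  note [simp] = module_simps[OF M] module_simps[OF N] module_simps[OF A]
  have "(\<lambda>x. f (Pair x \<zero>\<^bsub>N\<^esub>)) \<in> mod_homs R M B"
  proof (rule mod_homsI)
    fix x y a assume x: "x \<in> carrier M"
    show "f (Pair x \<zero>\<^bsub>N\<^esub>) \<in> carrier B" using x by (simp add: *(1))
    show "a \<in> carrier R \<Longrightarrow> f (Pair (a \<odot>\<^bsub>M\<^esub> x) \<zero>\<^bsub>N\<^esub>) = a \<odot>\<^bsub>B\<^esub> f (Pair x \<zero>\<^bsub>N\<^esub>)"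
      using *(3)[of a "Pair x \<zero>\<^bsub>N\<^esub>"] x by simp
    show "y \<in> carrier M \<Longrightarrow> f (Pair (x \<oplus>\<^bsub>M\<^esub> y) \<zero>\<^bsub>N\<^esub>) = f (Pair x \<zero>\<^bsub>N\<^esub>) \<oplus>\<^bsub>B\<^esub> f (Pair y \<zero>\<^bsub>N\<^esub>)"
      using *(2)[of "Pair x \<zero>\<^bsub>N\<^esub>" "Pair y \<zero>\<^bsub>N\<^esub>"] x by simp
  qed
  then obtain h where h: "h \<in> mod_homs R M A" "\<And>x. x \<in> carrier M \<Longrightarrow> g (h x) = f (Pair x \<zero>\<^bsub>N\<^esub>)"
    using projective_lift[OF assms(3) A B g] by blast
  have "(\<lambda>y. f (Pair \<zero>\<^bsub>M\<^esub> y)) \<in> mod_homs R N B"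
  proof (rule mod_homsI)
    fix x y a assume x: "x \<in> carrier N"
    show "f (Pair \<zero>\<^bsub>M\<^esub> x) \<in> carrier B" using x by (simp add: *(1))
    show "a \<in> carrier R \<Longrightarrow> f (Pair \<zero>\<^bsub>M\<^esub> (a \<odot>\<^bsub>N\<^esub> x)) = a \<odot>\<^bsub>B\<^esub> f (Pair \<zero>\<^bsub>M\<^esub> x)"
      using *(3)[of a "Pair \<zero>\<^bsub>M\<^esub> x"] x by simp
    show "y \<in> carrier N \<Longrightarrow> f (Pair \<zero>\<^bsub>M\<^esub> (x \<oplus>\<^bsub>N\<^esub> y)) = f (Pair \<zero>\<^bsub>M\<^esub> x) \<oplus>\<^bsub>B\<^esub> f (Pair \<zero>\<^bsub>M\<^esub> y)"
      using *(2)[of "Pair \<zero>\<^bsub>M\<^esub> x" "Pair \<zero>\<^bsub>M\<^esub> y"] x by simp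
  qed
  then obtain k where k: "k \<in> mod_homs R N A" "\<And>y. y \<in> carrier N \<Longrightarrow> g (k y) = f (Pair \<zero>\<^bsub>M\<^esub> y)"
    using projective_lift[OF assms(4) A B g] by blast
  note hh [simp] = mod_homsD[OF h(1) M A] mod_homsD[OF k(1) N A]
  have "(\<lambda>p. h (pfst p) \<oplus>\<^bsub>A\<^esub> k (psnd p)) \<in> mod_homs R (mod_dsum M N) A"
  proof (rule mod_homsI)
    fix p q a assume "p \<in> carrier (mod_dsum M N)"
    then obtain x y where p: "p = Pair x y" "x \<in> carrier M" "y \<in> carrier N" by (rule mod_dsum_cases)
    then show "h (pfst p) \<oplus>\<^bsub>A\<^esub> k (psnd p) \<in> carrier A" by simp
    show "a \<in> carrier R \<Longrightarrow> h (pfst (a \<odot>\<^bsub>mod_dsum M N\<^esub> p)) \<oplus>\<^bsub>A\<^esub> k (psnd (a \<odot>\<^bsub>mod_dsum M N\<^esub> p)) =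
        a \<odot>\<^bsub>A\<^esub> (h (pfst p) \<oplus>\<^bsub>A\<^esub> k (psnd p))" using p by simp
    assume "q \<in> carrier (mod_dsum M N)"
    then obtain x' y' where q: "q = Pair x' y'" "x' \<in> carrier M" "y' \<in> carrier N" by (rule mod_dsum_cases)
    show "h (pfst (p \<oplus>\<^bsub>mod_dsum M N\<^esub> q)) \<oplus>\<^bsub>A\<^esub> k (psnd (p \<oplus>\<^bsub>mod_dsum M N\<^esub> q)) =
        (h (pfst p) \<oplus>\<^bsub>A\<^esub> k (psnd p)) \<oplus>\<^bsub>A\<^esub> (h (pfst q) \<oplus>\<^bsub>A\<^esub> k (psnd q))"
      using p q by (simp add: module_ac[OF A])
  qed
  moreover have "g (h x \<oplus>\<^bsub>A\<^esub> k y) = f (Pair x y)" if "x \<in> carrier M" "y \<in> carrier N" for x y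
    using that mod_homsD(2)[OF g(1) A B] h(2) k(2) *(2)[of "Pair x \<zero>\<^bsub>N\<^esub>" "Pair \<zero>\<^bsub>M\<^esub> y"] by simp
  ultimately show "\<exists>h\<in>mod_homs R (mod_dsum M N) A. \<forall>x\<in>carrier (mod_dsum M N). g (h x) = f x"
    by (intro bexI[of _ "\<lambda>p. h (pfst p) \<oplus>\<^bsub>A\<^esub> k (psnd p)"]) simp_all
qed

text \<open>Complexes are indexed by integers, so that \<open>cmod X (i - 1 + 1)\<close>, \<open>cmod X (i + 1 + 1)\<close> and the like
  must be brought to a normal form before the rules for differentials apply.\<close>

lemma int_index [simp]: "i + 1 + 1 = i + (2::int)" "i - 1 + 2 = i + (1::int)" "i + 2 - 1 = i + (1::int)"
  "1 + i + 1 = i + (2::int)"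
  by simp_all

lemma cpxD:
  assumes X: "bounded_cpx R X"
  shows "module R (cmod X i)" and "fin_gen R (cmod X i)"
    and "cdif X i \<in> mod_homs R (cmod X i) (cmod X (i + 1))"
    and "x \<in> carrier (cmod X i) \<Longrightarrow> j = i + 1 \<Longrightarrow> cdif X i x \<in> carrier (cmod X j)"
    and "x \<in> carrier (cmod X i) \<Longrightarrow> y \<in> carrier (cmod X i) \<Longrightarrow>
      cdif X i (x \<oplus>\<^bsub>cmod X i\<^esub> y) = cdif X i x \<oplus>\<^bsub>cmod X (i + 1)\<^esub> cdif X i y"
    and "a \<in> carrier R \<Longrightarrow> x \<in> carrier (cmod X i) \<Longrightarrow>
      cdif X i (a \<odot>\<^bsub>cmod X i\<^esub> x) = a \<odot>\<^bsub>cmod X (i + 1)\<^esub> cdif X i x"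
    and "x \<in> carrier (cmod X i) \<Longrightarrow> cdif X i (\<ominus>\<^bsub>cmod X i\<^esub> x) = \<ominus>\<^bsub>cmod X (i + 1)\<^esub> cdif X i x"
    and "cdif X i \<zero>\<^bsub>cmod X i\<^esub> = \<zero>\<^bsub>cmod X (i + 1)\<^esub>"
    and "x \<in> carrier (cmod X i) \<Longrightarrow> j = i + 1 \<Longrightarrow> cdif X j (cdif X i x) = \<zero>\<^bsub>cmod X (j + 1)\<^esub>"
    and "finite {i. carrier (cmod X i) \<noteq> {\<zero>\<^bsub>cmod X i\<^esub>}}"
proof -
  show m: "module R (cmod X i)" and "fin_gen R (cmod X i)" and
    h: "cdif X i \<in> mod_homs R (cmod X i) (cmod X (i + 1))" for i using X by (auto simp: bounded_cpx_def)
  note * = mod_homsD[OF h m m]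
  show "x \<in> carrier (cmod X i) \<Longrightarrow> j = i + 1 \<Longrightarrow> cdif X i x \<in> carrier (cmod X j)"
    and "x \<in> carrier (cmod X i) \<Longrightarrow> y \<in> carrier (cmod X i) \<Longrightarrow>
      cdif X i (x \<oplus>\<^bsub>cmod X i\<^esub> y) = cdif X i x \<oplus>\<^bsub>cmod X (i + 1)\<^esub> cdif X i y"
    and "a \<in> carrier R \<Longrightarrow> x \<in> carrier (cmod X i) \<Longrightarrow>
      cdif X i (a \<odot>\<^bsub>cmod X i\<^esub> x) = a \<odot>\<^bsub>cmod X (i + 1)\<^esub> cdif X i x"
    and "x \<in> carrier (cmod X i) \<Longrightarrow> cdif X i (\<ominus>\<^bsub>cmod X i\<^esub> x) = \<ominus>\<^bsub>cmod X (i + 1)\<^esub> cdif X i x"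
    and "cdif X i \<zero>\<^bsub>cmod X i\<^esub> = \<zero>\<^bsub>cmod X (i + 1)\<^esub>"
    using * by simp_all
  show "x \<in> carrier (cmod X i) \<Longrightarrow> j = i + 1 \<Longrightarrow> cdif X j (cdif X i x) = \<zero>\<^bsub>cmod X (j + 1)\<^esub>"
    using X by (simp add: bounded_cpx_def)
  show "finite {i. carrier (cmod X i) \<noteq> {\<zero>\<^bsub>cmod X i\<^esub>}}" using X by (auto simp: bounded_cpx_def)
qed

lemmas cpx_simps = cpxD(1,4-9) 
  module_simps[OF cpxD(1)]
lemmas cpx_ac = module_ac[OF cpxD(1)] module_cancel[OF cpxD(1)] module_cancel'[OF cpxD(1)]

lemma bounded_cpxI:
  assumes "\<And>i. module R (cmod X i)" "\<And>i. fin_gen R (cmod X i)"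
    and "\<And>i. cdif X i \<in> mod_homs R (cmod X i) (cmod X (i + 1))"
    and "\<And>i x. x \<in> carrier (cmod X i) \<Longrightarrow> cdif X (i + 1) (cdif X i x) = \<zero>\<^bsub>cmod X (i + 2)\<^esub>"
    and "finite {i. carrier (cmod X i) \<noteq> {\<zero>\<^bsub>cmod X i\<^esub>}}"
  shows "bounded_cpx R X"
  using assms by (simp add: bounded_cpx_def)

lemma chain_mapD:
  assumes f: "chain_map R X Y f" and X: "bounded_cpx R X" and Y: "bounded_cpx R Y"
  shows "f i \<in> mod_homs R (cmod X i) (cmod Y i)"
    and "x \<in> carrier (cmod X i) \<Longrightarrow> f i x \<in> carrier (cmod Y i)"
    and "x \<in> carrier (cmod X i) \<Longrightarrow> y \<in> carrier (cmod X i) \<Longrightarrow>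
      f i (x \<oplus>\<^bsub>cmod X i\<^esub> y) = f i x \<oplus>\<^bsub>cmod Y i\<^esub> f i y"
    and "a \<in> carrier R \<Longrightarrow> x \<in> carrier (cmod X i) \<Longrightarrow> f i (a \<odot>\<^bsub>cmod X i\<^esub> x) = a \<odot>\<^bsub>cmod Y i\<^esub> f i x"
    and "f i \<zero>\<^bsub>cmod X i\<^esub> = \<zero>\<^bsub>cmod Y i\<^esub>"
    and "x \<in> carrier (cmod X i) \<Longrightarrow> f i (\<ominus>\<^bsub>cmod X i\<^esub> x) = \<ominus>\<^bsub>cmod Y i\<^esub> f i x"
    and "x \<in> carrier (cmod X i) \<Longrightarrow> cdif Y i (f i x) = f (i + 1) (cdif X i x)"
proof -
  show h: "f i \<in> mod_homs R (cmod X i) (cmod Y i)" using f by (simp add: chain_map_def)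
  show "x \<in> carrier (cmod X i) \<Longrightarrow> cdif Y i (f i x) = f (i + 1) (cdif X i x)"
    using f by (simp add: chain_map_def)
qed (use mod_homsD[of "f i" "cmod X i" "cmod Y i"] f cpxD(1)[OF X] cpxD(1)[OF Y] in
    \<open>simp_all add: chain_map_def\<close>)

lemma chain_mapI:
  assumes "\<And>i x. x \<in> carrier (cmod X i) \<Longrightarrow> f i x \<in> carrier (cmod Y i)"
    and "\<And>i x y. x \<in> carrier (cmod X i) \<Longrightarrow> y \<in> carrier (cmod X i) \<Longrightarrow>
      f i (x \<oplus>\<^bsub>cmod X i\<^esub> y) = f i x \<oplus>\<^bsub>cmod Y i\<^esub> f i y"
    and "\<And>i a x. a \<in> carrier R \<Longrightarrow> x \<in> carrier (cmod X i) \<Longrightarrow> f i (a \<odot>\<^bsub>cmod X i\<^esub> x) = a \<odot>\<^bsub>cmod Y i\<^esub> f i x"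
    and "\<And>i x. x \<in> carrier (cmod X i) \<Longrightarrow> cdif Y i (f i x) = f (i + 1) (cdif X i x)"
  shows "chain_map R X Y f"
  using assms by (simp add: chain_map_def mod_homsI)

definition htpy_maps :: "'a cpx \<Rightarrow> 'a cpx \<Rightarrow> (int \<Rightarrow> 'a mel \<Rightarrow> 'a mel) \<Rightarrow> bool" where
  "htpy_maps X Y h \<longleftrightarrow> (\<forall>i. h i \<in> mod_homs R (cmod X i) (cmod Y (i - 1)))"

lemma htpy_mapsD:
  assumes f: "htpy_maps X Y h" and X: "bounded_cpx R X" and Y: "bounded_cpx R Y"
  shows "x \<in> carrier (cmod X i) \<Longrightarrow> j = i - 1 \<Longrightarrow> h i x \<in> carrier (cmod Y j)"
    and "x \<in> carrier (cmod X i) \<Longrightarrow> y \<in> carrier (cmod X i) \<Longrightarrow>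
      h i (x \<oplus>\<^bsub>cmod X i\<^esub> y) = h i x \<oplus>\<^bsub>cmod Y (i - 1)\<^esub> h i y"
    and "a \<in> carrier R \<Longrightarrow> x \<in> carrier (cmod X i) \<Longrightarrow> h i (a \<odot>\<^bsub>cmod X i\<^esub> x) = a \<odot>\<^bsub>cmod Y (i - 1)\<^esub> h i x"
    and "h i \<zero>\<^bsub>cmod X i\<^esub> = \<zero>\<^bsub>cmod Y (i - 1)\<^esub>"
    and "x \<in> carrier (cmod X i) \<Longrightarrow> h i (\<ominus>\<^bsub>cmod X i\<^esub> x) = \<ominus>\<^bsub>cmod Y (i - 1)\<^esub> h i x"
  using mod_homsD[of "h i" "cmod X i" "cmod Y (i - 1)"] f cpxD(1)[OF X] cpxD(1)[OF Y]
  by (simp_all add: htpy_maps_def)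

lemma htpy_mapsI:
  assumes "\<And>i x. x \<in> carrier (cmod X i) \<Longrightarrow> h i x \<in> carrier (cmod Y (i - 1))"
    and "\<And>i x y. x \<in> carrier (cmod X i) \<Longrightarrow> y \<in> carrier (cmod X i) \<Longrightarrow>
      h i (x \<oplus>\<^bsub>cmod X i\<^esub> y) = h i x \<oplus>\<^bsub>cmod Y (i - 1)\<^esub> h i y"
    and "\<And>i a x. a \<in> carrier R \<Longrightarrow> x \<in> carrier (cmod X i) \<Longrightarrow>
      h i (a \<odot>\<^bsub>cmod X i\<^esub> x) = a \<odot>\<^bsub>cmod Y (i - 1)\<^esub> h i x"
  shows "htpy_maps X Y h"
  using assms by (simp add: htpy_maps_def mod_homsI)

lemma homotopicI:
  assumes "htpy_maps X Y h"
    and "\<And>i x. x \<in> carrier (cmod X i) \<Longrightarrow> f i x =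
      g i x \<oplus>\<^bsub>cmod Y i\<^esub> (cdif Y (i - 1) (h i x) \<oplus>\<^bsub>cmod Y i\<^esub> h (i + 1) (cdif X i x))"
  shows "homotopic R X Y f g"
  using assms unfolding homotopic_def htpy_maps_def by blast

lemma homotopicE:
  assumes "homotopic R X Y f g"
  obtains h where "htpy_maps X Y h"
    and "\<And>i x. x \<in> carrier (cmod X i) \<Longrightarrow> f i x =
      g i x \<oplus>\<^bsub>cmod Y i\<^esub> (cdif Y (i - 1) (h i x) \<oplus>\<^bsub>cmod Y i\<^esub> h (i + 1) (cdif X i x))"
  using assms unfolding homotopic_def htpy_maps_def by blast

lemma finite_int_shift:
  "finite {i :: int. P i} \<Longrightarrow> finite {i. P (i + k)}"
proof (rule finite_subset)
  show "{i. P (i + k)} \<subseteq> (\<lambda>i. i - k) ` {i. P i}"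
  proof
    fix i assume "i \<in> {i. P (i + k)}"
    then show "i \<in> (\<lambda>i. i - k) ` {i. P i}" by (intro image_eqI[of _ _ "i + k"]) auto
  qed
qed simp

lemma shift_simps [simp]:
  "cmod (shift_cpx X) i = cmod X (i + 1)"
  "cdif (shift_cpx X) i x = \<ominus>\<^bsub>cmod X (i + 2)\<^esub> cdif X (i + 1) x"
  by (simp_all add: shift_cpx_def)

lemma shift_bounded:
  assumes X: "bounded_cpx R X" shows "bounded_cpx R (shift_cpx X)"
proof -
  note [simp] = cpxD[OF X] module_simps[OF cpxD(1)[OF X]]
  show ?thesis
    by (rule bounded_cpxI) (auto intro!: mod_homsI finite_int_shift)
qed

text \<open>Inverse to \<open>shift_cpx\<close> up to the values of the differentials outside the carriers.\<close>

definition unshift_cpx :: "'a cpx \<Rightarrow> 'a cpx" where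
  "unshift_cpx X =
    \<lparr> cmod = (\<lambda>i. cmod X (i - 1)),
      cdif = (\<lambda>i x. \<ominus>\<^bsub>cmod X i\<^esub> cdif X (i - 1) x) \<rparr>"

lemma unshift_simps [simp]:
  "cmod (unshift_cpx X) i = cmod X (i - 1)"
  "cdif (unshift_cpx X) i x = \<ominus>\<^bsub>cmod X i\<^esub> cdif X (i - 1) x"
  by (simp_all add: unshift_cpx_def)

lemma unshift_bounded:
  assumes X: "bounded_cpx R X" shows "bounded_cpx R (unshift_cpx X)"
proof -
  note [simp] = cpxD[OF X] module_simps[OF cpxD(1)[OF X]]
  show ?thesis
    by (rule bounded_cpxI)
      (use cpxD(5-8)[OF X, where i = "_ - 1"] finite_int_shift[OF cpxD(10)[OF X], of "-1"] in
        \<open>auto intro!: mod_homsI\<close>)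
qed

lemma cone_simps [simp]:
  "cmod (cone_cpx X Y f) i = mod_dsum (cmod X (i + 1)) (cmod Y i)"
  "cdif (cone_cpx X Y f) i (Pair x y) = Pair (\<ominus>\<^bsub>cmod X (i + 2)\<^esub> cdif X (i + 1) x)
                         (f (i + 1) x \<oplus>\<^bsub>cmod Y (i + 1)\<^esub> cdif Y i y)"
  by (simp_all add: cone_cpx_def)

lemma cone_bounded:
  assumes X: "bounded_cpx R X" and Y: "bounded_cpx R Y" and f: "chain_map R X Y f"
  shows "bounded_cpx R (cone_cpx X Y f)"
proof (rule bounded_cpxI)
  note [simp] = cpxD[OF X] module_simps[OF cpxD(1)[OF X]] cpxD[OF Y] module_simps[OF cpxD(1)[OF Y]]
    chain_mapD[OF f X Y]
  note ac = module_ac[OF cpxD(1)[OF X]] module_ac[OF cpxD(1)[OF Y]]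
  fix i
  show "module R (cmod (cone_cpx X Y f) i)" by (simp add: mod_dsum_module)
  show "fin_gen R (cmod (cone_cpx X Y f) i)" by (simp add: mod_dsum_fin_gen)
  show "cdif (cone_cpx X Y f) i \<in> mod_homs R (cmod (cone_cpx X Y f) i) (cmod (cone_cpx X Y f) (i + 1))"
    by (rule mod_homsI) (auto elim!: mod_dsum_cases simp: ac)
  show "cdif (cone_cpx X Y f) (i + 1) (cdif (cone_cpx X Y f) i x) = \<zero>\<^bsub>cmod (cone_cpx X Y f) (i + 2)\<^esub>"
    if "x \<in> carrier (cmod (cone_cpx X Y f) i)" for x
    using that by (auto elim!: mod_dsum_cases)
  have "{i. carrier (cmod (cone_cpx X Y f) i) \<noteq> {\<zero>\<^bsub>cmod (cone_cpx X Y f) i\<^esub>}} \<subseteq>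
    {i. carrier (cmod X (i + 1)) \<noteq> {\<zero>\<^bsub>cmod X (i + 1)\<^esub>}} \<union> {i. carrier (cmod Y i) \<noteq> {\<zero>\<^bsub>cmod Y i\<^esub>}}"
    by (auto simp: mod_dsum_def)
  then show "finite {i. carrier (cmod (cone_cpx X Y f) i) \<noteq> {\<zero>\<^bsub>cmod (cone_cpx X Y f) i\<^esub>}}"
    by (rule finite_subset) (use cpxD(10)[OF Y] finite_int_shift[OF cpxD(10)[OF X], of 1] in blast)
qed

section \<open>Chain maps up to homotopy\<close>

lemma chain_map_id: "chain_map R X X (\<lambda>i x. x)"
  by (rule chain_mapI) simp_all

lemma chain_map_comp:
  assumes f: "chain_map R X Y f" and g: "chain_map R Y Z g"
    and X: "bounded_cpx R X" and Y: "bounded_cpx R Y" and Z: "bounded_cpx R Z"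
  shows "chain_map R X Z (\<lambda>i x. g i (f i x))"
  by (rule chain_mapI) (simp_all add: chain_mapD[OF f X Y] chain_mapD[OF g Y Z] cpxD(4)[OF X])

lemma chain_map_zero:
  assumes "bounded_cpx R X" "bounded_cpx R Y"
  shows "chain_map R X Y (\<lambda>i x. \<zero>\<^bsub>cmod Y i\<^esub>)"
  by (rule chain_mapI) (simp_all add: cpx_simps[OF assms(2)])

lemma chain_map_add:
  assumes f: "chain_map R X Y f" and g: "chain_map R X Y g"
    and X: "bounded_cpx R X" and Y: "bounded_cpx R Y"
  shows "chain_map R X Y (\<lambda>i x. f i x \<oplus>\<^bsub>cmod Y i\<^esub> g i x)"
  by (rule chain_mapI) (simp_all add: chain_mapD[OF f X Y] chain_mapD[OF g X Y] cpx_simps[OF X]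
    cpx_simps[OF Y] module_ac[OF cpxD(1)[OF Y]])

lemma chain_map_smult:
  assumes a: "a \<in> carrier R" and X: "bounded_cpx R X"
  shows "chain_map R X X (\<lambda>i x. a \<odot>\<^bsub>cmod X i\<^esub> x)"
proof (rule chain_mapI)
  fix i b x assume *: "b \<in> carrier R" "x \<in> carrier (cmod X i)"
  interpret M: module R "cmod X i" using cpxD(1)[OF X] .
  show "a \<odot>\<^bsub>cmod X i\<^esub> (b \<odot>\<^bsub>cmod X i\<^esub> x) = b \<odot>\<^bsub>cmod X i\<^esub> (a \<odot>\<^bsub>cmod X i\<^esub> x)"
    using * a by (simp add: M.smult_assoc1[symmetric] m_comm)
qed (simp_all add: cpx_simps[OF X] a)

lemma chain_map_shift:
  assumes f: "chain_map R X Y f" and X: "bounded_cpx R X" and Y: "bounded_cpx R Y"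
  shows "chain_map R (shift_cpx X) (shift_cpx Y) (\<lambda>i. f (i + 1))"
  by (rule chain_mapI) (simp_all add: chain_mapD[OF f X Y] cpx_simps[OF X])

lemma homotopic_eqI:
  assumes X: "bounded_cpx R X" and Y: "bounded_cpx R Y" and f: "chain_map R X Y f"
    and eq: "\<And>i x. x \<in> carrier (cmod X i) \<Longrightarrow> f i x = g i x"
  shows "homotopic R X Y f g"
proof (rule homotopicI[of _ _ "\<lambda>i x. \<zero>\<^bsub>cmod Y (i - 1)\<^esub>"])
  show "htpy_maps X Y (\<lambda>i x. \<zero>\<^bsub>cmod Y (i - 1)\<^esub>)"
    by (rule htpy_mapsI) (simp_all add: cpx_simps[OF Y])
  fix i x assume "x \<in> carrier (cmod X i)"
  then show "f i x = g i x \<oplus>\<^bsub>cmod Y i\<^esub>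
       (cdif Y (i - 1) \<zero>\<^bsub>cmod Y (i - 1)\<^esub> \<oplus>\<^bsub>cmod Y i\<^esub> \<zero>\<^bsub>cmod Y (i + 1 - 1)\<^esub>)"
    using cpxD(8)[OF Y, of "i - 1"] eq[of x i] chain_mapD(2)[OF f X Y, of x i]
    by (simp add: module_simps[OF cpxD(1)[OF Y]])
qed

lemma homotopic_refl:
  assumes "bounded_cpx R X" "bounded_cpx R Y" "chain_map R X Y f"
  shows "homotopic R X Y f f"
  using assms by (rule homotopic_eqI) simp

lemma htpy_maps_add:
  assumes h: "htpy_maps X Y h" and k: "htpy_maps X Y k" and X: "bounded_cpx R X" and Y: "bounded_cpx R Y"
  shows "htpy_maps X Y (\<lambda>i x. h i x \<oplus>\<^bsub>cmod Y (i - 1)\<^esub> k i x)"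
  by (rule htpy_mapsI) (simp_all add: htpy_mapsD[OF h X Y] htpy_mapsD[OF k X Y] cpx_simps[OF X]
    cpx_simps[OF Y] module_ac[OF cpxD(1)[OF Y]])

lemma htpy_maps_minus:
  assumes h: "htpy_maps X Y h" and X: "bounded_cpx R X" and Y: "bounded_cpx R Y"
  shows "htpy_maps X Y (\<lambda>i x. \<ominus>\<^bsub>cmod Y (i - 1)\<^esub> h i x)"
  by (rule htpy_mapsI) (simp_all add: htpy_mapsD[OF h X Y] cpx_simps[OF X] cpx_simps[OF Y])

text \<open>A homotopy takes \<open>cmod X i\<close> to \<open>cmod Y (i - 1)\<close>, whence differentials in degree \<open>i - 1\<close>.\<close>

lemma cpxD_pred:
  assumes X: "bounded_cpx R X"
  shows "x \<in> carrier (cmod X (i - 1)) \<Longrightarrow> y \<in> carrier (cmod X (i - 1)) \<Longrightarrow>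
      cdif X (i - 1) (x \<oplus>\<^bsub>cmod X (i - 1)\<^esub> y) = cdif X (i - 1) x \<oplus>\<^bsub>cmod X i\<^esub> cdif X (i - 1) y"
    and "a \<in> carrier R \<Longrightarrow> x \<in> carrier (cmod X (i - 1)) \<Longrightarrow>
      cdif X (i - 1) (a \<odot>\<^bsub>cmod X (i - 1)\<^esub> x) = a \<odot>\<^bsub>cmod X i\<^esub> cdif X (i - 1) x"
    and "x \<in> carrier (cmod X (i - 1)) \<Longrightarrow> cdif X (i - 1) (\<ominus>\<^bsub>cmod X (i - 1)\<^esub> x) = \<ominus>\<^bsub>cmod X i\<^esub> cdif X (i - 1) x"
    and "cdif X (i - 1) \<zero>\<^bsub>cmod X (i - 1)\<^esub> = \<zero>\<^bsub>cmod X i\<^esub>"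
  using cpxD(5-8)[OF X, where i = "i - 1"] by simp_all

lemma homotopic_sym:
  assumes X: "bounded_cpx R X" and Y: "bounded_cpx R Y" and g: "chain_map R X Y g"
    and "homotopic R X Y f g"
  shows "homotopic R X Y g f"
proof -
  obtain h where h: "htpy_maps X Y h" and e: "\<And>i x. x \<in> carrier (cmod X i) \<Longrightarrow> f i x =
      g i x \<oplus>\<^bsub>cmod Y i\<^esub> (cdif Y (i - 1) (h i x) \<oplus>\<^bsub>cmod Y i\<^esub> h (i + 1) (cdif X i x))"
    using assms(4) by (rule homotopicE) blast
  show ?thesis
    by (rule homotopicI[OF htpy_maps_minus[OF h X Y]])
      (simp add: e htpy_mapsD[OF h X Y] chain_mapD[OF g X Y] cpx_simps[OF X] cpx_simps[OF Y]
        cpxD_pred[OF Y] cpx_ac[OF Y])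
qed

lemma homotopic_trans:
  assumes X: "bounded_cpx R X" and Y: "bounded_cpx R Y" and c: "chain_map R X Y c"
    and "homotopic R X Y f g" "homotopic R X Y g c"
  shows "homotopic R X Y f c"
proof -
  obtain h where h: "htpy_maps X Y h" and e: "\<And>i x. x \<in> carrier (cmod X i) \<Longrightarrow> f i x =
      g i x \<oplus>\<^bsub>cmod Y i\<^esub> (cdif Y (i - 1) (h i x) \<oplus>\<^bsub>cmod Y i\<^esub> h (i + 1) (cdif X i x))"
    using assms(4) by (rule homotopicE) blast
  obtain k where k: "htpy_maps X Y k" and e2: "\<And>i x. x \<in> carrier (cmod X i) \<Longrightarrow> g i x =
      c i x \<oplus>\<^bsub>cmod Y i\<^esub> (cdif Y (i - 1) (k i x) \<oplus>\<^bsub>cmod Y i\<^esub> k (i + 1) (cdif X i x))"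
    using assms(5) by (rule homotopicE) blast
  show ?thesis
    by (rule homotopicI[OF htpy_maps_add[OF h k X Y]])
      (simp add: e e2 htpy_mapsD[OF h X Y] htpy_mapsD[OF k X Y] chain_mapD[OF c X Y] cpx_simps[OF X]
        cpx_simps[OF Y] cpxD_pred[OF Y] module_ac[OF cpxD(1)[OF Y]])
qed

text \<open>If \<open>f - f' = d h + h d\<close> and \<open>g - g' = d k + k d\<close>, then \<open>g' h + k f\<close> is a homotopy from \<open>g f\<close> to
  \<open>g' f'\<close>.\<close>

lemma homotopic_comp:
  assumes X: "bounded_cpx R X" and Y: "bounded_cpx R Y" and Z: "bounded_cpx R Z"
    and f: "chain_map R X Y f" "chain_map R X Y f'" and g: "chain_map R Y Z g" "chain_map R Y Z g'"
    and "homotopic R X Y f f'" "homotopic R Y Z g g'"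
  shows "homotopic R X Z (\<lambda>i x. g i (f i x)) (\<lambda>i x. g' i (f' i x))"
proof -
  obtain h where h: "htpy_maps X Y h" and e: "\<And>i x. x \<in> carrier (cmod X i) \<Longrightarrow> f i x =
      f' i x \<oplus>\<^bsub>cmod Y i\<^esub> (cdif Y (i - 1) (h i x) \<oplus>\<^bsub>cmod Y i\<^esub> h (i + 1) (cdif X i x))"
    using assms(8) by (rule homotopicE) blast
  obtain k where k: "htpy_maps Y Z k" and e2: "\<And>i x. x \<in> carrier (cmod Y i) \<Longrightarrow> g i x =
      g' i x \<oplus>\<^bsub>cmod Z i\<^esub> (cdif Z (i - 1) (k i x) \<oplus>\<^bsub>cmod Z i\<^esub> k (i + 1) (cdif Y i x))"
    using assms(9) by (rule homotopicE) blast
  note [simp] = htpy_mapsD[OF h X Y] htpy_mapsD[OF k Y Z] chain_mapD[OF f(1) X Y] chain_mapD[OF f(2) X Y]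
    chain_mapD[OF g(1) Y Z] chain_mapD[OF g(2) Y Z] cpx_simps[OF X] cpx_simps[OF Y] cpx_simps[OF Z]
    cpxD_pred[OF Z]
  have gc: "cdif Z (i - 1) (g' (i - 1) y) = g' i (cdif Y (i - 1) y)" if "y \<in> carrier (cmod Y (i - 1))" for i y
    using chain_mapD(7)[OF g(2) Y Z that] by simp
  have 1: "htpy_maps X Z (\<lambda>i x. g' (i - 1) (h i x) \<oplus>\<^bsub>cmod Z (i - 1)\<^esub> k i (f i x))"
    by (rule htpy_mapsI) (simp_all add: module_ac[OF cpxD(1)[OF Z]])
  show ?thesis
  proof (rule homotopicI[OF 1])
    fix i x assume x: "x \<in> carrier (cmod X i)"
    have "g i (f i x) = g' i (f i x) \<oplus>\<^bsub>cmod Z i\<^esub> (cdif Z (i - 1) (k i (f i x)) \<oplus>\<^bsub>cmod Z i\<^esub> k (i + 1) (f (i + 1) (cdif X i x)))"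
      using e2[of "f i x" i] x by simp
    also have "g' i (f i x) = g' i (f' i x) \<oplus>\<^bsub>cmod Z i\<^esub> (g' i (cdif Y (i - 1) (h i x)) \<oplus>\<^bsub>cmod Z i\<^esub> g' i (h (i + 1) (cdif X i x)))"
      using x by (simp add: e)
    finally show "g i (f i x) = g' i (f' i x) \<oplus>\<^bsub>cmod Z i\<^esub> (cdif Z (i - 1) (g' (i - 1) (h i x) \<oplus>\<^bsub>cmod Z (i - 1)\<^esub> k i (f i x)) \<oplus>\<^bsub>cmod Z i\<^esub>
        (g' (i + 1 - 1) (h (i + 1) (cdif X i x)) \<oplus>\<^bsub>cmod Z (i + 1 - 1)\<^esub> k (i + 1) (f (i + 1) (cdif X i x))))"
      using x by (simp add: gc module_ac[OF cpxD(1)[OF Z]])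
  qed
qed

lemma homotopic_add:
  assumes X: "bounded_cpx R X" and Y: "bounded_cpx R Y"
    and f: "chain_map R X Y f" "chain_map R X Y f'" and g: "chain_map R X Y g" "chain_map R X Y g'"
    and "homotopic R X Y f f'" "homotopic R X Y g g'"
  shows "homotopic R X Y (\<lambda>i x. f i x \<oplus>\<^bsub>cmod Y i\<^esub> g i x) (\<lambda>i x. f' i x \<oplus>\<^bsub>cmod Y i\<^esub> g' i x)"
proof -
  obtain h where h: "htpy_maps X Y h" and e: "\<And>i x. x \<in> carrier (cmod X i) \<Longrightarrow> f i x =
      f' i x \<oplus>\<^bsub>cmod Y i\<^esub> (cdif Y (i - 1) (h i x) \<oplus>\<^bsub>cmod Y i\<^esub> h (i + 1) (cdif X i x))"
    using assms(7) by (rule homotopicE) blast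
  obtain k where k: "htpy_maps X Y k" and e2: "\<And>i x. x \<in> carrier (cmod X i) \<Longrightarrow> g i x =
      g' i x \<oplus>\<^bsub>cmod Y i\<^esub> (cdif Y (i - 1) (k i x) \<oplus>\<^bsub>cmod Y i\<^esub> k (i + 1) (cdif X i x))"
    using assms(8) by (rule homotopicE) blast
  show ?thesis
    by (rule homotopicI[OF htpy_maps_add[OF h k X Y]])
      (simp add: e e2 htpy_mapsD[OF h X Y] htpy_mapsD[OF k X Y] chain_mapD[OF f(2) X Y]
        chain_mapD[OF g(2) X Y] cpx_simps[OF X]
        cpx_simps[OF Y] cpxD_pred[OF Y] module_ac[OF cpxD(1)[OF Y]])
qed

text \<open>The sign of the homotopy compensates for the sign of the shifted differentials.\<close>

lemma homotopic_shift:
  assumes X: "bounded_cpx R X" and Y: "bounded_cpx R Y" and g: "chain_map R X Y g"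
    and "homotopic R X Y f g"
  shows "homotopic R (shift_cpx X) (shift_cpx Y) (\<lambda>i. f (i + 1)) (\<lambda>i. g (i + 1))"
proof -
  obtain h where h: "htpy_maps X Y h" and e: "\<And>i x. x \<in> carrier (cmod X i) \<Longrightarrow> f i x =
      g i x \<oplus>\<^bsub>cmod Y i\<^esub> (cdif Y (i - 1) (h i x) \<oplus>\<^bsub>cmod Y i\<^esub> h (i + 1) (cdif X i x))"
    using assms(4) by (rule homotopicE) blast
  note [simp] = htpy_mapsD[OF h X Y] chain_mapD[OF g X Y] cpx_simps[OF X] cpx_simps[OF Y] cpxD_pred[OF Y]
  have hm: "h (i + 2) (\<ominus>\<^bsub>cmod X (i + 2)\<^esub> x) = \<ominus>\<^bsub>cmod Y (i + 1)\<^esub> h (i + 2) x"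
    if "x \<in> carrier (cmod X (i + 2))" for i x using htpy_mapsD(5)[OF h X Y that] by simp
  have 1: "htpy_maps (shift_cpx X) (shift_cpx Y) (\<lambda>i x. \<ominus>\<^bsub>cmod Y i\<^esub> h (i + 1) x)"
    by (rule htpy_mapsI) simp_all
  show ?thesis
    by (rule homotopicI[OF 1]) (simp add: e hm)
qed

section \<open>Quasi-isomorphisms\<close>

definition cycle :: "'a cpx \<Rightarrow> int \<Rightarrow> 'a mel \<Rightarrow> bool" where
  "cycle X i x \<longleftrightarrow> x \<in> carrier (cmod X i) \<and> cdif X i x = \<zero>\<^bsub>cmod X (i + 1)\<^esub>"

definition boundary :: "'a cpx \<Rightarrow> int \<Rightarrow> 'a mel \<Rightarrow> bool" where
  "boundary X i x \<longleftrightarrow> (\<exists>y\<in>carrier (cmod X (i - 1)). x = cdif X (i - 1) y)"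

text \<open>Injectivity and surjectivity on homology, expressed on cycles without forming quotient modules.
  They are kept apart because the two have different cancellation laws.\<close>

definition hinj :: "'a cpx \<Rightarrow> 'a cpx \<Rightarrow> (int \<Rightarrow> 'a mel \<Rightarrow> 'a mel) \<Rightarrow> bool" where
  "hinj X Y f \<longleftrightarrow> (\<forall>i x. cycle X i x \<longrightarrow> boundary Y i (f i x) \<longrightarrow> boundary X i x)"

definition hsurj :: "'a cpx \<Rightarrow> 'a cpx \<Rightarrow> (int \<Rightarrow> 'a mel \<Rightarrow> 'a mel) \<Rightarrow> bool" where
  "hsurj X Y f \<longleftrightarrow> (\<forall>i y. cycle Y i y \<longrightarrow> (\<exists>x b. cycle X i x \<and> boundary Y i b \<and> y = f i x \<oplus>\<^bsub>cmod Y i\<^esub> b))"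

definition qis :: "'a cpx \<Rightarrow> 'a cpx \<Rightarrow> (int \<Rightarrow> 'a mel \<Rightarrow> 'a mel) \<Rightarrow> bool" where
  "qis X Y f \<longleftrightarrow> chain_map R X Y f \<and> hinj X Y f \<and> hsurj X Y f"

lemma hsurjD:
  "hsurj X Y f \<Longrightarrow> cycle Y i y \<Longrightarrow> \<exists>x b. cycle X i x \<and> boundary Y i b \<and> y = f i x \<oplus>\<^bsub>cmod Y i\<^esub> b"
  by (simp add: hsurj_def)

lemma boundary_in: "bounded_cpx R X \<Longrightarrow> boundary X i x \<Longrightarrow> x \<in> carrier (cmod X i)"
  by (auto simp: boundary_def cpxD(4))

lemma boundary_add:
  assumes X: "bounded_cpx R X" and "boundary X i x" "boundary X i y"
  shows "boundary X i (x \<oplus>\<^bsub>cmod X i\<^esub> y)"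
proof -
  obtain a b where "a \<in> carrier (cmod X (i - 1))" "x = cdif X (i - 1) a" "b \<in> carrier (cmod X (i - 1))"
    "y = cdif X (i - 1) b" using assms by (auto simp: boundary_def)
  then show ?thesis unfolding boundary_def
    by (intro bexI[of _ "a \<oplus>\<^bsub>cmod X (i - 1)\<^esub> b"]) (simp_all add: cpxD_pred[OF X] cpx_simps[OF X])
qed

lemma boundary_minus:
  assumes X: "bounded_cpx R X" and "boundary X i x" shows "boundary X i (\<ominus>\<^bsub>cmod X i\<^esub> x)"
proof -
  obtain a where "a \<in> carrier (cmod X (i - 1))" "x = cdif X (i - 1) a"
    using assms by (auto simp: boundary_def)
  then show ?thesis unfolding boundary_def
    by (intro bexI[of _ "\<ominus>\<^bsub>cmod X (i - 1)\<^esub> a"]) (simp_all add: cpxD_pred[OF X] cpx_simps[OF X])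
qed

lemma boundary_zero:
  assumes X: "bounded_cpx R X" shows "boundary X i \<zero>\<^bsub>cmod X i\<^esub>"
  unfolding boundary_def
  by (intro bexI[of _ "\<zero>\<^bsub>cmod X (i - 1)\<^esub>"]) (simp_all add: cpxD_pred[OF X] cpx_simps[OF X])

lemma boundary_cancel:
  assumes X: "bounded_cpx R X" and "boundary X i b" "boundary X i (x \<oplus>\<^bsub>cmod X i\<^esub> b)" "x \<in> carrier (cmod X i)"
  shows "boundary X i x"
  using boundary_add[OF X assms(3) boundary_minus[OF X assms(2)]] boundary_in[OF X assms(2)] assms(4)
  by (simp add: cpx_ac[OF X] cpx_simps[OF X])

lemma cycle_add:
  assumes X: "bounded_cpx R X" and "cycle X i x" "cycle X i y" shows "cycle X i (x \<oplus>\<^bsub>cmod X i\<^esub> y)"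
  using assms by (simp add: cycle_def cpx_simps[OF X])

lemma cycle_minus:
  assumes X: "bounded_cpx R X" and "cycle X i x" shows "cycle X i (\<ominus>\<^bsub>cmod X i\<^esub> x)"
  using assms by (simp add: cycle_def cpx_simps[OF X])

lemma cycle_map:
  assumes X: "bounded_cpx R X" and Y: "bounded_cpx R Y" and f: "chain_map R X Y f" and "cycle X i x"
  shows "cycle Y i (f i x)"
  using assms(4) by (simp add: cycle_def chain_mapD[OF f X Y])

lemma boundary_map:
  assumes X: "bounded_cpx R X" and Y: "bounded_cpx R Y" and f: "chain_map R X Y f" and "boundary X i x"
  shows "boundary Y i (f i x)"
proof -
  obtain a where a: "a \<in> carrier (cmod X (i - 1))" "x = cdif X (i - 1) a"
    using assms by (auto simp: boundary_def)
  then show ?thesis unfolding boundary_def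
    using chain_mapD(7)[OF f X Y a(1)] chain_mapD(2)[OF f X Y a(1)] by (intro bexI) auto
qed

lemma homotopic_cycle:
  assumes X: "bounded_cpx R X" and Y: "bounded_cpx R Y" and g: "chain_map R X Y g"
    and "homotopic R X Y f g" "cycle X i x"
  shows "\<exists>b. boundary Y i b \<and> f i x = g i x \<oplus>\<^bsub>cmod Y i\<^esub> b"
proof -
  obtain h where h: "htpy_maps X Y h" and e: "\<And>i x. x \<in> carrier (cmod X i) \<Longrightarrow> f i x =
      g i x \<oplus>\<^bsub>cmod Y i\<^esub> (cdif Y (i - 1) (h i x) \<oplus>\<^bsub>cmod Y i\<^esub> h (i + 1) (cdif X i x))"
    using assms(4) by (rule homotopicE) blast
  have x: "x \<in> carrier (cmod X i)" "cdif X i x = \<zero>\<^bsub>cmod X (i + 1)\<^esub>" using assms(5) by (auto simp: cycle_def)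
  have "f i x = g i x \<oplus>\<^bsub>cmod Y i\<^esub> cdif Y (i - 1) (h i x)"
    using e[OF x(1)] x htpy_mapsD(4)[OF h X Y, of "i + 1"] htpy_mapsD(1)[OF h X Y x(1)]
    by (simp add: cpx_simps[OF Y])
  then show ?thesis using htpy_mapsD(1)[OF h X Y x(1)] unfolding boundary_def by blast
qed

lemma hinj_homotopic:
  assumes X: "bounded_cpx R X" and Y: "bounded_cpx R Y" and f: "chain_map R X Y f" and g: "chain_map R X Y g"
    and h: "homotopic R X Y f g" and "hinj X Y f"
  shows "hinj X Y g"
  unfolding hinj_def
proof (intro allI impI)
  fix i x assume x: "cycle X i x" "boundary Y i (g i x)"
  obtain b where "boundary Y i b" "f i x = g i x \<oplus>\<^bsub>cmod Y i\<^esub> b"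
    using homotopic_cycle[OF X Y g h x(1)] by blast
  then have "boundary Y i (f i x)" using boundary_add[OF Y x(2)] by simp
  then show "boundary X i x" using assms(6) x by (auto simp: hinj_def)
qed

lemma hsurj_homotopic:
  assumes X: "bounded_cpx R X" and Y: "bounded_cpx R Y" and f: "chain_map R X Y f" and g: "chain_map R X Y g"
    and h: "homotopic R X Y f g" and "hsurj X Y f"
  shows "hsurj X Y g"
  unfolding hsurj_def
proof (intro allI impI)
  fix i y assume y: "cycle Y i y"
  obtain x c where x: "cycle X i x" "boundary Y i c" "y = f i x \<oplus>\<^bsub>cmod Y i\<^esub> c"
    using hsurjD[OF assms(6) y] by blast
  obtain b where b: "boundary Y i b" "f i x = g i x \<oplus>\<^bsub>cmod Y i\<^esub> b"
    using homotopic_cycle[OF X Y g h x(1)] by blast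
  have "g i x \<in> carrier (cmod Y i)" using x(1) by (simp add: cycle_def chain_mapD[OF g X Y])
  then have "y = g i x \<oplus>\<^bsub>cmod Y i\<^esub> (b \<oplus>\<^bsub>cmod Y i\<^esub> c)"
    using x b boundary_in[OF Y] by (simp add: module_ac[OF cpxD(1)[OF Y]])
  then show "\<exists>x b. cycle X i x \<and> boundary Y i b \<and> y = g i x \<oplus>\<^bsub>cmod Y i\<^esub> b"
    using x(1) boundary_add[OF Y b(1) x(2)] by blast
qed

lemma qis_homotopic:
  assumes X: "bounded_cpx R X" and Y: "bounded_cpx R Y" and g: "chain_map R X Y g"
    and h: "homotopic R X Y f g" and "qis X Y f"
  shows "qis X Y g"
  using assms hinj_homotopic[OF X Y _ g h] hsurj_homotopic[OF X Y _ g h] by (auto simp: qis_def)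

lemma hinj_comp:
  assumes X: "bounded_cpx R X" and Y: "bounded_cpx R Y" and f: "chain_map R X Y f"
    and "hinj X Y f" "hinj Y Z g"
  shows "hinj X Z (\<lambda>i x. g i (f i x))"
  using assms cycle_map[OF X Y f] unfolding hinj_def by blast

lemma hsurj_comp:
  assumes X: "bounded_cpx R X" and Y: "bounded_cpx R Y" and Z: "bounded_cpx R Z"
    and f: "chain_map R X Y f" and g: "chain_map R Y Z g"
    and "hsurj X Y f" "hsurj Y Z g"
  shows "hsurj X Z (\<lambda>i x. g i (f i x))"
  unfolding hsurj_def
proof (intro allI impI)
  fix i z assume "cycle Z i z"
  then obtain y b where y: "cycle Y i y" "boundary Z i b" "z = g i y \<oplus>\<^bsub>cmod Z i\<^esub> b"
    using hsurjD[OF assms(7)] by blast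
  obtain x c where x: "cycle X i x" "boundary Y i c" "y = f i x \<oplus>\<^bsub>cmod Y i\<^esub> c"
    using hsurjD[OF assms(6) y(1)] by blast
  have "g i c \<in> carrier (cmod Z i)" "b \<in> carrier (cmod Z i)" "c \<in> carrier (cmod Y i)" "f i x \<in> carrier (cmod Y i)"
    using x y boundary_in[OF Y] boundary_in[OF Z] by (auto simp: chain_mapD[OF g Y Z] cycle_def chain_mapD[OF f X Y])
  then have "z = g i (f i x) \<oplus>\<^bsub>cmod Z i\<^esub> (g i c \<oplus>\<^bsub>cmod Z i\<^esub> b)"
    using y x by (simp add: module_ac[OF cpxD(1)[OF Z]] chain_mapD[OF g Y Z])
  moreover have "boundary Z i (g i c \<oplus>\<^bsub>cmod Z i\<^esub> b)"
    using boundary_add[OF Z boundary_map[OF Y Z g x(2)] y(2)] .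
  ultimately show "\<exists>x b. cycle X i x \<and> boundary Z i b \<and> z = g i (f i x) \<oplus>\<^bsub>cmod Z i\<^esub> b"
    using x(1) by blast
qed

lemma hinj_cancel:
  assumes X: "bounded_cpx R X" and Y: "bounded_cpx R Y" and Z: "bounded_cpx R Z" and g: "chain_map R Y Z g"
    and "hinj X Z (\<lambda>i x. g i (f i x))"
  shows "hinj X Y f"
  using assms boundary_map[OF Y Z g] unfolding hinj_def by blast

lemma hsurj_cancel:
  assumes X: "bounded_cpx R X" and Y: "bounded_cpx R Y" and f: "chain_map R X Y f"
    and "hsurj X Z (\<lambda>i x. g i (f i x))"
  shows "hsurj Y Z g"
  using assms cycle_map[OF X Y f] unfolding hsurj_def by meson

lemma hinj_cancel_hsurj:
  assumes X: "bounded_cpx R X" and Y: "bounded_cpx R Y" and Z: "bounded_cpx R Z"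
    and f: "chain_map R X Y f" and g: "chain_map R Y Z g"
    and "hinj X Z (\<lambda>i x. g i (f i x))" "hsurj X Y f"
  shows "hinj Y Z g"
  unfolding hinj_def
proof (intro allI impI)
  fix i y assume y: "cycle Y i y" "boundary Z i (g i y)"
  then obtain x b where x: "cycle X i x" "boundary Y i b" "y = f i x \<oplus>\<^bsub>cmod Y i\<^esub> b"
    using hsurjD[OF assms(7)] by blast
  have in': "b \<in> carrier (cmod Y i)" "f i x \<in> carrier (cmod Y i)" "g i (f i x) \<in> carrier (cmod Z i)"
    using x boundary_in[OF Y] by (auto simp: cycle_def chain_mapD[OF f X Y] chain_mapD[OF g Y Z])
  have "boundary Z i (g i (f i x))"
    by (rule boundary_cancel[OF Z boundary_map[OF Y Z g x(2)]])
      (use y(2) x(3) in' in \<open>simp_all add: chain_mapD[OF g Y Z]\<close>)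
  then have "boundary X i x" using assms(6) x(1) by (auto simp: hinj_def)
  then show "boundary Y i y" using boundary_add[OF Y boundary_map[OF X Y f]] x by simp
qed

lemma hsurj_cancel_hinj:
  assumes X: "bounded_cpx R X" and Y: "bounded_cpx R Y" and Z: "bounded_cpx R Z"
    and f: "chain_map R X Y f" and g: "chain_map R Y Z g"
    and "hsurj X Z (\<lambda>i x. g i (f i x))" "hinj Y Z g"
  shows "hsurj X Y f"
  unfolding hsurj_def
proof (intro allI impI)
  fix i y assume y: "cycle Y i y"
  obtain x b where x: "cycle X i x" "boundary Z i b" "g i y = g i (f i x) \<oplus>\<^bsub>cmod Z i\<^esub> b"
    using assms(6) cycle_map[OF Y Z g y] unfolding hsurj_def by meson
  have in': "y \<in> carrier (cmod Y i)" "f i x \<in> carrier (cmod Y i)" "b \<in> carrier (cmod Z i)"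
    using x y boundary_in[OF Z] by (auto simp: cycle_def chain_mapD[OF f X Y])
  let ?c = "\<ominus>\<^bsub>cmod Y i\<^esub> f i x \<oplus>\<^bsub>cmod Y i\<^esub> y"
  have "g i ?c = b"
    using in' x(3) by (simp add: chain_mapD[OF g Y Z] cpx_simps[OF Y] cpx_ac[OF Z])
  moreover have "cycle Y i ?c"
    using cycle_add[OF Y cycle_minus[OF Y cycle_map[OF X Y f x(1)]] y] .
  ultimately have "boundary Y i ?c" using assms(7) x(2) by (auto simp: hinj_def)
  moreover have "y = f i x \<oplus>\<^bsub>cmod Y i\<^esub> ?c" using in' by (simp add: cpx_ac[OF Y] cpx_simps[OF Y])
  ultimately show "\<exists>x b. cycle X i x \<and> boundary Y i b \<and> y = f i x \<oplus>\<^bsub>cmod Y i\<^esub> b"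
    using x(1) by blast
qed

lemma qis_comp:
  assumes "bounded_cpx R X" "bounded_cpx R Y" "bounded_cpx R Z" "qis X Y f" "qis Y Z g"
  shows "qis X Z (\<lambda>i x. g i (f i x))"
  using assms hinj_comp[of X Y f Z g] hsurj_comp[of X Y Z f g] chain_map_comp[of X Y f Z g]
  by (auto simp: qis_def)

lemma qis_id: assumes X: "bounded_cpx R X" shows "qis X X (\<lambda>i x. x)"
  unfolding qis_def hinj_def hsurj_def
proof (intro conjI chain_map_id allI impI)
  fix i y assume "cycle X i y"
  then show "\<exists>x b. cycle X i x \<and> boundary X i b \<and> y = x \<oplus>\<^bsub>cmod X i\<^esub> b"
    using boundary_zero[OF X] by (intro exI[of _ y] exI[of _ "\<zero>\<^bsub>cmod X i\<^esub>"])
      (auto simp: cycle_def cpx_simps[OF X])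
qed

lemma acyclic_iff: "acyclic_cpx R X \<longleftrightarrow> (\<forall>i x. cycle X i x \<longrightarrow> boundary X i x)"
  by (auto simp: acyclic_cpx_def cycle_def boundary_def Bex_def eq_commute)

lemma qis_acyclic:
  assumes X: "bounded_cpx R X" and Y: "bounded_cpx R Y" and f: "qis X Y f"
  shows "acyclic_cpx R X \<longleftrightarrow> acyclic_cpx R Y"
proof
  have c: "chain_map R X Y f" using f by (simp add: qis_def)
  show "acyclic_cpx R X \<Longrightarrow> acyclic_cpx R Y"
    unfolding acyclic_iff
  proof (intro allI impI)
    fix i y assume *: "\<forall>i x. cycle X i x \<longrightarrow> boundary X i x" "cycle Y i y"
    then obtain x b where "cycle X i x" "boundary Y i b" "y = f i x \<oplus>\<^bsub>cmod Y i\<^esub> b"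
      using f hsurjD unfolding qis_def by blast
    then show "boundary Y i y" using * boundary_add[OF Y boundary_map[OF X Y c]] by simp
  qed
  show "acyclic_cpx R Y \<Longrightarrow> acyclic_cpx R X"
    unfolding acyclic_iff using f cycle_map[OF X Y c] by (auto simp: qis_def hinj_def)
qed

lemma qis_of_acyclic:
  assumes X: "bounded_cpx R X" and Y: "bounded_cpx R Y" and f: "chain_map R X Y f"
    and "acyclic_cpx R X" "acyclic_cpx R Y"
  shows "qis X Y f"
  unfolding qis_def hinj_def hsurj_def
proof (intro conjI f allI impI)
  show "cycle X i x \<Longrightarrow> boundary X i x" for i x using assms(4) by (auto simp: acyclic_iff)
  fix i y assume y: "cycle Y i y"
  have "cycle X i \<zero>\<^bsub>cmod X i\<^esub>" by (simp add: cycle_def cpx_simps[OF X])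
  then show "\<exists>x b. cycle X i x \<and> boundary Y i b \<and> y = f i x \<oplus>\<^bsub>cmod Y i\<^esub> b"
    using assms(5) y by (intro exI[of _ "\<zero>\<^bsub>cmod X i\<^esub>"] exI[of _ y])
      (auto simp: acyclic_iff cycle_def chain_mapD[OF f X Y] cpx_simps[OF Y])
qed

lemma qis_of_bijective:
  assumes X: "bounded_cpx R X" and Y: "bounded_cpx R Y" and f: "chain_map R X Y f"
    and g: "\<And>i y. y \<in> carrier (cmod Y i) \<Longrightarrow> \<exists>x\<in>carrier (cmod X i). f i x = y"
    and i: "\<And>i x. x \<in> carrier (cmod X i) \<Longrightarrow> f i x = \<zero>\<^bsub>cmod Y i\<^esub> \<Longrightarrow> x = \<zero>\<^bsub>cmod X i\<^esub>"
  shows "qis X Y f"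
proof -
  note [simp] = chain_mapD[OF f X Y] cpx_simps[OF X] cpx_simps[OF Y]
  have inj: "x = y" if "x \<in> carrier (cmod X i)" "y \<in> carrier (cmod X i)" "f i x = f i y" for i x y
  proof -
    have "x \<oplus>\<^bsub>cmod X i\<^esub> \<ominus>\<^bsub>cmod X i\<^esub> y = \<zero>\<^bsub>cmod X i\<^esub>" by (rule i) (use that in simp_all)
    then have "(x \<oplus>\<^bsub>cmod X i\<^esub> \<ominus>\<^bsub>cmod X i\<^esub> y) \<oplus>\<^bsub>cmod X i\<^esub> y = y" using that by simp
    then show ?thesis using that by (simp add: module_ac[OF cpxD(1)[OF X]] module_simps[OF cpxD(1)[OF X]])
  qed
  show ?thesis unfolding qis_def hinj_def hsurj_def
  proof (intro conjI f allI impI)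
    fix i x assume x: "cycle X i x" "boundary Y i (f i x)"
    then obtain y where y: "y \<in> carrier (cmod Y (i - 1))" "f i x = cdif Y (i - 1) y" by (auto simp: boundary_def)
    obtain z where z: "z \<in> carrier (cmod X (i - 1))" "f (i - 1) z = y" using g[OF y(1)] by blast
    have "f i x = f i (cdif X (i - 1) z)" using chain_mapD(7)[OF f X Y z(1)] y z by simp
    then have "x = cdif X (i - 1) z" using inj[of x i "cdif X (i - 1) z"] x(1) z(1) by (simp add: cycle_def)
    then show "boundary X i x" using z by (auto simp: boundary_def)
  next
    fix i y assume y: "cycle Y i y"
    then obtain x where x: "x \<in> carrier (cmod X i)" "f i x = y" using g by (auto simp: cycle_def)
    have "f (i + 1) (cdif X i x) = \<zero>\<^bsub>cmod Y (i + 1)\<^esub>" using x y chain_mapD(7)[OF f X Y x(1)] by (simp add: cycle_def)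
    then have "cdif X i x = \<zero>\<^bsub>cmod X (i + 1)\<^esub>" using x i by simp
    then show "\<exists>x b. cycle X i x \<and> boundary Y i b \<and> y = f i x \<oplus>\<^bsub>cmod Y i\<^esub> b"
      using x y boundary_zero[OF Y, of i]
      by (intro exI[of _ x] exI[of _ "\<zero>\<^bsub>cmod Y i\<^esub>"]) (auto simp: cycle_def)
  qed
qed

lemma int_index' [simp]: "i + 2 + 1 = i + (3::int)" "i + 1 + 2 = i + (3::int)" "i - 1 + 3 = i + (2::int)"
  by simp_all

section \<open>Cones\<close>

lemma cone_incl:
  assumes X: "bounded_cpx R X" and Y: "bounded_cpx R Y" and f: "chain_map R X Y f"
  shows "chain_map R Y (cone_cpx X Y f) (\<lambda>i y. Pair \<zero>\<^bsub>cmod X (i + 1)\<^esub> y)"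
  by (rule chain_mapI) (simp_all add: cpx_simps[OF X] cpx_simps[OF Y] chain_mapD[OF f X Y])

lemma cone_proj:
  assumes X: "bounded_cpx R X" and Y: "bounded_cpx R Y" and f: "chain_map R X Y f"
  shows "chain_map R (cone_cpx X Y f) (shift_cpx X) (\<lambda>i. pfst)"
  by (rule chain_mapI) (auto elim!: mod_dsum_cases)

lemma cycle_cone:
  assumes X: "bounded_cpx R X" and Y: "bounded_cpx R Y" and f: "chain_map R X Y f"
  shows "cycle (cone_cpx X Y f) i (Pair x y) \<longleftrightarrow> cycle X (i + 1) x \<and> y \<in> carrier (cmod Y i) \<and>
    f (i + 1) x = \<ominus>\<^bsub>cmod Y (i + 1)\<^esub> cdif Y i y"
proof -
  note [simp] = cpx_simps[OF X] cpx_simps[OF Y] chain_mapD[OF f X Y]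
  have "f (i + 1) x \<oplus>\<^bsub>cmod Y (i + 1)\<^esub> cdif Y i y = \<zero>\<^bsub>cmod Y (i + 1)\<^esub> \<longleftrightarrow>
    f (i + 1) x = \<ominus>\<^bsub>cmod Y (i + 1)\<^esub> cdif Y i y" (is "?L \<longleftrightarrow> ?R")
    if x: "x \<in> carrier (cmod X (i + 1))" and y: "y \<in> carrier (cmod Y i)"
  proof
    interpret M: module R "cmod Y (i + 1)" using cpxD(1)[OF Y] .
    show "?L \<Longrightarrow> ?R" using M.minus_equality[of "f (i + 1) x" "cdif Y i y"] x y by simp
    show "?R \<Longrightarrow> ?L" using x y by simp
  qed
  then show ?thesis by (auto simp: cycle_def)
qed

lemma boundary_cone:
  assumes X: "bounded_cpx R X" and Y: "bounded_cpx R Y" and f: "chain_map R X Y f"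
  shows "boundary (cone_cpx X Y f) i (Pair x y) \<longleftrightarrow> (\<exists>a\<in>carrier (cmod X i). \<exists>b\<in>carrier (cmod Y (i - 1)).
    x = \<ominus>\<^bsub>cmod X (i + 1)\<^esub> cdif X i a \<and> y = f i a \<oplus>\<^bsub>cmod Y i\<^esub> cdif Y (i - 1) b)"
  by (simp add: boundary_def)

text \<open>The long exact homology sequence of the cone, on elements: a cycle \<open>(x, y)\<close> of the cone says that
  \<open>f x\<close> is the boundary of \<open>- y\<close>.\<close>

lemma cone_acyclic_iff:
  assumes X: "bounded_cpx R X" and Y: "bounded_cpx R Y" and f: "chain_map R X Y f"
  shows "acyclic_cpx R (cone_cpx X Y f) \<longleftrightarrow> qis X Y f"
proof
  note [simp] = cpx_simps[OF X] cpx_simps[OF Y] chain_mapD[OF f X Y]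
  assume A: "acyclic_cpx R (cone_cpx X Y f)"
  show "qis X Y f" unfolding qis_def hinj_def hsurj_def
  proof (intro conjI f allI impI)
    fix i x assume x: "cycle X i x" "boundary Y i (f i x)"
    then obtain y where y: "y \<in> carrier (cmod Y (i - 1))" "f i x = cdif Y (i - 1) y" by (auto simp: boundary_def)
    have "cycle (cone_cpx X Y f) (i - 1) (Pair x (\<ominus>\<^bsub>cmod Y (i - 1)\<^esub> y))"
      using x y by (simp add: cycle_cone[OF X Y f] cpxD_pred[OF Y])
    then have "boundary (cone_cpx X Y f) (i - 1) (Pair x (\<ominus>\<^bsub>cmod Y (i - 1)\<^esub> y))"
      using A by (simp add: acyclic_iff)
    then obtain a where "a \<in> carrier (cmod X (i - 1))" "x = \<ominus>\<^bsub>cmod X i\<^esub> cdif X (i - 1) a"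
      by (auto simp: boundary_cone[OF X Y f])
    then show "boundary X i x" unfolding boundary_def
      by (intro bexI[of _ "\<ominus>\<^bsub>cmod X (i - 1)\<^esub> a"]) (simp_all add: cpxD_pred[OF X])
  next
    fix i y assume y: "cycle Y i y"
    have "cycle (cone_cpx X Y f) i (Pair \<zero>\<^bsub>cmod X (i + 1)\<^esub> y)"
      using y by (simp add: cycle_cone[OF X Y f]) (simp add: cycle_def)
    then have "boundary (cone_cpx X Y f) i (Pair \<zero>\<^bsub>cmod X (i + 1)\<^esub> y)"
      using A by (simp add: acyclic_iff)
    then obtain a b where a: "a \<in> carrier (cmod X i)" "\<zero>\<^bsub>cmod X (i + 1)\<^esub> = \<ominus>\<^bsub>cmod X (i + 1)\<^esub> cdif X i a"
      and b: "b \<in> carrier (cmod Y (i - 1))" "y = f i a \<oplus>\<^bsub>cmod Y i\<^esub> cdif Y (i - 1) b"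
      by (auto simp: boundary_cone[OF X Y f])
    then have "cycle X i a" by (simp add: cycle_def)
    then show "\<exists>x b. cycle X i x \<and> boundary Y i b \<and> y = f i x \<oplus>\<^bsub>cmod Y i\<^esub> b"
      using b by (auto simp: boundary_def)
  qed
next
  note [simp] = cpx_simps[OF X] cpx_simps[OF Y] chain_mapD[OF f X Y]
  assume q: "qis X Y f"
  show "acyclic_cpx R (cone_cpx X Y f)" unfolding acyclic_iff
  proof (intro allI impI)
    fix i p assume p: "cycle (cone_cpx X Y f) i p"
    then obtain x y where xy: "p = Pair x y" by (auto simp: cycle_def elim: mod_dsum_cases)
    have c: "cycle X (i + 1) x" "y \<in> carrier (cmod Y i)" "f (i + 1) x = \<ominus>\<^bsub>cmod Y (i + 1)\<^esub> cdif Y i y"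
      using p by (auto simp: xy cycle_cone[OF X Y f])
    then have "boundary Y (i + 1) (f (i + 1) x)"
      unfolding boundary_def by (intro bexI[of _ "\<ominus>\<^bsub>cmod Y i\<^esub> y"]) simp_all
    then have "boundary X (i + 1) x" using q c by (auto simp: qis_def hinj_def)
    then obtain a where a: "a \<in> carrier (cmod X i)" "x = cdif X i a" by (auto simp: boundary_def)
    have "cycle Y i (f i a \<oplus>\<^bsub>cmod Y i\<^esub> y)" using a c by (simp add: cycle_def)
    then obtain c' b where cb: "cycle X i c'" "boundary Y i b" "f i a \<oplus>\<^bsub>cmod Y i\<^esub> y = f i c' \<oplus>\<^bsub>cmod Y i\<^esub> b"
      using q hsurjD unfolding qis_def by blast
    then obtain d where d: "d \<in> carrier (cmod Y (i - 1))" "b = cdif Y (i - 1) d" by (auto simp: boundary_def)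
    have c': "c' \<in> carrier (cmod X i)" "cdif X i c' = \<zero>\<^bsub>cmod X (i + 1)\<^esub>" using cb by (auto simp: cycle_def)
    have "y = \<ominus>\<^bsub>cmod Y i\<^esub> f i a \<oplus>\<^bsub>cmod Y i\<^esub> (f i a \<oplus>\<^bsub>cmod Y i\<^esub> y)"
      using a c by (simp add: cpx_ac[OF Y])
    then have y: "y = f i (\<ominus>\<^bsub>cmod X i\<^esub> a \<oplus>\<^bsub>cmod X i\<^esub> c') \<oplus>\<^bsub>cmod Y i\<^esub> cdif Y (i - 1) d"
      using a c' d cb(3) by (simp add: cpx_ac[OF Y])
    show "boundary (cone_cpx X Y f) i p" unfolding xy boundary_cone[OF X Y f]
      by (rule bexI[of _ "\<ominus>\<^bsub>cmod X i\<^esub> a \<oplus>\<^bsub>cmod X i\<^esub> c'"], rule bexI[of _ d])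
        (use y a c' d in simp_all)
  qed
qed

text \<open>The first component of a cycle of the cone is the boundary of some \<open>a\<close>, and subtracting a
  boundary of the cone moves the cycle to \<open>(0, f a + y)\<close>.\<close>

lemma cone_incl_qis:
  assumes X: "bounded_cpx R X" and Y: "bounded_cpx R Y" and f: "chain_map R X Y f" and A: "acyclic_cpx R X"
  shows "qis Y (cone_cpx X Y f) (\<lambda>i y. Pair \<zero>\<^bsub>cmod X (i + 1)\<^esub> y)"
  unfolding qis_def hinj_def hsurj_def
proof (intro conjI cone_incl[OF X Y f] allI impI)
  note [simp] = cpx_simps[OF X] cpx_simps[OF Y] chain_mapD[OF f X Y]
  fix i y assume y: "cycle Y i y" "boundary (cone_cpx X Y f) i (Pair \<zero>\<^bsub>cmod X (i + 1)\<^esub> y)"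
  then obtain a b where a: "a \<in> carrier (cmod X i)" "\<zero>\<^bsub>cmod X (i + 1)\<^esub> = \<ominus>\<^bsub>cmod X (i + 1)\<^esub> cdif X i a"
      and b: "b \<in> carrier (cmod Y (i - 1))" "y = f i a \<oplus>\<^bsub>cmod Y i\<^esub> cdif Y (i - 1) b"
    by (auto simp: boundary_cone[OF X Y f])
  then have "cycle X i a" by (simp add: cycle_def)
  then have "boundary Y i (f i a)" using A boundary_map[OF X Y f] by (auto simp: acyclic_iff)
  moreover have "boundary Y i (cdif Y (i - 1) b)" using b(1) by (auto simp: boundary_def)
  ultimately show "boundary Y i y" unfolding b(2) by (rule boundary_add[OF Y])
next
  note [simp] = cpx_simps[OF X] cpx_simps[OF Y] chain_mapD[OF f X Y]
  fix i p assume p: "cycle (cone_cpx X Y f) i p"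
  then obtain x y where xy: "p = Pair x y" by (auto simp: cycle_def elim: mod_dsum_cases)
  have c: "cycle X (i + 1) x" "y \<in> carrier (cmod Y i)" "f (i + 1) x = \<ominus>\<^bsub>cmod Y (i + 1)\<^esub> cdif Y i y"
    using p by (auto simp: xy cycle_cone[OF X Y f])
  then have "boundary X (i + 1) x" using A by (auto simp: acyclic_iff)
  then obtain a where a: "a \<in> carrier (cmod X i)" "x = cdif X i a" by (auto simp: boundary_def)
  have 1: "cycle Y i (f i a \<oplus>\<^bsub>cmod Y i\<^esub> y)" using a c by (simp add: cycle_def)
  have 2: "boundary (cone_cpx X Y f) i (Pair x (\<ominus>\<^bsub>cmod Y i\<^esub> f i a))"
    unfolding boundary_cone[OF X Y f]
    by (rule bexI[of _ "\<ominus>\<^bsub>cmod X i\<^esub> a"], rule bexI[of _ "\<zero>\<^bsub>cmod Y (i - 1)\<^esub>"])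
      (use a in \<open>simp_all add: cpxD_pred[OF Y]\<close>)
  have "p = Pair \<zero>\<^bsub>cmod X (i + 1)\<^esub> (f i a \<oplus>\<^bsub>cmod Y i\<^esub> y) \<oplus>\<^bsub>cmod (cone_cpx X Y f) i\<^esub> Pair x (\<ominus>\<^bsub>cmod Y i\<^esub> f i a)"
    using a c(2) by (simp add: xy cpx_ac[OF Y])
  with 1 2 show "\<exists>y b. cycle Y i y \<and> boundary (cone_cpx X Y f) i b \<and>
      p = Pair \<zero>\<^bsub>cmod X (i + 1)\<^esub> y \<oplus>\<^bsub>cmod (cone_cpx X Y f) i\<^esub> b" by blast
qed

definition cone_map :: "(int \<Rightarrow> 'a mel \<Rightarrow> 'a mel) \<Rightarrow> (int \<Rightarrow> 'a mel \<Rightarrow> 'a mel) \<Rightarrow> int \<Rightarrow> 'a mel \<Rightarrow> 'a mel" where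
  "cone_map a b = (\<lambda>i p. Pair (a (i + 1) (pfst p)) (b i (psnd p)))"

lemma cone_map_Pair [simp]: "cone_map a b i (Pair x y) = Pair (a (i + 1) x) (b i y)"
  by (simp add: cone_map_def)

lemma cone_map_chain:
  assumes X: "bounded_cpx R X" and Y: "bounded_cpx R Y" and X': "bounded_cpx R X'" and Y': "bounded_cpx R Y'"
    and f: "chain_map R X Y f" and f': "chain_map R X' Y' f'"
    and a: "chain_map R X X' a" and b: "chain_map R Y Y' b"
    and sq: "\<And>i x. x \<in> carrier (cmod X i) \<Longrightarrow> b i (f i x) = f' i (a i x)"
  shows "chain_map R (cone_cpx X Y f) (cone_cpx X' Y' f') (cone_map a b)"
proof -
  note [simp] = cpx_simps[OF X] cpx_simps[OF Y] cpx_simps[OF X'] cpx_simps[OF Y'] chain_mapD[OF f X Y]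
    chain_mapD[OF f' X' Y'] chain_mapD[OF a X X'] chain_mapD[OF b Y Y'] sq
  show ?thesis by (rule chain_mapI) (auto elim!: mod_dsum_cases)
qed

text \<open>Iterated cones of a commutative square do not depend on the order in which they are taken: the
  map \<open>((x, y), (x', y')) \<mapsto> ((- x, x'), (y, y'))\<close> is an isomorphism of complexes, where the sign is
  caused by shifting \<open>x\<close> twice. This replaces the octahedral axiom and the five lemma below.\<close>

lemma cone_cone_qis:
  assumes X: "bounded_cpx R X" and Y: "bounded_cpx R Y" and X': "bounded_cpx R X'" and Y': "bounded_cpx R Y'"
    and f: "chain_map R X Y f" and f': "chain_map R X' Y' f'"
    and a: "chain_map R X X' a" and b: "chain_map R Y Y' b"
    and sq: "\<And>i x. x \<in> carrier (cmod X i) \<Longrightarrow> b i (f i x) = f' i (a i x)"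
  shows "\<exists>\<theta>. qis (cone_cpx (cone_cpx X Y f) (cone_cpx X' Y' f') (cone_map a b))
    (cone_cpx (cone_cpx X X' a) (cone_cpx Y Y' b) (cone_map f f')) \<theta>"
proof -
  note [simp] = cpx_simps[OF X] cpx_simps[OF Y] cpx_simps[OF X'] cpx_simps[OF Y'] chain_mapD[OF f X Y]
    chain_mapD[OF f' X' Y'] chain_mapD[OF a X X'] chain_mapD[OF b Y Y'] sq
  note ac = module_ac[OF cpxD(1)[OF Y']]
  let ?V = "cone_cpx (cone_cpx X Y f) (cone_cpx X' Y' f') (cone_map a b)"
  let ?U = "cone_cpx (cone_cpx X X' a) (cone_cpx Y Y' b) (cone_map f f')"
  have V: "bounded_cpx R ?V" and U: "bounded_cpx R ?U"
    by (intro cone_bounded cone_map_chain assms; simp)+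
  define \<theta> where "\<theta> = (\<lambda>i p. Pair (Pair (\<ominus>\<^bsub>cmod X (i + 2)\<^esub> pfst (pfst p)) (pfst (psnd p)))
    (Pair (psnd (pfst p)) (psnd (psnd p))))"
  have \<theta> [simp]: "\<theta> i (Pair (Pair x y) (Pair x' y')) = Pair (Pair (\<ominus>\<^bsub>cmod X (i + 2)\<^esub> x) x') (Pair y y')"
    for i x y x' y' by (simp add: \<theta>_def)
  have c: "chain_map R ?V ?U \<theta>"
    by (rule chain_mapI) (auto elim!: mod_dsum_cases simp: ac)
  have "qis ?V ?U \<theta>"
  proof (rule qis_of_bijective[OF V U c])
    fix i p assume "p \<in> carrier (cmod ?U i)"
    then obtain x x' y y' where "p = Pair (Pair x x') (Pair y y')" "x \<in> carrier (cmod X (i + 2))"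
      "x' \<in> carrier (cmod X' (i + 1))" "y \<in> carrier (cmod Y (i + 1))" "y' \<in> carrier (cmod Y' i)"
      by (auto elim!: mod_dsum_cases)
    then show "\<exists>q\<in>carrier (cmod ?V i). \<theta> i q = p"
      by (intro bexI[of _ "Pair (Pair (\<ominus>\<^bsub>cmod X (i + 2)\<^esub> x) y) (Pair x' y')"]) simp_all
  next
    fix i p assume "p \<in> carrier (cmod ?V i)" "\<theta> i p = \<zero>\<^bsub>cmod ?U i\<^esub>"
    then show "p = \<zero>\<^bsub>cmod ?V i\<^esub>"
      by (auto elim!: mod_dsum_cases)
  qed
  then show ?thesis by blast
qed

text \<open>The five lemma: the cone of the induced map is an iterated cone of two acyclic complexes.\<close>

lemma cone_map_qis:
  assumes X: "bounded_cpx R X" and Y: "bounded_cpx R Y" and X': "bounded_cpx R X'" and Y': "bounded_cpx R Y'"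
    and f: "chain_map R X Y f" and f': "chain_map R X' Y' f'"
    and a: "qis X X' a" and b: "qis Y Y' b"
    and sq: "\<And>i x. x \<in> carrier (cmod X i) \<Longrightarrow> b i (f i x) = f' i (a i x)"
  shows "qis (cone_cpx X Y f) (cone_cpx X' Y' f') (cone_map a b)"
proof -
  have ac: "chain_map R X X' a" "chain_map R Y Y' b" using a b by (auto simp: qis_def)
  have v: "chain_map R (cone_cpx X Y f) (cone_cpx X' Y' f') (cone_map a b)"
    by (rule cone_map_chain) (use assms ac in auto)
  have w: "chain_map R (cone_cpx X X' a) (cone_cpx Y Y' b) (cone_map f f')"
    by (rule cone_map_chain) (use assms ac in auto)
  note bd = cone_bounded[OF X Y f] cone_bounded[OF X' Y' f'] cone_bounded[OF X X' ac(1)] cone_bounded[OF Y Y' ac(2)]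
  have "acyclic_cpx R (cone_cpx X X' a)" "acyclic_cpx R (cone_cpx Y Y' b)"
    using a b cone_acyclic_iff[OF X X' ac(1)] cone_acyclic_iff[OF Y Y' ac(2)] by auto
  then have "qis (cone_cpx X X' a) (cone_cpx Y Y' b) (cone_map f f')"
    using qis_of_acyclic bd w by blast
  then have "acyclic_cpx R (cone_cpx (cone_cpx X X' a) (cone_cpx Y Y' b) (cone_map f f'))"
    using cone_acyclic_iff bd w by blast
  moreover obtain \<theta> where "qis (cone_cpx (cone_cpx X Y f) (cone_cpx X' Y' f') (cone_map a b))
    (cone_cpx (cone_cpx X X' a) (cone_cpx Y Y' b) (cone_map f f')) \<theta>"
    using cone_cone_qis[OF X Y X' Y' f f' ac sq] by blast
  ultimately have "acyclic_cpx R (cone_cpx (cone_cpx X Y f) (cone_cpx X' Y' f') (cone_map a b))"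
    using qis_acyclic[OF cone_bounded[OF bd(1,2) v] cone_bounded[OF bd(3,4) w]] by blast
  then show ?thesis using cone_acyclic_iff[OF bd(1,2) v] by blast
qed

text \<open>If \<open>f = g + d h + h d\<close>, then \<open>(x, y) \<mapsto> (x, y + h x)\<close> is an isomorphism of the two cones.\<close>

lemma cone_homotopic_qis:
  assumes X: "bounded_cpx R X" and Y: "bounded_cpx R Y" and f: "chain_map R X Y f" and g: "chain_map R X Y g"
    and "homotopic R X Y f g"
  shows "\<exists>\<theta>. qis (cone_cpx X Y f) (cone_cpx X Y g) \<theta>"
proof -
  obtain h where h: "htpy_maps X Y h" and e: "\<And>i x. x \<in> carrier (cmod X i) \<Longrightarrow> f i x =
      g i x \<oplus>\<^bsub>cmod Y i\<^esub> (cdif Y (i - 1) (h i x) \<oplus>\<^bsub>cmod Y i\<^esub> h (i + 1) (cdif X i x))"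
    using assms(5) by (rule homotopicE) blast
  note [simp] = cpx_simps[OF X] cpx_simps[OF Y] chain_mapD[OF f X Y] chain_mapD[OF g X Y] htpy_mapsD[OF h X Y]
    htpy_mapsD[OF h X Y, where i = "_ + 1", simplified] htpy_mapsD[OF h X Y, where i = "_ + 2", simplified]
  define \<theta> where "\<theta> = (\<lambda>i p. Pair (pfst p) (psnd p \<oplus>\<^bsub>cmod Y i\<^esub> h (i + 1) (pfst p)))"
  have \<theta> [simp]: "\<theta> i (Pair x y) = Pair x (y \<oplus>\<^bsub>cmod Y i\<^esub> h (i + 1) x)" for i x y by (simp add: \<theta>_def)
  have c: "chain_map R (cone_cpx X Y f) (cone_cpx X Y g) \<theta>"
  proof (rule chain_mapI)
    fix i p assume "p \<in> carrier (cmod (cone_cpx X Y f) i)"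
    then obtain x y where p: "p = Pair x y" "x \<in> carrier (cmod X (i + 1))" "y \<in> carrier (cmod Y i)"
      by (auto elim: mod_dsum_cases)
    then show "cdif (cone_cpx X Y g) i (\<theta> i p) = \<theta> (i + 1) (cdif (cone_cpx X Y f) i p)"
      using e[of x "i + 1"] by (simp add: cpx_ac[OF Y])
  qed (auto elim!: mod_dsum_cases simp: cpx_ac[OF Y])
  have "qis (cone_cpx X Y f) (cone_cpx X Y g) \<theta>"
  proof (rule qis_of_bijective[OF cone_bounded[OF X Y f] cone_bounded[OF X Y g] c])
    fix i p assume "p \<in> carrier (cmod (cone_cpx X Y g) i)"
    then obtain x y where p: "p = Pair x y" "x \<in> carrier (cmod X (i + 1))" "y \<in> carrier (cmod Y i)"
      by (auto elim: mod_dsum_cases)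
    then show "\<exists>q\<in>carrier (cmod (cone_cpx X Y f) i). \<theta> i q = p"
      by (intro bexI[of _ "Pair x (y \<oplus>\<^bsub>cmod Y i\<^esub> \<ominus>\<^bsub>cmod Y i\<^esub> h (i + 1) x)"]) (simp_all add: cpx_ac[OF Y])
  qed (auto elim!: mod_dsum_cases)
  then show ?thesis by blast
qed

text \<open>The two complexes have the same modules; the isomorphism \<open>(x, y) \<mapsto> (- x, y)\<close> matches the
  signs.\<close>

lemma cone_shift_qis:
  assumes X: "bounded_cpx R X" and Y: "bounded_cpx R Y" and f: "chain_map R X Y f"
  shows "\<exists>\<theta>. qis (cone_cpx (shift_cpx X) (shift_cpx Y) (\<lambda>i. f (i + 1))) (shift_cpx (cone_cpx X Y f)) \<theta>"
proof -
  note [simp] = cpx_simps[OF X] cpx_simps[OF Y] chain_mapD[OF f X Y]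
    chain_mapD[OF f X Y, where i = "_ + 1", simplified] chain_mapD[OF f X Y, where i = "_ + 2", simplified]
  define \<theta> where "\<theta> = (\<lambda>i p. Pair (\<ominus>\<^bsub>cmod X (i + 2)\<^esub> pfst p) (psnd p))"
  have \<theta> [simp]: "\<theta> i (Pair x y) = Pair (\<ominus>\<^bsub>cmod X (i + 2)\<^esub> x) y" for i x y by (simp add: \<theta>_def)
  have bd: "bounded_cpx R (cone_cpx (shift_cpx X) (shift_cpx Y) (\<lambda>i. f (i + 1)))"
    "bounded_cpx R (shift_cpx (cone_cpx X Y f))"
    by (intro shift_bounded cone_bounded chain_map_shift assms)+
  have c: "chain_map R (cone_cpx (shift_cpx X) (shift_cpx Y) (\<lambda>i. f (i + 1))) (shift_cpx (cone_cpx X Y f)) \<theta>"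
  proof (rule chain_mapI)
    fix i p assume "p \<in> carrier (cmod (cone_cpx (shift_cpx X) (shift_cpx Y) (\<lambda>i. f (i + 1))) i)"
    then obtain x y where p: "p = Pair x y" "x \<in> carrier (cmod X (i + 2))" "y \<in> carrier (cmod Y (i + 1))"
      by (auto elim: mod_dsum_cases)
    then show "cdif (shift_cpx (cone_cpx X Y f)) i (\<theta> i p) =
        \<theta> (i + 1) (cdif (cone_cpx (shift_cpx X) (shift_cpx Y) (\<lambda>i. f (i + 1))) i p)"
      using cpxD(7)[OF X, of x "i + 2"] chain_mapD(6)[OF f X Y, of x "i + 2"] by simp
  qed (auto elim!: mod_dsum_cases)
  have "qis (cone_cpx (shift_cpx X) (shift_cpx Y) (\<lambda>i. f (i + 1))) (shift_cpx (cone_cpx X Y f)) \<theta>"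
  proof (rule qis_of_bijective[OF bd c])
    fix i p assume "p \<in> carrier (cmod (shift_cpx (cone_cpx X Y f)) i)"
    then obtain x y where p: "p = Pair x y" "x \<in> carrier (cmod X (i + 2))" "y \<in> carrier (cmod Y (i + 1))"
      by (auto elim: mod_dsum_cases)
    then show "\<exists>q\<in>carrier (cmod (cone_cpx (shift_cpx X) (shift_cpx Y) (\<lambda>i. f (i + 1))) i). \<theta> i q = p"
      by (intro bexI[of _ "Pair (\<ominus>\<^bsub>cmod X (i + 2)\<^esub> x) y"]) simp_all
  next
    fix i p assume "p \<in> carrier (cmod (cone_cpx (shift_cpx X) (shift_cpx Y) (\<lambda>i. f (i + 1))) i)"
      "\<theta> i p = \<zero>\<^bsub>cmod (shift_cpx (cone_cpx X Y f)) i\<^esub>"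
    then show "p = \<zero>\<^bsub>cmod (cone_cpx (shift_cpx X) (shift_cpx Y) (\<lambda>i. f (i + 1))) i\<^esub>"
      by (auto elim!: mod_dsum_cases)
  qed
  then show ?thesis by blast
qed

section \<open>Fibres\<close>

text \<open>The fibre of \<open>f\<close>, with \<open>d (x, y) = (d x, - f x - d y)\<close>. It completes \<open>f\<close> to a triangle on the left,
  as the cone does on the right.\<close>

definition fib_cpx :: "'a cpx \<Rightarrow> 'a cpx \<Rightarrow> (int \<Rightarrow> 'a mel \<Rightarrow> 'a mel) \<Rightarrow> 'a cpx" where
  "fib_cpx X Y f = unshift_cpx (cone_cpx X Y f)"

lemma fib_bounded:
  "bounded_cpx R X \<Longrightarrow> bounded_cpx R Y \<Longrightarrow> chain_map R X Y f \<Longrightarrow> bounded_cpx R (fib_cpx X Y f)"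
  unfolding fib_cpx_def by (intro unshift_bounded cone_bounded)

lemma fib_simps:
  assumes X: "bounded_cpx R X" and Y: "bounded_cpx R Y" and f: "chain_map R X Y f"
  shows "cmod (fib_cpx X Y f) i = mod_dsum (cmod X i) (cmod Y (i - 1))"
    and "x \<in> carrier (cmod X i) \<Longrightarrow> y \<in> carrier (cmod Y (i - 1)) \<Longrightarrow>
      cdif (fib_cpx X Y f) i (Pair x y) = Pair (cdif X i x)
        (\<ominus>\<^bsub>cmod Y i\<^esub> f i x \<oplus>\<^bsub>cmod Y i\<^esub> \<ominus>\<^bsub>cmod Y i\<^esub> cdif Y (i - 1) y)"
  unfolding fib_cpx_def
  by (simp_all add: cpx_simps[OF X] cpx_simps[OF Y] chain_mapD[OF f X Y])

lemma fib_proj: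
  assumes X: "bounded_cpx R X" and Y: "bounded_cpx R Y" and f: "chain_map R X Y f"
  shows "chain_map R (fib_cpx X Y f) X (\<lambda>i. pfst)"
  by (rule chain_mapI) (auto simp: fib_simps[OF X Y f] elim!: mod_dsum_cases)

text \<open>Rotation of the triangle: the cone of the projection of the fibre to \<open>X\<close> recovers \<open>Y\<close>, by
  \<open>((x', y), x) \<mapsto> y - f x\<close>.\<close>

lemma cone_fib_proj_qis:
  assumes X: "bounded_cpx R X" and Y: "bounded_cpx R Y" and f: "chain_map R X Y f"
  shows "\<exists>\<theta>. qis (cone_cpx (fib_cpx X Y f) X (\<lambda>i. pfst)) Y \<theta>"
proof -
  note [simp] = cpx_simps[OF X] cpx_simps[OF Y] chain_mapD[OF f X Y] fib_simps[OF X Y f]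
    fib_simps(2)[OF X Y f, where i = "_ + 1", simplified] 
  let ?K = "cone_cpx (fib_cpx X Y f) X (\<lambda>i. pfst)"
  have K: "bounded_cpx R ?K" by (intro cone_bounded fib_proj fib_bounded assms)
  define \<theta> where "\<theta> = (\<lambda>i p. psnd (pfst p) \<oplus>\<^bsub>cmod Y i\<^esub> \<ominus>\<^bsub>cmod Y i\<^esub> f i (psnd p))"
  have \<theta> [simp]: "\<theta> i (Pair (Pair x' y) x) = y \<oplus>\<^bsub>cmod Y i\<^esub> \<ominus>\<^bsub>cmod Y i\<^esub> f i x" for i x' x y by (simp add: \<theta>_def)
  have c: "chain_map R ?K Y \<theta>"
    by (rule chain_mapI) (auto elim!: mod_dsum_cases simp: cpx_ac[OF Y])
  have "qis ?K Y \<theta>" unfolding qis_def hinj_def hsurj_def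
  proof (intro conjI c allI impI)
    fix i p assume p: "cycle ?K i p" "boundary Y i (\<theta> i p)"
    then obtain x' y x where xy: "p = Pair (Pair x' y) x" "x' \<in> carrier (cmod X (i + 1))"
      "y \<in> carrier (cmod Y i)" "x \<in> carrier (cmod X i)"
      by (auto simp: cycle_def elim!: mod_dsum_cases)
    obtain m where m: "m \<in> carrier (cmod Y (i - 1))" "y \<oplus>\<^bsub>cmod Y i\<^esub> \<ominus>\<^bsub>cmod Y i\<^esub> f i x = cdif Y (i - 1) m"
      using p xy by (auto simp: boundary_def)
    have y: "y = f i x \<oplus>\<^bsub>cmod Y i\<^esub> cdif Y (i - 1) m"
      using xy unfolding m(2)[symmetric] by (simp add: cpx_ac[OF Y])
    interpret M: module R "cmod X (i + 1)" using cpxD(1)[OF X] .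
    have "x' \<oplus>\<^bsub>cmod X (i + 1)\<^esub> cdif X i x = \<zero>\<^bsub>cmod X (i + 1)\<^esub>"
      using p(1) xy by (simp add: cycle_def)
    then have x': "x' = \<ominus>\<^bsub>cmod X (i + 1)\<^esub> cdif X i x"
      using M.minus_equality[of x' "cdif X i x"] xy by simp
    show "boundary ?K i p" unfolding boundary_def
      by (rule bexI[of _ "Pair (Pair x m) \<zero>\<^bsub>cmod X (i - 1)\<^esub>"])
        (use xy y x' m in \<open>simp_all add: cpxD_pred[OF X] cpxD_pred[OF Y] cpx_ac[OF Y]\<close>)
  next
    fix i y assume y: "cycle Y i y"
    then have "cycle ?K i (Pair (Pair \<zero>\<^bsub>cmod X (i + 1)\<^esub> y) \<zero>\<^bsub>cmod X i\<^esub>)"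
      by (simp add: cycle_def)
    moreover have "y = \<theta> i (Pair (Pair \<zero>\<^bsub>cmod X (i + 1)\<^esub> y) \<zero>\<^bsub>cmod X i\<^esub>) \<oplus>\<^bsub>cmod Y i\<^esub> \<zero>\<^bsub>cmod Y i\<^esub>"
      using y by (simp add: cycle_def)
    ultimately show "\<exists>x b. cycle ?K i x \<and> boundary Y i b \<and> y = \<theta> i x \<oplus>\<^bsub>cmod Y i\<^esub> b"
      using boundary_zero[OF Y] by blast
  qed
  then show ?thesis by blast
qed

end

section \<open>The homotopy category\<close>

context cring begin

definition htpy_arr :: "'a cpx \<Rightarrow> 'a cpx \<Rightarrow> (int \<Rightarrow> 'a mel \<Rightarrow> 'a mel) \<Rightarrow>
    ('a cpx, (int \<Rightarrow> 'a mel \<Rightarrow> 'a mel) set) arr" where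
  "htpy_arr X Y f = (X, Y, htpy_class R X Y f)"

lemma htpy_arr_ends [simp]: "src (htpy_arr X Y f) = X" "tgt (htpy_arr X Y f) = Y"
  by (simp_all add: htpy_arr_def src_def tgt_def)

lemma htpy_class_eq:
  assumes "bounded_cpx R X" "bounded_cpx R Y" "chain_map R X Y f" "chain_map R X Y g"
  shows "htpy_class R X Y f = htpy_class R X Y g \<longleftrightarrow> homotopic R X Y f g"
proof
  assume "htpy_class R X Y f = htpy_class R X Y g"
  moreover have "g \<in> htpy_class R X Y g" using assms homotopic_refl by (auto simp: htpy_class_def)
  ultimately show "homotopic R X Y f g" by (auto simp: htpy_class_def)
next
  assume "homotopic R X Y f g"
  then show "htpy_class R X Y f = htpy_class R X Y g"
    using homotopic_trans homotopic_sym assms unfolding htpy_class_def by blast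
qed

lemma htpy_arr_eq_iff:
  assumes "bounded_cpx R X" "bounded_cpx R Y" "chain_map R X Y f" "chain_map R X Y g"
  shows "htpy_arr X Y f = htpy_arr X Y g \<longleftrightarrow> homotopic R X Y f g"
  using htpy_class_eq[OF assms] by (simp add: htpy_arr_def)

lemma Kb_simps [simp]:
  "Ob (Kb R) = {X. bounded_cpx R X}" "Sh (Kb R) = shift_cpx"
  "Idt (Kb R) X = htpy_arr X X (\<lambda>i x. x)" "Nul (Kb R) X Y = htpy_arr X Y (\<lambda>i x. \<zero>\<^bsub>cmod Y i\<^esub>)"
  by (simp_all add: Kb_def Kb_shiftcat_def htpy_arr_def)

lemma Hom_Kb: "Hom (Kb R) X Y = {htpy_arr X Y f | f. bounded_cpx R X \<and> bounded_cpx R Y \<and> chain_map R X Y f}"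
  by (simp add: Kb_def Kb_shiftcat_def htpy_arr_def)

lemma mem_htpy_class: "g \<in> htpy_class R X Y f \<longleftrightarrow> chain_map R X Y g \<and> homotopic R X Y f g"
  by (simp add: htpy_class_def)

lemma Cmp_htpy_arr:
  assumes X: "bounded_cpx R X" and Y: "bounded_cpx R Y" and Z: "bounded_cpx R Z"
    and f: "chain_map R X Y f" and g: "chain_map R Y Z g"
  shows "Cmp (Kb R) (htpy_arr Y Z g) (htpy_arr X Y f) = htpy_arr X Z (\<lambda>i x. g i (f i x))"
proof -
  have "\<Union> {htpy_class R X Z (\<lambda>i x. g' i (f' i x)) | f' g'. f' \<in> htpy_class R X Y f \<and> g' \<in> htpy_class R Y Z g}
      = htpy_class R X Z (\<lambda>i x. g i (f i x))" (is "\<Union>?A = ?B")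
  proof (rule Union_same)
    show "?A \<noteq> {}" using homotopic_refl[OF X Y f] homotopic_refl[OF Y Z g] f g
      by (auto simp: mem_htpy_class)
    fix B assume "B \<in> ?A"
    then obtain f' g' where B: "B = htpy_class R X Z (\<lambda>i x. g' i (f' i x))"
      and h: "chain_map R X Y f'" "homotopic R X Y f f'" "chain_map R Y Z g'" "homotopic R Y Z g g'"
      by (auto simp: mem_htpy_class)
    have "homotopic R X Z (\<lambda>i x. g i (f i x)) (\<lambda>i x. g' i (f' i x))"
      by (rule homotopic_comp) (use assms h in auto)
    then show "B = ?B" unfolding B
      using htpy_class_eq[OF X Z] chain_map_comp[OF f g X Y Z] chain_map_comp[OF h(1,3) X Y Z] by blast
  qed
  then show ?thesis by (simp add: Kb_def Kb_shiftcat_def htpy_arr_def)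
qed

lemma Add_htpy_arr:
  assumes X: "bounded_cpx R X" and Y: "bounded_cpx R Y"
    and f: "chain_map R X Y f" and g: "chain_map R X Y g"
  shows "Add (Kb R) (htpy_arr X Y f) (htpy_arr X Y g) = htpy_arr X Y (\<lambda>i x. f i x \<oplus>\<^bsub>cmod Y i\<^esub> g i x)"
proof -
  have "\<Union> {htpy_class R X Y (\<lambda>i x. f' i x \<oplus>\<^bsub>cmod Y i\<^esub> g' i x) | f' g'. f' \<in> htpy_class R X Y f \<and> g' \<in> htpy_class R X Y g}
      = htpy_class R X Y (\<lambda>i x. f i x \<oplus>\<^bsub>cmod Y i\<^esub> g i x)" (is "\<Union>?A = ?B")
  proof (rule Union_same)
    show "?A \<noteq> {}" using homotopic_refl[OF X Y f] homotopic_refl[OF X Y g] f g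
      by (auto simp: mem_htpy_class)
    fix B assume "B \<in> ?A"
    then obtain f' g' where B: "B = htpy_class R X Y (\<lambda>i x. f' i x \<oplus>\<^bsub>cmod Y i\<^esub> g' i x)"
      and h: "chain_map R X Y f'" "homotopic R X Y f f'" "chain_map R X Y g'" "homotopic R X Y g g'"
      by (auto simp: mem_htpy_class)
    have "homotopic R X Y (\<lambda>i x. f i x \<oplus>\<^bsub>cmod Y i\<^esub> g i x) (\<lambda>i x. f' i x \<oplus>\<^bsub>cmod Y i\<^esub> g' i x)"
      by (rule homotopic_add) (use assms h in auto)
    then show "B = ?B" unfolding B
      using htpy_class_eq[OF X Y] chain_map_add[OF f g X Y] chain_map_add[OF h(1,3) X Y] by blast
  qed
  then show ?thesis by (simp add: Kb_def Kb_shiftcat_def htpy_arr_def)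
qed

lemma ShA_htpy_arr:
  assumes X: "bounded_cpx R X" and Y: "bounded_cpx R Y" and f: "chain_map R X Y f"
  shows "ShA (Kb R) (htpy_arr X Y f) = htpy_arr (shift_cpx X) (shift_cpx Y) (\<lambda>i. f (i + 1))"
proof -
  have "\<Union> {htpy_class R (shift_cpx X) (shift_cpx Y) (\<lambda>i. f' (i + 1)) | f'. f' \<in> htpy_class R X Y f}
      = htpy_class R (shift_cpx X) (shift_cpx Y) (\<lambda>i. f (i + 1))" (is "\<Union>?A = ?B")
  proof (rule Union_same)
    show "?A \<noteq> {}" using homotopic_refl[OF X Y f] f by (auto simp: mem_htpy_class)
    fix B assume "B \<in> ?A"
    then obtain f' where B: "B = htpy_class R (shift_cpx X) (shift_cpx Y) (\<lambda>i. f' (i + 1))"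
      and h: "chain_map R X Y f'" "homotopic R X Y f f'"
      by (auto simp: mem_htpy_class)
    have "homotopic R (shift_cpx X) (shift_cpx Y) (\<lambda>i. f (i + 1)) (\<lambda>i. f' (i + 1))"
      by (rule homotopic_shift[OF X Y h])
    then show "B = ?B" unfolding B
      using htpy_class_eq[OF shift_bounded[OF X] shift_bounded[OF Y]] chain_map_shift[OF f X Y]
        chain_map_shift[OF h(1) X Y] by blast
  qed
  then show ?thesis by (simp add: Kb_def Kb_shiftcat_def htpy_arr_def)
qed

theorem Kb_shift_category: "shift_category (Kb R)"
proof
  fix X Y Z T f g h
  show "f \<in> Hom (Kb R) X Y \<Longrightarrow> X \<in> Ob (Kb R) \<and> Y \<in> Ob (Kb R) \<and> src f = X \<and> tgt f = Y"
    by (auto simp: Hom_Kb)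
  show "X \<in> Ob (Kb R) \<Longrightarrow> Idt (Kb R) X \<in> Hom (Kb R) X X"
    using chain_map_id by (auto simp: Hom_Kb)
  show "f \<in> Hom (Kb R) X Y \<Longrightarrow> g \<in> Hom (Kb R) Y Z \<Longrightarrow> Cmp (Kb R) g f \<in> Hom (Kb R) X Z"
    using chain_map_comp by (fastforce simp: Hom_Kb Cmp_htpy_arr)
  show "f \<in> Hom (Kb R) X Y \<Longrightarrow> g \<in> Hom (Kb R) Y Z \<Longrightarrow> h \<in> Hom (Kb R) Z T \<Longrightarrow>
      Cmp (Kb R) (Cmp (Kb R) h g) f = Cmp (Kb R) h (Cmp (Kb R) g f)"
    by (auto simp: Hom_Kb Cmp_htpy_arr chain_map_comp)
  show "f \<in> Hom (Kb R) X Y \<Longrightarrow> Cmp (Kb R) (Idt (Kb R) Y) f = f"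
    by (auto simp: Hom_Kb Cmp_htpy_arr chain_map_id)
  show "f \<in> Hom (Kb R) X Y \<Longrightarrow> Cmp (Kb R) f (Idt (Kb R) X) = f"
    by (auto simp: Hom_Kb Cmp_htpy_arr chain_map_id)
  show "f \<in> Hom (Kb R) X Y \<Longrightarrow> g \<in> Hom (Kb R) X Y \<Longrightarrow> Add (Kb R) f g \<in> Hom (Kb R) X Y"
    using chain_map_add by (fastforce simp: Hom_Kb Add_htpy_arr)
  show "h \<in> Hom (Kb R) X Y \<Longrightarrow> f \<in> Hom (Kb R) Y Z \<Longrightarrow> g \<in> Hom (Kb R) Y Z \<Longrightarrow>
      Cmp (Kb R) (Add (Kb R) f g) h = Add (Kb R) (Cmp (Kb R) f h) (Cmp (Kb R) g h)"
    by (auto simp: Hom_Kb Cmp_htpy_arr Add_htpy_arr chain_map_comp chain_map_add)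
  show "X \<in> Ob (Kb R) \<Longrightarrow> Y \<in> Ob (Kb R) \<Longrightarrow> Nul (Kb R) X Y \<in> Hom (Kb R) X Y"
    using chain_map_zero by (fastforce simp: Hom_Kb)
  show "X \<in> Ob (Kb R) \<Longrightarrow> Sh (Kb R) X \<in> Ob (Kb R)" by (simp add: shift_bounded)
  show "f \<in> Hom (Kb R) X Y \<Longrightarrow> ShA (Kb R) f \<in> Hom (Kb R) (Sh (Kb R) X) (Sh (Kb R) Y)"
    using chain_map_shift shift_bounded by (fastforce simp: Hom_Kb ShA_htpy_arr)
  show "X \<in> Ob (Kb R) \<Longrightarrow> ShA (Kb R) (Idt (Kb R) X) = Idt (Kb R) (Sh (Kb R) X)"
    by (simp add: ShA_htpy_arr chain_map_id)
  show "f \<in> Hom (Kb R) X Y \<Longrightarrow> g \<in> Hom (Kb R) Y Z \<Longrightarrow>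
      ShA (Kb R) (Cmp (Kb R) g f) = Cmp (Kb R) (ShA (Kb R) g) (ShA (Kb R) f)"
    by (auto simp: Hom_Kb Cmp_htpy_arr ShA_htpy_arr chain_map_comp chain_map_shift shift_bounded)
qed

lemma arr_Kb: "shift_category.arr (Kb R) \<phi> \<longleftrightarrow>
    (\<exists>X Y f. \<phi> = htpy_arr X Y f \<and> bounded_cpx R X \<and> bounded_cpx R Y \<and> chain_map R X Y f)"
proof -
  interpret K: shift_category "Kb R" by (rule Kb_shift_category)
  show ?thesis unfolding K.arr_def Hom_Kb by (force)
qed

end

section \<open>Classes of complexes closed under cones\<close>

text \<open>The class of acyclic complexes and the class of perfect complexes are the instances. The axioms
  are those of a triangulated subcategory of the derived category, in terms of complexes.\<close>

locale cone_class = cring R for R :: "('a, 'b) ring_scheme" (structure) +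
  fixes N :: "'a cpx set"
  assumes N_bounded: "X \<in> N \<Longrightarrow> bounded_cpx R X"
    and N_qis: "bounded_cpx R X \<Longrightarrow> bounded_cpx R Y \<Longrightarrow> qis X Y f \<Longrightarrow> X \<in> N \<longleftrightarrow> Y \<in> N"
    and N_cone: "X \<in> N \<Longrightarrow> Y \<in> N \<Longrightarrow> chain_map R X Y f \<Longrightarrow> cone_cpx X Y f \<in> N"
    and N_shift: "X \<in> N \<Longrightarrow> shift_cpx X \<in> N"
    and N_unshift: "X \<in> N \<Longrightarrow> unshift_cpx X \<in> N"
    and N_acyclic: "bounded_cpx R X \<Longrightarrow> acyclic_cpx R X \<Longrightarrow> X \<in> N"
begin

definition cone_arrows :: "('a cpx, (int \<Rightarrow> 'a mel \<Rightarrow> 'a mel) set) arr set" where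
  "cone_arrows = {htpy_arr X Y f | X Y f. bounded_cpx R X \<and> bounded_cpx R Y \<and> chain_map R X Y f \<and>
     cone_cpx X Y f \<in> N}"

lemma N_cone_homotopic:
  assumes "bounded_cpx R X" "bounded_cpx R Y" "chain_map R X Y f" "chain_map R X Y g" "homotopic R X Y f g"
  shows "cone_cpx X Y f \<in> N \<longleftrightarrow> cone_cpx X Y g \<in> N"
  using cone_homotopic_qis[OF assms] N_qis cone_bounded assms(1-4) by blast

lemma htpy_arr_cone_arrows:
  assumes "bounded_cpx R X" "bounded_cpx R Y" "chain_map R X Y f"
  shows "htpy_arr X Y f \<in> cone_arrows \<longleftrightarrow> cone_cpx X Y f \<in> N"
proof
  assume "htpy_arr X Y f \<in> cone_arrows"
  then obtain X' Y' g where "htpy_arr X Y f = htpy_arr X' Y' g" "chain_map R X' Y' g" "cone_cpx X' Y' g \<in> N"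
    by (auto simp: cone_arrows_def)
  moreover from this(1) have "X' = X" "Y' = Y" by (auto simp: htpy_arr_def)
  ultimately show "cone_cpx X Y f \<in> N"
    using htpy_arr_eq_iff[OF assms(1,2,3)] N_cone_homotopic[OF assms(1,2,3)] by blast
qed (use assms in \<open>auto simp: cone_arrows_def\<close>)

lemma N_cone_of_qis:
  assumes X: "bounded_cpx R X" and Y: "bounded_cpx R Y" and f: "qis X Y f"
  shows "cone_cpx X Y f \<in> N"
  using f cone_acyclic_iff[OF X Y] cone_bounded[OF X Y] N_acyclic by (auto simp: qis_def)

text \<open>By \<open>cone_cone_qis\<close>, the cone of the induced map is up to quasi-isomorphism the cone of a map between
  the cones of the two sides.\<close>

lemma N_cone_map:
  assumes X: "bounded_cpx R X" and Y: "bounded_cpx R Y" and X': "bounded_cpx R X'" and Y': "bounded_cpx R Y'"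
    and f: "chain_map R X Y f" and f': "chain_map R X' Y' f'"
    and a: "chain_map R X X' a" and b: "chain_map R Y Y' b"
    and sq: "\<And>i x. x \<in> carrier (cmod X i) \<Longrightarrow> b i (f i x) = f' i (a i x)"
    and N: "cone_cpx X X' a \<in> N" "cone_cpx Y Y' b \<in> N"
  shows "cone_cpx (cone_cpx X Y f) (cone_cpx X' Y' f') (cone_map a b) \<in> N"
proof -
  have v: "chain_map R (cone_cpx X Y f) (cone_cpx X' Y' f') (cone_map a b)"
    by (rule cone_map_chain) (use assms in auto)
  have w: "chain_map R (cone_cpx X X' a) (cone_cpx Y Y' b) (cone_map f f')"
    by (rule cone_map_chain) (use assms in auto)
  have "cone_cpx (cone_cpx X X' a) (cone_cpx Y Y' b) (cone_map f f') \<in> N"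
    by (rule N_cone[OF N w])
  moreover obtain \<theta> where \<theta>: "qis (cone_cpx (cone_cpx X Y f) (cone_cpx X' Y' f') (cone_map a b))
    (cone_cpx (cone_cpx X X' a) (cone_cpx Y Y' b) (cone_map f f')) \<theta>"
    using cone_cone_qis[OF X Y X' Y' f f' a b sq] by blast
  moreover note N_qis[OF cone_bounded[OF cone_bounded[OF X Y f] cone_bounded[OF X' Y' f'] v]
    cone_bounded[OF cone_bounded[OF X X' a] cone_bounded[OF Y Y' b] w] \<theta>]
  ultimately show ?thesis by simp
qed

text \<open>The octahedral axiom. The map of cones comes from the square with sides \<open>id\<close> and \<open>g\<close>. Its cone is,
  by \<open>cone_cone_qis\<close>, the cone of a map from the acyclic cone of \<open>id\<close> to the cone of \<open>g\<close>, hence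
  receives a quasi-isomorphism from the latter.\<close>

lemma cone_factor_qis:
  assumes X: "bounded_cpx R X" and Y: "bounded_cpx R Y" and Z: "bounded_cpx R Z"
    and f: "chain_map R X Y f" and g: "chain_map R Y Z g" and gf: "chain_map R X Z gf"
    and e: "\<And>i x. x \<in> carrier (cmod X i) \<Longrightarrow> gf i x = g i (f i x)"
  shows "chain_map R (cone_cpx X Y f) (cone_cpx X Z gf) (cone_map (\<lambda>i x. x) g)"
    and "\<exists>E. bounded_cpx R E \<and> (\<exists>\<theta>. qis (cone_cpx (cone_cpx X Y f) (cone_cpx X Z gf) (cone_map (\<lambda>i x. x) g)) E \<theta>) \<and>
      (\<exists>\<theta>. qis (cone_cpx Y Z g) E \<theta>)"
proof -
  have sq: "\<And>i x. x \<in> carrier (cmod X i) \<Longrightarrow> g i (f i x) = gf i x" using e by simp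
  show v: "chain_map R (cone_cpx X Y f) (cone_cpx X Z gf) (cone_map (\<lambda>i x. x) g)"
    by (rule cone_map_chain[OF X Y X Z f gf chain_map_id g]) (simp add: sq)
  have w: "chain_map R (cone_cpx X X (\<lambda>i x. x)) (cone_cpx Y Z g) (cone_map f gf)"
    by (rule cone_map_chain[OF X X Y Z chain_map_id g f gf]) (simp add: sq)
  have 1: "acyclic_cpx R (cone_cpx X X (\<lambda>i x. x))"
    using cone_acyclic_iff[OF X X chain_map_id] qis_id[OF X] by simp
  note bd = cone_bounded[OF X X chain_map_id] cone_bounded[OF Y Z g]
  let ?E = "cone_cpx (cone_cpx X X (\<lambda>i x. x)) (cone_cpx Y Z g) (cone_map f gf)"
  have 2: "\<exists>\<theta>. qis (cone_cpx (cone_cpx X Y f) (cone_cpx X Z gf) (cone_map (\<lambda>i x. x) g)) ?E \<theta>"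
    by (rule cone_cone_qis[OF X Y X Z f gf chain_map_id g sq])
  have 3: "\<exists>\<theta>. qis (cone_cpx Y Z g) ?E \<theta>"
    by (rule exI) (rule cone_incl_qis[OF bd w 1])
  show "\<exists>E. bounded_cpx R E \<and> (\<exists>\<theta>. qis (cone_cpx (cone_cpx X Y f) (cone_cpx X Z gf) (cone_map (\<lambda>i x. x) g)) E \<theta>) \<and>
      (\<exists>\<theta>. qis (cone_cpx Y Z g) E \<theta>)"
    by (intro exI[of _ ?E] conjI cone_bounded[OF bd w] 2 3)
qed

text \<open>In the triangle \<open>cone f \<rightarrow> cone (g f) \<rightarrow> cone g\<close> the outer terms are in \<open>N\<close>. Rotating it by means of
  the fibre exhibits the middle term as a cone between objects of \<open>N\<close>.\<close>

lemma N_cone_comp: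
  assumes X: "bounded_cpx R X" and Y: "bounded_cpx R Y" and Z: "bounded_cpx R Z"
    and f: "chain_map R X Y f" and g: "chain_map R Y Z g"
    and N: "cone_cpx X Y f \<in> N" "cone_cpx Y Z g \<in> N"
  shows "cone_cpx X Z (\<lambda>i x. g i (f i x)) \<in> N"
proof -
  let ?gf = "\<lambda>i x. g i (f i x)"
  let ?u = "cone_map (\<lambda>i x. x) g"
  have gf: "chain_map R X Z ?gf" by (rule chain_map_comp[OF f g X Y Z])
  note u = cone_factor_qis(1)[OF X Y Z f g gf refl]
  note bd = cone_bounded[OF X Y f] cone_bounded[OF X Z gf]
  obtain E \<theta> \<theta>' where E: "bounded_cpx R E" "qis (cone_cpx (cone_cpx X Y f) (cone_cpx X Z ?gf) ?u) E \<theta>"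
    "qis (cone_cpx Y Z g) E \<theta>'"
    using cone_factor_qis(2)[OF X Y Z f g gf refl] by (elim exE conjE)
  have "cone_cpx (cone_cpx X Y f) (cone_cpx X Z ?gf) ?u \<in> N"
    using N_qis[OF cone_bounded[OF bd u] E(1,2)] N_qis[OF cone_bounded[OF Y Z g] E(1,3)] N(2) by simp
  then have "fib_cpx (cone_cpx X Y f) (cone_cpx X Z ?gf) ?u \<in> N"
    unfolding fib_cpx_def by (rule N_unshift)
  then have "cone_cpx (fib_cpx (cone_cpx X Y f) (cone_cpx X Z ?gf) ?u) (cone_cpx X Y f) (\<lambda>i. pfst) \<in> N"
    by (rule N_cone[OF _ N(1) fib_proj[OF bd u]])
  moreover obtain \<theta>2 where "qis (cone_cpx (fib_cpx (cone_cpx X Y f) (cone_cpx X Z ?gf) ?u) (cone_cpx X Y f) (\<lambda>i. pfst))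
    (cone_cpx X Z ?gf) \<theta>2" using cone_fib_proj_qis[OF bd u] by blast
  ultimately show ?thesis
    using N_qis[OF N_bounded bd(2)] by blast
qed

text \<open>Composition with quasi-isomorphisms on either side does not change a cone up to
  quasi-isomorphism.\<close>

lemma N_cone_descend:
  assumes bd: "bounded_cpx R X'" "bounded_cpx R X" "bounded_cpx R Y'" "bounded_cpx R Y"
    and s': "qis X' X s'" and s: "qis Y' Y s" and g: "chain_map R X Y g" and g': "chain_map R X' Y' g'"
    and h: "homotopic R X' Y (\<lambda>i x. s i (g' i x)) (\<lambda>i x. g i (s' i x))" and N: "cone_cpx X Y g \<in> N"
  shows "cone_cpx X' Y' g' \<in> N"
proof -
  have c: "chain_map R X' X s'" "chain_map R Y' Y s" using s s' by (auto simp: qis_def)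
  have c1: "chain_map R X' Y (\<lambda>i x. s i (g' i x))" using chain_map_comp g' c(2) bd by blast
  have c2: "chain_map R X' Y (\<lambda>i x. g i (s' i x))" using chain_map_comp g c(1) bd by blast
  have "qis (cone_cpx X' Y (\<lambda>i x. g i (s' i x))) (cone_cpx X Y g) (cone_map s' (\<lambda>i x. x))"
    by (rule cone_map_qis) (use bd c2 g s' qis_id in auto)
  then have "cone_cpx X' Y (\<lambda>i x. g i (s' i x)) \<in> N"
    using N_qis[OF cone_bounded[OF bd(1,4) c2] cone_bounded[OF bd(2,4) g]] N by blast
  then have "cone_cpx X' Y (\<lambda>i x. s i (g' i x)) \<in> N"
    using N_cone_homotopic[OF bd(1,4) c1 c2 h] by simp
  moreover have "qis (cone_cpx X' Y' g') (cone_cpx X' Y (\<lambda>i x. s i (g' i x))) (cone_map (\<lambda>i x. x) s)"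
    by (rule cone_map_qis) (use bd c1 g' s qis_id in auto)
  ultimately show ?thesis
    using N_qis[OF cone_bounded[OF bd(1,3) g'] cone_bounded[OF bd(1,4) c1]] by blast
qed

text \<open>The homotopy pullback of \<open>s\<close> and \<open>f\<close>, built as the fibre of \<open>Y \<rightarrow> Z \<rightarrow> cone s\<close>. Its elements are
  \<open>(y, (x, z))\<close>, and \<open>z\<close> is the homotopy from \<open>s (- x)\<close> to \<open>f y\<close>.\<close>

lemma N_ore:
  assumes X: "bounded_cpx R X" and Y: "bounded_cpx R Y" and Z: "bounded_cpx R Z"
    and s: "chain_map R X Z s" and f: "chain_map R Y Z f" and N: "cone_cpx X Z s \<in> N"
  shows "\<exists>V u t. bounded_cpx R V \<and> chain_map R V X u \<and> chain_map R V Y t \<and> cone_cpx V Y t \<in> N \<and>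
    homotopic R V Z (\<lambda>i x. s i (u i x)) (\<lambda>i x. f i (t i x))"
proof -
  note [simp] = cpx_simps[OF X] cpx_simps[OF Y] cpx_simps[OF Z] chain_mapD[OF s X Z] chain_mapD[OF f Y Z]
  let ?C = "cone_cpx X Z s"
  let ?if = "\<lambda>i y. Pair \<zero>\<^bsub>cmod X (i + 1)\<^esub> (f i y)"
  have C: "bounded_cpx R ?C" by (rule cone_bounded[OF X Z s])
  have c: "chain_map R Y ?C ?if"
    using chain_map_comp[OF f cone_incl[OF X Z s] Y Z C] .
  define V where "V = fib_cpx Y ?C ?if"
  define u where "u = (\<lambda>i p. \<ominus>\<^bsub>cmod X i\<^esub> pfst (psnd p))"
  have V: "bounded_cpx R V" unfolding V_def by (rule fib_bounded[OF Y C c])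
  have Vs [simp]: "cmod V i = mod_dsum (cmod Y i) (mod_dsum (cmod X i) (cmod Z (i - 1)))" for i
    unfolding V_def by (simp add: fib_simps[OF Y C c])
  have Vd [simp]: "cdif V i (Pair y (Pair x z)) = Pair (cdif Y i y) (Pair (cdif X i x)
     (\<ominus>\<^bsub>cmod Z i\<^esub> f i y \<oplus>\<^bsub>cmod Z i\<^esub> (\<ominus>\<^bsub>cmod Z i\<^esub> s i x \<oplus>\<^bsub>cmod Z i\<^esub> \<ominus>\<^bsub>cmod Z i\<^esub> cdif Z (i - 1) z)))"
    if "y \<in> carrier (cmod Y i)" "x \<in> carrier (cmod X i)" "z \<in> carrier (cmod Z (i - 1))" for i x y z
    using that unfolding V_def by (simp add: fib_simps[OF Y C c])
  have u: "chain_map R V X u"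
    by (rule chain_mapI) (auto elim!: mod_dsum_cases simp: u_def)
  have t: "chain_map R V Y (\<lambda>i. pfst)" unfolding V_def by (rule fib_proj[OF Y C c])
  have 1: "htpy_maps V Z (\<lambda>i p. psnd (psnd p))"
    by (rule htpy_mapsI) (auto elim!: mod_dsum_cases)
  have "homotopic R V Z (\<lambda>i x. s i (u i x)) (\<lambda>i x. f i (pfst x))"
    by (rule homotopicI[OF 1]) (auto elim!: mod_dsum_cases simp: u_def cpx_ac[OF Z])
  moreover have "cone_cpx V Y (\<lambda>i. pfst) \<in> N"
    using cone_fib_proj_qis[OF Y C c] N_qis[OF cone_bounded[OF V Y t] C] N unfolding V_def by blast
  ultimately show ?thesis using V u t by blast
qed

text \<open>A homotopy \<open>k\<close> from \<open>s f\<close> to \<open>s g\<close> lifts \<open>f - g\<close> to the chain map \<open>d = (f - g, - k)\<close> into the fibre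
  of \<open>s\<close>, which is in \<open>N\<close>. The projection from the fibre of \<open>d\<close> has its cone in \<open>N\<close> and equalises \<open>f\<close>
  and \<open>g\<close> up to homotopy.\<close>

lemma N_cancel:
  assumes X: "bounded_cpx R X" and Y: "bounded_cpx R Y" and Z: "bounded_cpx R Z"
    and s: "chain_map R X Z s" and f: "chain_map R Y X f" and g: "chain_map R Y X g" and N: "cone_cpx X Z s \<in> N"
    and h: "homotopic R Y Z (\<lambda>i x. s i (f i x)) (\<lambda>i x. s i (g i x))"
  shows "\<exists>V t. bounded_cpx R V \<and> chain_map R V Y t \<and> cone_cpx V Y t \<in> N \<and>
    homotopic R V X (\<lambda>i x. f i (t i x)) (\<lambda>i x. g i (t i x))"
proof -
  obtain k where k: "htpy_maps Y Z k" and e: "\<And>i x. x \<in> carrier (cmod Y i) \<Longrightarrow> s i (f i x) =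
      s i (g i x) \<oplus>\<^bsub>cmod Z i\<^esub> (cdif Z (i - 1) (k i x) \<oplus>\<^bsub>cmod Z i\<^esub> k (i + 1) (cdif Y i x))"
    using h by (rule homotopicE) blast
  note [simp] = cpx_simps[OF X] cpx_simps[OF Y] cpx_simps[OF Z] chain_mapD[OF s X Z] chain_mapD[OF f Y X]
    chain_mapD[OF g Y X] htpy_mapsD[OF k Y Z] cpxD_pred[OF Z]
  have F: "bounded_cpx R (fib_cpx X Z s)" by (rule fib_bounded[OF X Z s])
  note [simp] = fib_simps[OF X Z s]
  define d where "d = (\<lambda>i y. Pair (f i y \<oplus>\<^bsub>cmod X i\<^esub> \<ominus>\<^bsub>cmod X i\<^esub> g i y) (\<ominus>\<^bsub>cmod Z (i - 1)\<^esub> k i y))"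
  have d: "chain_map R Y (fib_cpx X Z s) d"
    by (rule chain_mapI) (simp_all add: d_def e cpx_ac[OF X] cpx_ac[OF Z])
  define V where "V = fib_cpx Y (fib_cpx X Z s) d"
  have V: "bounded_cpx R V" unfolding V_def by (rule fib_bounded[OF Y F d])
  have t: "chain_map R V Y (\<lambda>i. pfst)" unfolding V_def by (rule fib_proj[OF Y F d])
  have Vs [simp]: "cmod V i = mod_dsum (cmod Y i) (mod_dsum (cmod X (i - 1)) (cmod Z (i - 1 - 1)))" for i
    unfolding V_def by (simp add: fib_simps[OF Y F d])
  have dp: "d i y = Pair (f i y \<oplus>\<^bsub>cmod X i\<^esub> \<ominus>\<^bsub>cmod X i\<^esub> g i y) (\<ominus>\<^bsub>cmod Z (i - 1)\<^esub> k i y)" for i y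
    by (simp add: d_def)
  have Vd: "cdif V i (Pair y p) = Pair (cdif Y i y) 
     (\<ominus>\<^bsub>cmod (fib_cpx X Z s) i\<^esub> d i y \<oplus>\<^bsub>cmod (fib_cpx X Z s) i\<^esub> \<ominus>\<^bsub>cmod (fib_cpx X Z s) i\<^esub> cdif (fib_cpx X Z s) (i - 1) p)"
    if "y \<in> carrier (cmod Y i)" "p \<in> carrier (cmod (fib_cpx X Z s) (i - 1))" for i y p
    unfolding V_def by (rule fib_simps(2)[OF Y F d that])
  have Vd' [simp]: "pfst (psnd (cdif V i (Pair y (Pair x z)))) =
      (\<ominus>\<^bsub>cmod X i\<^esub> f i y \<oplus>\<^bsub>cmod X i\<^esub> g i y) \<oplus>\<^bsub>cmod X i\<^esub> \<ominus>\<^bsub>cmod X i\<^esub> cdif X (i - 1) x"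
    if "y \<in> carrier (cmod Y i)" "x \<in> carrier (cmod X (i - 1))" "z \<in> carrier (cmod Z (i - 1 - 1))" for i x y z
    using that by (simp add: Vd dp)
  have 1: "htpy_maps V X (\<lambda>i p. \<ominus>\<^bsub>cmod X (i - 1)\<^esub> pfst (psnd p))"
    by (rule htpy_mapsI) (auto elim!: mod_dsum_cases)
  have "homotopic R V X (\<lambda>i x. f i (pfst x)) (\<lambda>i x. g i (pfst x))"
    by (rule homotopicI[OF 1]) (auto elim!: mod_dsum_cases simp: cpxD_pred[OF X] cpx_ac[OF X])
  moreover have "cone_cpx V Y (\<lambda>i. pfst) \<in> N"
    using cone_fib_proj_qis[OF Y F d] N_qis[OF cone_bounded[OF V Y t] F] N_unshift[OF N]
    unfolding V_def fib_cpx_def by blast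
  ultimately show ?thesis using V t by blast
qed

theorem cone_arrows_right_fractions: "right_fractions (Kb R) cone_arrows"
proof -
  interpret K: shift_category "Kb R" by (rule Kb_shift_category)
  show ?thesis
  proof
    show "Idt (Kb R) X \<in> cone_arrows" if "X \<in> Ob (Kb R)" for X
      using that N_cone_of_qis[OF _ _ qis_id] chain_map_id by (simp add: htpy_arr_cone_arrows)
  next
    fix \<phi> \<psi> assume *: "\<phi> \<in> cone_arrows" "\<psi> \<in> cone_arrows" "K.arr \<phi>" "K.arr \<psi>" "src \<psi> = tgt \<phi>"
    then obtain X Y Z f g where "\<phi> = htpy_arr X Y f" "\<psi> = htpy_arr Y Z g"
      "bounded_cpx R X" "bounded_cpx R Y" "bounded_cpx R Z" "chain_map R X Y f" "chain_map R Y Z g"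
      by (auto simp: arr_Kb)
    with * show "Cmp (Kb R) \<psi> \<phi> \<in> cone_arrows"
      using N_cone_comp by (simp add: Cmp_htpy_arr htpy_arr_cone_arrows chain_map_comp)
  next
    fix \<sigma> \<phi> assume *: "\<sigma> \<in> cone_arrows" "K.arr \<sigma>" "K.arr \<phi>" "tgt \<phi> = tgt \<sigma>"
    then obtain X Y Z s f where a: "\<sigma> = htpy_arr X Z s" "\<phi> = htpy_arr Y Z f"
      "bounded_cpx R X" "bounded_cpx R Y" "bounded_cpx R Z" "chain_map R X Z s" "chain_map R Y Z f"
      by (auto simp: arr_Kb)
    moreover have "cone_cpx X Z s \<in> N" using * a by (simp add: htpy_arr_cone_arrows)
    ultimately obtain V u t where V: "bounded_cpx R V" "chain_map R V X u" "chain_map R V Y t"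
      "cone_cpx V Y t \<in> N" "homotopic R V Z (\<lambda>i x. s i (u i x)) (\<lambda>i x. f i (t i x))"
      using N_ore by blast
    then have "Cmp (Kb R) \<sigma> (htpy_arr V X u) = Cmp (Kb R) \<phi> (htpy_arr V Y t)"
      using a by (simp add: Cmp_htpy_arr htpy_arr_eq_iff chain_map_comp)
    then show "\<exists>u t. K.arr u \<and> K.arr t \<and> t \<in> cone_arrows \<and> src u = src t \<and> tgt t = src \<phi> \<and> tgt u = src \<sigma> \<and>
        Cmp (Kb R) \<sigma> u = Cmp (Kb R) \<phi> t"
      using a V by (intro exI[of _ "htpy_arr V X u"] exI[of _ "htpy_arr V Y t"]) (auto simp: arr_Kb htpy_arr_cone_arrows)
  next
    fix \<sigma> \<phi> \<psi>
    assume *: "\<sigma> \<in> cone_arrows" "K.arr \<sigma>" "K.arr \<phi>" "K.arr \<psi>" "tgt \<phi> = src \<sigma>" "tgt \<psi> = src \<sigma>"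
      "src \<phi> = src \<psi>" "Cmp (Kb R) \<sigma> \<phi> = Cmp (Kb R) \<sigma> \<psi>"
    then obtain X Y Z s f g where a: "\<sigma> = htpy_arr X Z s" "\<phi> = htpy_arr Y X f" "\<psi> = htpy_arr Y X g"
      "bounded_cpx R X" "bounded_cpx R Y" "bounded_cpx R Z" "chain_map R X Z s" "chain_map R Y X f" "chain_map R Y X g"
      by (auto simp: arr_Kb)
    moreover have "cone_cpx X Z s \<in> N" using * a by (simp add: htpy_arr_cone_arrows)
    moreover have "homotopic R Y Z (\<lambda>i x. s i (f i x)) (\<lambda>i x. s i (g i x))"
      using *(8) a by (simp add: Cmp_htpy_arr htpy_arr_eq_iff chain_map_comp)
    ultimately obtain V t where V: "bounded_cpx R V" "chain_map R V Y t"
      "cone_cpx V Y t \<in> N" "homotopic R V X (\<lambda>i x. f i (t i x)) (\<lambda>i x. g i (t i x))"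
      using N_cancel[of X Y Z s f g] by blast
    then have "Cmp (Kb R) \<phi> (htpy_arr V Y t) = Cmp (Kb R) \<psi> (htpy_arr V Y t)"
      using a by (simp add: Cmp_htpy_arr htpy_arr_eq_iff chain_map_comp)
    then show "\<exists>t. K.arr t \<and> t \<in> cone_arrows \<and> tgt t = src \<psi> \<and> Cmp (Kb R) \<phi> t = Cmp (Kb R) \<psi> t"
      using a V by (intro exI[of _ "htpy_arr V Y t"]) (auto simp: arr_Kb htpy_arr_cone_arrows)
  next
    fix \<sigma> assume *: "\<sigma> \<in> cone_arrows" "K.arr \<sigma>"
    then obtain X Z s where a: "\<sigma> = htpy_arr X Z s" "bounded_cpx R X" "bounded_cpx R Z" "chain_map R X Z s"
      by (auto simp: arr_Kb)
    have "cone_cpx X Z s \<in> N" using * a by (simp add: htpy_arr_cone_arrows)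
    then have "cone_cpx (shift_cpx X) (shift_cpx Z) (\<lambda>i. s (i + 1)) \<in> N"
      using cone_shift_qis[OF a(2-4)] N_shift
        N_qis[OF cone_bounded[OF shift_bounded[OF a(2)] shift_bounded[OF a(3)] chain_map_shift[OF a(4,2,3)]]
          shift_bounded[OF cone_bounded[OF a(2-4)]]] by blast
    then show "ShA (Kb R) \<sigma> \<in> cone_arrows"
      using a by (simp add: ShA_htpy_arr htpy_arr_cone_arrows shift_bounded chain_map_shift)
  qed
qed

end

section \<open>Perfect complexes\<close>

context cring begin

text \<open>One step of the construction of a null-homotopy: if \<open>f d = d k d\<close> then \<open>f - k d\<close> takes
  values in the cycles, hence in the boundaries, of the acyclic complex, and lifts along \<open>d\<close>.\<close>

lemma projective_htpy_step:
  assumes P: "bounded_cpx R P" and A: "bounded_cpx R A" and f: "chain_map R P A f"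
    and ac: "acyclic_cpx R A" and pr: "projective_mod R (cmod P i)"
    and k: "k \<in> mod_homs R (cmod P (i + 1)) (cmod A i)"
    and inv: "\<And>x. x \<in> carrier (cmod P i) \<Longrightarrow> f (i + 1) (cdif P i x) = cdif A i (k (cdif P i x))"
  shows "\<exists>h\<in>mod_homs R (cmod P i) (cmod A (i - 1)). \<forall>x\<in>carrier (cmod P i).
    f i x = cdif A (i - 1) (h x) \<oplus>\<^bsub>cmod A i\<^esub> k (cdif P i x)"
proof -
  note [simp] = cpx_simps[OF P] cpx_simps[OF A] chain_mapD[OF f P A] cpxD_pred[OF A]
    mod_homsD[OF k cpxD(1)[OF P] cpxD(1)[OF A]]
  interpret M: module R "cmod A i" using cpxD(1)[OF A] .
  \<comment> \<open>Projectivity lifts along surjections, so the target of the differential is cut down to its image.\<close>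
  define B where "B = cdif A (i - 1) ` carrier (cmod A (i - 1))"
  have B: "x \<in> B \<longleftrightarrow> boundary A i x" for x by (auto simp: B_def boundary_def)
  have sub: "submodule B R (cmod A i)"
  proof (rule M.submoduleI)
    show "B \<subseteq> carrier (cmod A i)" using boundary_in[OF A] B by blast
    show "\<zero>\<^bsub>cmod A i\<^esub> \<in> B" using boundary_zero[OF A] B by blast
    show "\<ominus>\<^bsub>cmod A i\<^esub> x \<in> B" if "x \<in> B" for x using that boundary_minus[OF A] B by blast
    show "x \<oplus>\<^bsub>cmod A i\<^esub> y \<in> B" if "x \<in> B" "y \<in> B" for x y using that boundary_add[OF A] B by blast
    show "a \<odot>\<^bsub>cmod A i\<^esub> x \<in> B" if a: "a \<in> carrier R" and x: "x \<in> B" for a x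
    proof -
      obtain y where y: "y \<in> carrier (cmod A (i - 1))" "x = cdif A (i - 1) y" using x by (auto simp: B_def)
      show ?thesis unfolding B_def
        by (rule image_eqI[of _ _ "a \<odot>\<^bsub>cmod A (i - 1)\<^esub> y"]) (use a y in simp_all)
    qed
  qed
  define N where "N = (cmod A i)\<lparr>carrier := B\<rparr>"
  have N: "module R N" unfolding N_def by (rule submodule.submodule_is_module[OF sub cpxD(1)[OF A]])
  have Nc: "carrier N = B" "add N = add (cmod A i)" "smult N = smult (cmod A i)" by (simp_all add: N_def)
  let ?q = "\<lambda>x. f i x \<oplus>\<^bsub>cmod A i\<^esub> \<ominus>\<^bsub>cmod A i\<^esub> k (cdif P i x)"
  have qB: "?q x \<in> B" if x: "x \<in> carrier (cmod P i)" for x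
  proof -
    have "cycle A i (?q x)" using x inv[OF x] by (simp add: cycle_def)
    then show ?thesis using ac by (simp add: B acyclic_iff)
  qed
  have q: "?q \<in> mod_homs R (cmod P i) N"
    by (rule mod_homsI) (simp_all add: Nc qB, simp_all add: cpx_ac[OF A])
  have d: "cdif A (i - 1) \<in> mod_homs R (cmod A (i - 1)) N"
    by (rule mod_homsI) (simp_all add: Nc B_def)
  have im: "cdif A (i - 1) ` carrier (cmod A (i - 1)) = carrier N" by (simp add: Nc B_def)
  from projective_lift[OF pr cpxD(1)[OF A] N d im q]
  obtain h where h: "h \<in> mod_homs R (cmod P i) (cmod A (i - 1))"
    and "\<forall>x\<in>carrier (cmod P i). cdif A (i - 1) (h x) = ?q x" ..
  then have hq: "cdif A (i - 1) (h x) = ?q x" if "x \<in> carrier (cmod P i)" for x using that by blast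
  show ?thesis
    by (rule bexI[OF _ h]) (simp add: hq cpx_ac[OF A])
qed

text \<open>The homotopy is built by descending recursion on the degree, starting above the top degree of \<open>P\<close>,
  where it is zero.\<close>

lemma projective_null_homotopic:
  assumes P: "bounded_cpx R P" and A: "bounded_cpx R A" and f: "chain_map R P A f"
    and ac: "acyclic_cpx R A" and pr: "\<And>i. projective_mod R (cmod P i)"
  shows "homotopic R P A f (\<lambda>i x. \<zero>\<^bsub>cmod A i\<^esub>)"
proof -
  note [simp] = cpx_simps[OF P] cpx_simps[OF A] chain_mapD[OF f P A] cpxD_pred[OF A]
  obtain m where m: "\<And>i. i > m \<Longrightarrow> carrier (cmod P i) = {\<zero>\<^bsub>cmod P i\<^esub>}"
  proof -
    obtain m where "\<forall>i\<in>{i. carrier (cmod P i) \<noteq> {\<zero>\<^bsub>cmod P i\<^esub>}}. i \<le> m"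
      using cpxD(10)[OF P] bdd_above_finite unfolding bdd_above_def by blast
    then show ?thesis by (intro that[of m]) force
  qed
  \<comment> \<open>Step \<open>n\<close> of the recursion concerns the degree \<open>?d n\<close>; \<open>?I\<close> is the invariant that the next step
    needs and \<open>?S\<close> the homotopy equation that relates consecutive steps.\<close>
  let ?d = "\<lambda>n. m + 1 - int n"
  let ?hom = "\<lambda>n h. h \<in> mod_homs R (cmod P (?d n)) (cmod A (?d n - 1))"
  let ?I = "\<lambda>n h. ?hom n h \<and> (\<forall>x\<in>carrier (cmod P (?d n - 1)).
      f (?d n) (cdif P (?d n - 1) x) = cdif A (?d n - 1) (h (cdif P (?d n - 1) x)))"
  let ?S = "\<lambda>n k h. \<forall>x\<in>carrier (cmod P (?d n - 1)).
      f (?d n - 1) x = cdif A (?d n - 1 - 1) (h x) \<oplus>\<^bsub>cmod A (?d n - 1)\<^esub> k (cdif P (?d n - 1) x)"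
  have ds: "?d (Suc n) = ?d n - 1" for n by simp
  have "\<exists>H. \<forall>n. ?I n (H n) \<and> ?S n (H n) (H (Suc n))"
  proof (rule dependent_nat_choice)
    have "(\<lambda>x. \<zero>\<^bsub>cmod A m\<^esub>) \<in> mod_homs R (cmod P (m + 1)) (cmod A m)" by (rule mod_homsI) simp_all
    moreover have "cdif P m x = \<zero>\<^bsub>cmod P (m + 1)\<^esub>" if "x \<in> carrier (cmod P m)" for x
      using m[of "m + 1"] cpxD(4)[OF P that, of "m + 1"] by simp
    ultimately show "\<exists>h. ?I 0 h" by (intro exI[of _ "\<lambda>x. \<zero>\<^bsub>cmod A m\<^esub>"]) simp
  next
    fix k n assume k: "?I n k"
    define i where "i = ?d n - 1"
    have i: "?d n = i + 1" by (simp add: i_def)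
    have k': "k \<in> mod_homs R (cmod P (i + 1)) (cmod A i)"
      "\<And>x. x \<in> carrier (cmod P i) \<Longrightarrow> f (i + 1) (cdif P i x) = cdif A i (k (cdif P i x))"
      using k by (simp_all add: i)
    note [simp] = mod_homsD[OF k'(1) cpxD(1)[OF P] cpxD(1)[OF A]]
    obtain h where h: "h \<in> mod_homs R (cmod P i) (cmod A (i - 1))"
      "\<And>x. x \<in> carrier (cmod P i) \<Longrightarrow> f i x = cdif A (i - 1) (h x) \<oplus>\<^bsub>cmod A i\<^esub> k (cdif P i x)"
      using projective_htpy_step[OF P A f ac pr k'] by blast
    note [simp] = mod_homsD[OF h(1) cpxD(1)[OF P] cpxD(1)[OF A]]
    have hI: "f i (cdif P (i - 1) x) = cdif A (i - 1) (h (cdif P (i - 1) x))"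
      if "x \<in> carrier (cmod P (i - 1))" for x using that by (simp add: h(2))
    show "\<exists>h. ?I (Suc n) h \<and> ?S n k h"
      unfolding ds i add_diff_cancel_right' by (rule exI[of _ h]) (intro conjI ballI h hI)
  qed
  then obtain H where HH: "\<forall>n. ?I n (H n) \<and> ?S n (H n) (H (Suc n))" ..
  note H = HH[THEN spec, THEN conjunct1] HH[THEN spec, THEN conjunct2]
  define h where "h = (\<lambda>i x. if i \<le> m + 1 then H (nat (m + 1 - i)) x else \<zero>\<^bsub>cmod A (i - 1)\<^esub>)"
  have hm: "htpy_maps P A h" unfolding htpy_maps_def
  proof
    fix i show "h i \<in> mod_homs R (cmod P i) (cmod A (i - 1))"
    proof (cases "i \<le> m + 1")
      case True
      then have "?d (nat (m + 1 - i)) = i" by simp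
      then show ?thesis using H(1)[of "nat (m + 1 - i)"] True by (simp add: h_def)
    next
      case False
      then show ?thesis by (auto simp: h_def intro!: mod_homsI)
    qed
  qed
  note [simp] = htpy_mapsD[OF hm P A]
  show ?thesis
  proof (rule homotopicI[OF hm])
    fix i x assume x: "x \<in> carrier (cmod P i)"
    show "f i x = \<zero>\<^bsub>cmod A i\<^esub> \<oplus>\<^bsub>cmod A i\<^esub> (cdif A (i - 1) (h i x) \<oplus>\<^bsub>cmod A i\<^esub> h (i + 1) (cdif P i x))"
    proof (cases "i \<le> m")
      case True
      define n where "n = nat (m - i)"
      have n: "?d n = i + 1" "nat (m + 1 - i) = Suc n" "nat (m + 1 - (i + 1)) = n"
        using True by (simp_all add: n_def)
      have "h i = H (Suc n)" "h (i + 1) = H n" using True n by (simp_all add: h_def)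
      then have "f i x = cdif A (i - 1) (h i x) \<oplus>\<^bsub>cmod A i\<^esub> h (i + 1) (cdif P i x)"
        using H(2)[of n] x unfolding n by simp
      then show ?thesis using x by simp
    next
      case False
      then have "x = \<zero>\<^bsub>cmod P i\<^esub>" using m[of i] x by auto
      then show ?thesis using htpy_mapsD(4)[OF hm P A, of "i + 1"] by simp
    qed
  qed
qed

text \<open>A null-homotopy of \<open>P \<rightarrow> Y \<rightarrow> cone t\<close> has two components: the first is a chain map \<open>P \<rightarrow> X\<close>, the
  second a homotopy that makes it a lift.\<close>

lemma projective_lift_qis:
  assumes P: "bounded_cpx R P" and X: "bounded_cpx R X" and Y: "bounded_cpx R Y"
    and pr: "\<And>i. projective_mod R (cmod P i)" and t: "qis X Y t" and s: "chain_map R P Y s"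
  shows "\<exists>a. chain_map R P X a \<and> homotopic R P Y s (\<lambda>i x. t i (a i x))"
proof -
  have tc: "chain_map R X Y t" using t by (simp add: qis_def)
  have C: "bounded_cpx R (cone_cpx X Y t)" by (rule cone_bounded[OF X Y tc])
  have c: "chain_map R P (cone_cpx X Y t) (\<lambda>i p. Pair \<zero>\<^bsub>cmod X (i + 1)\<^esub> (s i p))"
    using chain_map_comp[OF s cone_incl[OF X Y tc] P Y C] .
  have "homotopic R P (cone_cpx X Y t) (\<lambda>i p. Pair \<zero>\<^bsub>cmod X (i + 1)\<^esub> (s i p)) (\<lambda>i x. \<zero>\<^bsub>cmod (cone_cpx X Y t) i\<^esub>)"
    by (rule projective_null_homotopic[OF P C c _ pr]) (use t cone_acyclic_iff[OF X Y tc] in simp)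
  then obtain h where h: "htpy_maps P (cone_cpx X Y t) h"
    and e: "\<And>i x. x \<in> carrier (cmod P i) \<Longrightarrow> Pair \<zero>\<^bsub>cmod X (i + 1)\<^esub> (s i x) =
      \<zero>\<^bsub>cmod (cone_cpx X Y t) i\<^esub> \<oplus>\<^bsub>cmod (cone_cpx X Y t) i\<^esub> (cdif (cone_cpx X Y t) (i - 1) (h i x)
       \<oplus>\<^bsub>cmod (cone_cpx X Y t) i\<^esub> h (i + 1) (cdif P i x))"
    by (rule homotopicE) blast
  define a b where "a = (\<lambda>i x. pfst (h i x))" and "b = (\<lambda>i x. psnd (h i x))"
  note [simp] = cpx_simps[OF P] cpx_simps[OF X] cpx_simps[OF Y] chain_mapD[OF tc X Y] chain_mapD[OF s P Y]
    cpxD_pred[OF X] cpxD_pred[OF Y]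
  have hab: "h i x = Pair (a i x) (b i x)" "a i x \<in> carrier (cmod X i)" "b i x \<in> carrier (cmod Y (i - 1))"
    if "x \<in> carrier (cmod P i)" for i x
    using htpy_mapsD(1)[OF h P C that refl] by (auto simp: a_def b_def elim!: mod_dsum_cases)
  have add: "a i (x \<oplus>\<^bsub>cmod P i\<^esub> y) = a i x \<oplus>\<^bsub>cmod X i\<^esub> a i y" "b i (x \<oplus>\<^bsub>cmod P i\<^esub> y) = b i x \<oplus>\<^bsub>cmod Y (i - 1)\<^esub> b i y"
    if "x \<in> carrier (cmod P i)" "y \<in> carrier (cmod P i)" for i x y
    using htpy_mapsD(2)[OF h P C that] that hab[of _ i] by simp_all
  have smu: "a i (c \<odot>\<^bsub>cmod P i\<^esub> x) = c \<odot>\<^bsub>cmod X i\<^esub> a i x" "b i (c \<odot>\<^bsub>cmod P i\<^esub> x) = c \<odot>\<^bsub>cmod Y (i - 1)\<^esub> b i x"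
    if "c \<in> carrier R" "x \<in> carrier (cmod P i)" for i x c
    using htpy_mapsD(3)[OF h P C that] that hab[of _ i] by simp_all
  have e1: "\<zero>\<^bsub>cmod X (i + 1)\<^esub> = \<ominus>\<^bsub>cmod X (i + 1)\<^esub> cdif X i (a i x) \<oplus>\<^bsub>cmod X (i + 1)\<^esub> a (i + 1) (cdif P i x)"
    and e2: "s i x = t i (a i x) \<oplus>\<^bsub>cmod Y i\<^esub> cdif Y (i - 1) (b i x) \<oplus>\<^bsub>cmod Y i\<^esub> b (i + 1) (cdif P i x)"
    if x: "x \<in> carrier (cmod P i)" for i x
  proof -
    note h1 = hab[OF x] and h2 = hab[OF cpxD(4)[OF P x refl]]
    show "\<zero>\<^bsub>cmod X (i + 1)\<^esub> = \<ominus>\<^bsub>cmod X (i + 1)\<^esub> cdif X i (a i x) \<oplus>\<^bsub>cmod X (i + 1)\<^esub> a (i + 1) (cdif P i x)"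
      and "s i x = t i (a i x) \<oplus>\<^bsub>cmod Y i\<^esub> cdif Y (i - 1) (b i x) \<oplus>\<^bsub>cmod Y i\<^esub> b (i + 1) (cdif P i x)"
      using e[OF x] h1 h2 by simp_all
  qed
  have ac: "chain_map R P X a"
  proof (rule chain_mapI)
    fix i x assume x: "x \<in> carrier (cmod P i)"
    have "cdif X i (a i x) \<oplus>\<^bsub>cmod X (i + 1)\<^esub> \<zero>\<^bsub>cmod X (i + 1)\<^esub> = a (i + 1) (cdif P i x)"
      unfolding e1[OF x] using x hab(2) by (simp add: cpx_ac[OF X])
    then show "cdif X i (a i x) = a (i + 1) (cdif P i x)" using x hab(2) by simp
  qed (use hab add smu in simp_all)
  have bh: "htpy_maps P Y b" by (rule htpy_mapsI) (use hab add smu in simp_all)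
  have "homotopic R P Y s (\<lambda>i x. t i (a i x))"
    by (rule homotopicI[OF bh]) (use e2 hab htpy_mapsD(1)[OF bh P Y] in \<open>simp add: cpx_ac[OF Y]\<close>)
  with ac show ?thesis by blast
qed

definition perfect_cpx :: "'a cpx \<Rightarrow> bool" where
  "perfect_cpx X \<longleftrightarrow> bounded_cpx R X \<and>
     (\<exists>P \<theta>. bounded_cpx R P \<and> (\<forall>i. projective_mod R (cmod P i)) \<and> qis P X \<theta>)"

lemma unshift_qis:
  assumes X: "bounded_cpx R X" and Y: "bounded_cpx R Y" and f: "qis X Y f"
  shows "qis (unshift_cpx X) (unshift_cpx Y) (\<lambda>i. f (i - 1))"
proof -
  have fc: "chain_map R X Y f" using f by (simp add: qis_def)
  note [simp] = cpx_simps[OF X] cpx_simps[OF Y] chain_mapD[OF fc X Y] 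
    cpxD_pred[OF X] cpxD_pred[OF Y]
  have cm: "chain_map R (unshift_cpx X) (unshift_cpx Y) (\<lambda>i. f (i - 1))"
    by (rule chain_mapI) (simp_all add: chain_mapD[OF fc X Y, where i = "_ - 1", simplified])
  have cy: "cycle (unshift_cpx Z) i x \<longleftrightarrow> cycle Z (i - 1) x" if Z: "bounded_cpx R Z" for Z i x
  proof -
    note [simp] = cpx_simps[OF Z]
    show ?thesis by (auto simp: cycle_def)
  qed
  have bo: "boundary (unshift_cpx Z) i x \<longleftrightarrow> boundary Z (i - 1) x" if Z: "bounded_cpx R Z" for Z i x
  proof -
    note [simp] = cpx_simps[OF Z] cpxD_pred[OF Z, where i = "i - 1"]
    have "boundary Z (i - 1) x \<longleftrightarrow> boundary Z (i - 1) (\<ominus>\<^bsub>cmod Z (i - 1)\<^esub> x)" if "x \<in> carrier (cmod Z (i - 1))"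
      using boundary_minus[OF Z, of "i - 1" x] boundary_minus[OF Z, of "i - 1" "\<ominus>\<^bsub>cmod Z (i - 1)\<^esub> x"] that by auto
    moreover have "boundary (unshift_cpx Z) i x \<longleftrightarrow> boundary Z (i - 1) (\<ominus>\<^bsub>cmod Z (i - 1)\<^esub> x)"
      if x: "x \<in> carrier (cmod Z (i - 1))"
    proof -
      have "x = \<ominus>\<^bsub>cmod Z (i - 1)\<^esub> v \<longleftrightarrow> \<ominus>\<^bsub>cmod Z (i - 1)\<^esub> x = v" if "v \<in> carrier (cmod Z (i - 1))" for v
        using x that module_simps(9)[OF cpxD(1)[OF Z], of _ "i - 1"] by metis
      then show ?thesis unfolding boundary_def by (auto 0 3)
    qed
    moreover have "boundary (unshift_cpx Z) i x \<Longrightarrow> x \<in> carrier (cmod Z (i - 1))"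
      using boundary_in[OF unshift_bounded[OF Z]] by simp
    ultimately show ?thesis using boundary_in[OF Z] by blast
  qed
  show ?thesis
    using f cm unfolding qis_def hinj_def hsurj_def cy[OF X] cy[OF Y] bo[OF X] bo[OF Y] unshift_simps
    by blast
qed

lemma shift_qis:
  assumes X: "bounded_cpx R X" and Y: "bounded_cpx R Y" and f: "qis X Y f"
  shows "qis (shift_cpx X) (shift_cpx Y) (\<lambda>i. f (i + 1))"
proof -
  have fc: "chain_map R X Y f" using f by (simp add: qis_def)
  have cy: "cycle (shift_cpx Z) i x \<longleftrightarrow> cycle Z (i + 1) x" if Z: "bounded_cpx R Z" for Z i x
  proof -
    note [simp] = cpx_simps[OF Z]
    show ?thesis by (auto simp: cycle_def)
  qed
  have bo: "boundary (shift_cpx Z) i x \<longleftrightarrow> boundary Z (i + 1) x" if Z: "bounded_cpx R Z" for Z i x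
  proof -
    note [simp] = cpx_simps[OF Z] 
    have "boundary Z (i + 1) x \<longleftrightarrow> boundary Z (i + 1) (\<ominus>\<^bsub>cmod Z (i + 1)\<^esub> x)" if "x \<in> carrier (cmod Z (i + 1))"
      using boundary_minus[OF Z, of "i + 1" x] boundary_minus[OF Z, of "i + 1" "\<ominus>\<^bsub>cmod Z (i + 1)\<^esub> x"] that by auto
    moreover have "boundary (shift_cpx Z) i x \<longleftrightarrow> boundary Z (i + 1) (\<ominus>\<^bsub>cmod Z (i + 1)\<^esub> x)"
      if x: "x \<in> carrier (cmod Z (i + 1))"
    proof -
      have "x = \<ominus>\<^bsub>cmod Z (i + 1)\<^esub> v \<longleftrightarrow> \<ominus>\<^bsub>cmod Z (i + 1)\<^esub> x = v" if "v \<in> carrier (cmod Z (i + 1))" for v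
        using x that module_simps(9)[OF cpxD(1)[OF Z], of _ "i + 1"] by metis
      then show ?thesis unfolding boundary_def by (auto 0 3)
    qed
    moreover have "boundary (shift_cpx Z) i x \<Longrightarrow> x \<in> carrier (cmod Z (i + 1))"
      using boundary_in[OF shift_bounded[OF Z]] by simp
    ultimately show ?thesis using boundary_in[OF Z] by blast
  qed
  show ?thesis
    using f chain_map_shift[OF fc X Y] unfolding qis_def hinj_def hsurj_def cy[OF X] cy[OF Y] bo[OF X] bo[OF Y] shift_simps
    by blast
qed

definition zero_mod :: "('a, 'a mel) module" where
  "zero_mod = \<lparr>carrier = {Coset {}}, mult = undefined, one = undefined, zero = Coset {},
     add = (\<lambda>x y. Coset {}), smult = (\<lambda>a x. Coset {})\<rparr>"

lemma zero_mod_simps [simp]: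
  "carrier zero_mod = {Coset {}}" "\<zero>\<^bsub>zero_mod\<^esub> = Coset {}" "x \<oplus>\<^bsub>zero_mod\<^esub> y = Coset {}"
  "a \<odot>\<^bsub>zero_mod\<^esub> x = Coset {}"
  by (simp_all add: zero_mod_def)

lemma zero_mod_module: "module R zero_mod"
  by (rule moduleI, rule is_cring, rule abelian_groupI) simp_all

definition zero_cpx :: "'a cpx" where
  "zero_cpx = \<lparr>cmod = (\<lambda>i. zero_mod), cdif = (\<lambda>i x. Coset {})\<rparr>"

lemma zero_cpx_simps [simp]: "cmod zero_cpx i = zero_mod" "cdif zero_cpx i x = Coset {}"
  by (simp_all add: zero_cpx_def)

lemma zero_cpx_bounded: "bounded_cpx R zero_cpx"
proof (rule bounded_cpxI)
  interpret Z: module R zero_mod by (rule zero_mod_module)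
  show "fin_gen R (cmod zero_cpx i)" for i
    unfolding fin_gen_def
  proof (intro exI[of _ "{}"] conjI allI impI)
    fix N assume "submodule N R (cmod zero_cpx i) \<and> {} \<subseteq> N"
    then have N: "submodule N R zero_mod" by simp
    then have "Coset {} \<in> N" using subgroup.one_closed[OF submodule.axioms(1)[OF N]] by simp
    then show "N = carrier (cmod zero_cpx i)" using Z.submoduleE(1)[OF N] by auto
  qed simp_all
qed (auto intro!: mod_homsI zero_mod_module)

lemma zero_cpx_projective: "projective_mod R (cmod zero_cpx i)"
  unfolding projective_mod_def
proof (intro allI impI, elim conjE)
  fix M N :: "('a, 'a mel) module" and g f
  assume M: "module R M" and N: "module R N" and g: "g \<in> mod_homs R M N" and f: "f \<in> mod_homs R (cmod zero_cpx i) N"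
  have "(\<lambda>x. \<zero>\<^bsub>M\<^esub>) \<in> mod_homs R (cmod zero_cpx i) M"
    by (rule mod_homsI) (simp_all add: module_simps[OF M])
  moreover have "\<forall>x\<in>carrier (cmod zero_cpx i). g \<zero>\<^bsub>M\<^esub> = f x"
    using mod_homsD(4)[OF g M N] mod_homsD(4)[OF f _ N] zero_mod_module by simp
  ultimately show "\<exists>h\<in>mod_homs R (cmod zero_cpx i) M. \<forall>x\<in>carrier (cmod zero_cpx i). g (h x) = f x"
    by (intro bexI[of _ "\<lambda>x. \<zero>\<^bsub>M\<^esub>"])
qed

text \<open>Stability under shifts holds because an acyclic complex is quasi-isomorphic to the zero complex.\<close>

lemma Acyc_cone_class: "cone_class R (Acyc R)"
proof
  fix X Y f
  show "X \<in> Acyc R \<Longrightarrow> bounded_cpx R X" by (simp add: Acyc_def)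
  show "bounded_cpx R X \<Longrightarrow> acyclic_cpx R X \<Longrightarrow> X \<in> Acyc R" by (simp add: Acyc_def)
  show q: "bounded_cpx R X \<Longrightarrow> bounded_cpx R Y \<Longrightarrow> qis X Y f \<Longrightarrow> X \<in> Acyc R \<longleftrightarrow> Y \<in> Acyc R" for X Y f
    using qis_acyclic by (simp add: Acyc_def)
  show "X \<in> Acyc R \<Longrightarrow> Y \<in> Acyc R \<Longrightarrow> chain_map R X Y f \<Longrightarrow> cone_cpx X Y f \<in> Acyc R"
    using qis_of_acyclic cone_acyclic_iff cone_bounded by (simp add: Acyc_def)
  have z: "bounded_cpx R zero_cpx" "acyclic_cpx R zero_cpx"
    using zero_cpx_bounded by (simp_all add: acyclic_cpx_def)
  have z2: "acyclic_cpx R (shift_cpx zero_cpx)" "acyclic_cpx R (unshift_cpx zero_cpx)"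
    using module_simps(10)[OF zero_mod_module] by (simp_all add: acyclic_cpx_def)
  have zq: "qis zero_cpx X (\<lambda>i x. \<zero>\<^bsub>cmod X i\<^esub>)" if "X \<in> Acyc R" for X
    using that qis_of_acyclic[OF z(1) _ chain_map_zero z(2)] z by (simp add: Acyc_def)
  show "shift_cpx X \<in> Acyc R" if X: "X \<in> Acyc R"
    using q[OF _ _ shift_qis[OF z(1) _ zq[OF X]]] X z z2 shift_bounded by (simp add: Acyc_def)
  show "unshift_cpx X \<in> Acyc R" if X: "X \<in> Acyc R"
    using q[OF _ _ unshift_qis[OF z(1) _ zq[OF X]]] X z z2 unshift_bounded by (simp add: Acyc_def)
qed

text \<open>Resolutions by bounded complexes of projectives lift along quasi-isomorphisms, which gives stability
  under quasi-isomorphisms in the backward direction; and they lift along any chain map up to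
  homotopy, so that the cone of the lift resolves the cone.\<close>

lemma perfect_cone_class: "cone_class R {X. perfect_cpx X}"
proof
  fix X Y f
  show "X \<in> {X. perfect_cpx X} \<Longrightarrow> bounded_cpx R X" by (simp add: perfect_cpx_def)
  show "X \<in> {X. perfect_cpx X} \<longleftrightarrow> Y \<in> {X. perfect_cpx X}"
    if X: "bounded_cpx R X" and Y: "bounded_cpx R Y" and q: "qis X Y f"
  proof -
    have "perfect_cpx Y" if "perfect_cpx X"
      using that qis_comp[OF _ X Y _ q] Y unfolding perfect_cpx_def by blast
    moreover have "perfect_cpx X" if pY: "perfect_cpx Y"
    proof -
      obtain P s where P: "bounded_cpx R P" "\<forall>i. projective_mod R (cmod P i)" and s: "qis P Y s"
        using pY unfolding perfect_cpx_def by blast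
      have sc: "chain_map R P Y s" and qc: "chain_map R X Y f" using s q by (auto simp: qis_def)
      obtain a where a: "chain_map R P X a" "homotopic R P Y s (\<lambda>i x. f i (a i x))"
        using projective_lift_qis[OF P(1) X Y _ q sc] P(2) by blast
      have "qis P Y (\<lambda>i x. f i (a i x))"
        by (rule qis_homotopic[OF P(1) Y chain_map_comp[OF a(1) qc P(1) X Y] a(2) s])
      then have "qis P X a"
        using hinj_cancel[OF P(1) X Y qc] hsurj_cancel_hinj[OF P(1) X Y a(1) qc] q a(1) by (auto simp: qis_def)
      then show ?thesis using P X unfolding perfect_cpx_def by blast
    qed
    ultimately show ?thesis by auto
  qed
  show "cone_cpx X Y f \<in> {X. perfect_cpx X}"
    if pXY: "X \<in> {X. perfect_cpx X}" "Y \<in> {X. perfect_cpx X}" and f: "chain_map R X Y f"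
  proof -
    obtain P s P' s' where P: "bounded_cpx R P" "\<forall>i. projective_mod R (cmod P i)" and s: "qis P X s"
      and P': "bounded_cpx R P'" "\<forall>i. projective_mod R (cmod P' i)" and s': "qis P' Y s'"
      and X: "bounded_cpx R X" and Y: "bounded_cpx R Y"
      using pXY unfolding perfect_cpx_def by blast
    have sc: "chain_map R P X s" "chain_map R P' Y s'" using s s' by (auto simp: qis_def)
    have fs: "chain_map R P Y (\<lambda>i x. f i (s i x))" by (rule chain_map_comp[OF sc(1) f P(1) X Y])
    obtain a where a: "chain_map R P P' a" and h: "homotopic R P Y (\<lambda>i x. f i (s i x)) (\<lambda>i x. s' i (a i x))"
      using projective_lift_qis[OF P(1) P'(1) Y _ s' fs] P(2) by blast
    have sa: "chain_map R P Y (\<lambda>i x. s' i (a i x))" by (rule chain_map_comp[OF a sc(2) P(1) P'(1) Y])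
    have 1: "qis (cone_cpx P P' a) (cone_cpx P Y (\<lambda>i x. s' i (a i x))) (cone_map (\<lambda>i x. x) s')"
      by (rule cone_map_qis) (use P P' Y a sa s' qis_id in auto)
    obtain \<theta> where 2: "qis (cone_cpx P Y (\<lambda>i x. s' i (a i x))) (cone_cpx P Y (\<lambda>i x. f i (s i x))) \<theta>"
      using cone_homotopic_qis[OF P(1) Y sa fs homotopic_sym[OF P(1) Y sa h]] by blast
    have 3: "qis (cone_cpx P Y (\<lambda>i x. f i (s i x))) (cone_cpx X Y f) (cone_map s (\<lambda>i x. x))"
      by (rule cone_map_qis) (use P X Y f fs s qis_id in auto)
    note bd = cone_bounded[OF P(1) P'(1) a] cone_bounded[OF P(1) Y sa] cone_bounded[OF P(1) Y fs] cone_bounded[OF X Y f]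
    have "\<exists>\<theta>. qis (cone_cpx P P' a) (cone_cpx X Y f) \<theta>"
      using qis_comp[OF bd(1,2,4) 1 qis_comp[OF bd(2-4) 2 3]] by blast
    moreover have "\<forall>i. projective_mod R (cmod (cone_cpx P P' a) i)"
      using P P' cpxD(1)[OF P(1)] cpxD(1)[OF P'(1)] by (simp add: mod_dsum_projective)
    ultimately show ?thesis using bd unfolding perfect_cpx_def by blast
  qed
  show "shift_cpx X \<in> {X. perfect_cpx X}" if "X \<in> {X. perfect_cpx X}"
    using that shift_qis shift_bounded unfolding perfect_cpx_def mem_Collect_eq
    by (metis shift_simps(1))
  show "unshift_cpx X \<in> {X. perfect_cpx X}" if "X \<in> {X. perfect_cpx X}"
    using that unshift_qis unshift_bounded unfolding perfect_cpx_def mem_Collect_eq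
    by (metis unshift_simps(1))
  show "X \<in> {X. perfect_cpx X}" if X: "bounded_cpx R X" "acyclic_cpx R X"
  proof -
    have "acyclic_cpx R zero_cpx" by (simp add: acyclic_cpx_def)
    then have "qis zero_cpx X (\<lambda>i x. \<zero>\<^bsub>cmod X i\<^esub>)"
      using qis_of_acyclic[OF zero_cpx_bounded X(1) chain_map_zero[OF zero_cpx_bounded X(1)]] X by simp
    then show ?thesis using zero_cpx_bounded zero_cpx_projective X unfolding perfect_cpx_def by blast
  qed
qed

end

section \<open>The derived category\<close>

context cring begin

text \<open>For arrows of the homotopy category, on which equations hold on the nose rather than up to
  homotopy.\<close>

definition hinj_arr :: "('a cpx, (int \<Rightarrow> 'a mel \<Rightarrow> 'a mel) set) arr \<Rightarrow> bool" where
  "hinj_arr \<phi> \<longleftrightarrow> (\<exists>X Y f. \<phi> = htpy_arr X Y f \<and> bounded_cpx R X \<and> bounded_cpx R Y \<and> chain_map R X Y f \<and> hinj X Y f)"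

definition hsurj_arr :: "('a cpx, (int \<Rightarrow> 'a mel \<Rightarrow> 'a mel) set) arr \<Rightarrow> bool" where
  "hsurj_arr \<phi> \<longleftrightarrow> (\<exists>X Y f. \<phi> = htpy_arr X Y f \<and> bounded_cpx R X \<and> bounded_cpx R Y \<and> chain_map R X Y f \<and> hsurj X Y f)"

lemma htpy_arr_same_ends: "htpy_arr X Y f = htpy_arr X' Y' g \<Longrightarrow> X' = X \<and> Y' = Y"
  by (simp add: htpy_arr_def)

lemma hinj_arr_htpy_arr [simp]:
  assumes "bounded_cpx R X" "bounded_cpx R Y" "chain_map R X Y f"
  shows "hinj_arr (htpy_arr X Y f) \<longleftrightarrow> hinj X Y f"
proof
  assume "hinj_arr (htpy_arr X Y f)"
  then obtain X' Y' g where g: "htpy_arr X Y f = htpy_arr X' Y' g" "chain_map R X' Y' g" "hinj X' Y' g"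
    unfolding hinj_arr_def by blast
  then have e: "X' = X" "Y' = Y" using htpy_arr_same_ends by auto
  have "homotopic R X Y g f" using g htpy_arr_eq_iff[OF assms(1,2)] assms(3) unfolding e by metis
  then show "hinj X Y f" using hinj_homotopic[OF assms(1,2) _ assms(3)] g unfolding e by blast
qed (use assms in \<open>auto simp: hinj_arr_def\<close>)

lemma hsurj_arr_htpy_arr [simp]:
  assumes "bounded_cpx R X" "bounded_cpx R Y" "chain_map R X Y f"
  shows "hsurj_arr (htpy_arr X Y f) \<longleftrightarrow> hsurj X Y f"
proof
  assume "hsurj_arr (htpy_arr X Y f)"
  then obtain X' Y' g where g: "htpy_arr X Y f = htpy_arr X' Y' g" "chain_map R X' Y' g" "hsurj X' Y' g"
    unfolding hsurj_arr_def by blast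
  then have e: "X' = X" "Y' = Y" using htpy_arr_same_ends by auto
  have "homotopic R X Y g f" using g htpy_arr_eq_iff[OF assms(1,2)] assms(3) unfolding e by metis
  then show "hsurj X Y f" using hsurj_homotopic[OF assms(1,2) _ assms(3)] g unfolding e by blast
qed (use assms in \<open>auto simp: hsurj_arr_def\<close>)

end

text \<open>The prefixes stand for the categories and classes in play: \<open>K\<close> for the homotopy category, \<open>A\<close> and \<open>P\<close>
  for the acyclic and the perfect complexes, \<open>V\<close> for the localisation with quotient the derived
  category, \<open>T\<close> for the two-step localisation, and \<open>S\<close> for the second step, with quotient the
  singularity category.\<close>

locale derived_cring = cring R for R :: "('a, 'b) ring_scheme" (structure)
begin

sublocale A: cone_class R "Acyc R" by (rule Acyc_cone_class)
sublocale P: cone_class R "{X. perfect_cpx X}" by (rule perfect_cone_class)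
sublocale K: shift_category "Kb R" by (rule Kb_shift_category)

lemma arr_htpy_arr [simp]:
  "bounded_cpx R X \<Longrightarrow> bounded_cpx R Y \<Longrightarrow> chain_map R X Y f \<Longrightarrow> K.arr (htpy_arr X Y f)"
  by (auto simp: arr_Kb)

lemma arr_KbE:
  assumes "K.arr \<phi>"
  obtains f where "\<phi> = htpy_arr (src \<phi>) (tgt \<phi>) f" "bounded_cpx R (src \<phi>)" "bounded_cpx R (tgt \<phi>)"
    "chain_map R (src \<phi>) (tgt \<phi>) f"
  using assms by (auto simp: arr_Kb)

lemma qis_arr:
  assumes "K.arr \<phi>" shows "\<phi> \<in> A.cone_arrows \<longleftrightarrow> hinj_arr \<phi> \<and> hsurj_arr \<phi>"
proof -
  obtain X Y f where f: "\<phi> = htpy_arr X Y f" "bounded_cpx R X" "bounded_cpx R Y" "chain_map R X Y f"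
    using assms by (auto simp: arr_Kb)
  then show ?thesis
    using A.htpy_arr_cone_arrows[OF f(2-4)] cone_acyclic_iff[OF f(2-4)] cone_bounded[OF f(2-4)]
    by (simp add: Acyc_def qis_def)
qed

lemma htpy_arr_qis_arr:
  "bounded_cpx R X \<Longrightarrow> bounded_cpx R Y \<Longrightarrow> chain_map R X Y f \<Longrightarrow> htpy_arr X Y f \<in> A.cone_arrows \<longleftrightarrow> qis X Y f"
  using qis_arr[of "htpy_arr X Y f"] by (simp add: qis_def)

lemma hinj_arr_comp_iff:
  assumes "K.arr \<phi>" "K.arr \<psi>" "src \<psi> = tgt \<phi>"
  shows "hinj_arr \<phi> \<Longrightarrow> hinj_arr \<psi> \<Longrightarrow> hinj_arr (Cmp (Kb R) \<psi> \<phi>)"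
    and "hsurj_arr \<phi> \<Longrightarrow> hsurj_arr \<psi> \<Longrightarrow> hsurj_arr (Cmp (Kb R) \<psi> \<phi>)"
    and "hinj_arr (Cmp (Kb R) \<psi> \<phi>) \<Longrightarrow> hinj_arr \<phi>"
    and "hsurj_arr (Cmp (Kb R) \<psi> \<phi>) \<Longrightarrow> hsurj_arr \<psi>"
    and "hinj_arr (Cmp (Kb R) \<psi> \<phi>) \<Longrightarrow> hsurj_arr \<phi> \<Longrightarrow> hinj_arr \<psi>"
    and "hsurj_arr (Cmp (Kb R) \<psi> \<phi>) \<Longrightarrow> hinj_arr \<psi> \<Longrightarrow> hsurj_arr \<phi>"
proof -
  obtain X Y Z f g where a: "\<phi> = htpy_arr X Y f" "\<psi> = htpy_arr Y Z g" "bounded_cpx R X" "bounded_cpx R Y" "bounded_cpx R Z"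
    "chain_map R X Y f" "chain_map R Y Z g" using assms by (auto simp: arr_Kb)
  note [simp] = a(1,2) Cmp_htpy_arr[OF a(3-7)] a(3-7) chain_map_comp[OF a(6,7,3,4,5)]
  show "hinj_arr \<phi> \<Longrightarrow> hinj_arr \<psi> \<Longrightarrow> hinj_arr (Cmp (Kb R) \<psi> \<phi>)"
    using hinj_comp[OF a(3,4,6)] by simp
  show "hsurj_arr \<phi> \<Longrightarrow> hsurj_arr \<psi> \<Longrightarrow> hsurj_arr (Cmp (Kb R) \<psi> \<phi>)"
    using hsurj_comp[OF a(3-7)] by simp
  show "hinj_arr (Cmp (Kb R) \<psi> \<phi>) \<Longrightarrow> hinj_arr \<phi>" using hinj_cancel[OF a(3-5,7)] by simp
  show "hsurj_arr (Cmp (Kb R) \<psi> \<phi>) \<Longrightarrow> hsurj_arr \<psi>" using hsurj_cancel[OF a(3,4,6)] by simp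
  show "hinj_arr (Cmp (Kb R) \<psi> \<phi>) \<Longrightarrow> hsurj_arr \<phi> \<Longrightarrow> hinj_arr \<psi>"
    using hinj_cancel_hsurj[OF a(3-7)] by simp
  show "hsurj_arr (Cmp (Kb R) \<psi> \<phi>) \<Longrightarrow> hinj_arr \<psi> \<Longrightarrow> hsurj_arr \<phi>"
    using hsurj_cancel_hinj[OF a(3-7)] by simp
qed

lemma hinj_hsurj_Idt:
  assumes "bounded_cpx R X" shows "hinj_arr (Idt (Kb R) X)" "hsurj_arr (Idt (Kb R) X)"
  using assms qis_id[OF assms] chain_map_id by (auto simp: qis_def)

lemma Kb_iso_qis:
  assumes "is_iso (Kb R) X Y \<phi>" shows "hinj_arr \<phi>" "hsurj_arr \<phi>"
proof -
  obtain \<psi> where "\<phi> \<in> Hom (Kb R) X Y" "\<psi> \<in> Hom (Kb R) Y X" and e: "Cmp (Kb R) \<psi> \<phi> = Idt (Kb R) X" "Cmp (Kb R) \<phi> \<psi> = Idt (Kb R) Y"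
    using assms by (auto simp: K.is_iso_iff)
  then have h: "K.arr \<phi>" "src \<phi> = X" "tgt \<phi> = Y" "K.arr \<psi>" "src \<psi> = Y" "tgt \<psi> = X" by (auto simp: K.hom_iff)
  then have b: "bounded_cpx R X" "bounded_cpx R Y" using K.arr_Ob[of \<phi>] by auto
  show "hinj_arr \<phi>" using hinj_arr_comp_iff(3)[of \<phi> \<psi>] e hinj_hsurj_Idt[OF b(1)] h by simp
  show "hsurj_arr \<phi>" using hinj_arr_comp_iff(4)[of \<psi> \<phi>] e hinj_hsurj_Idt[OF b(2)] h by simp
qed

abbreviation incl_arr :: "'a cpx \<Rightarrow> 'a cpx \<Rightarrow> (int \<Rightarrow> 'a mel \<Rightarrow> 'a mel) \<Rightarrow> ('a cpx, (int \<Rightarrow> 'a mel \<Rightarrow> 'a mel) set) arr" where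
  "incl_arr X Y f \<equiv> htpy_arr Y (cone_cpx X Y f) (\<lambda>i y. Pair \<zero>\<^bsub>cmod X (i + 1)\<^esub> y)"

abbreviation proj_arr :: "'a cpx \<Rightarrow> 'a cpx \<Rightarrow> (int \<Rightarrow> 'a mel \<Rightarrow> 'a mel) \<Rightarrow> ('a cpx, (int \<Rightarrow> 'a mel \<Rightarrow> 'a mel) set) arr" where
  "proj_arr X Y f \<equiv> htpy_arr (cone_cpx X Y f) (shift_cpx X) (\<lambda>i. pfst)"

lemma Tri_Kb: "Tri (Kb R) = triangle_closure (Kb R)
   {(X, Y, cone_cpx X Y f, htpy_arr X Y f, incl_arr X Y f, proj_arr X Y f)
      | X Y f. bounded_cpx R X \<and> bounded_cpx R Y \<and> chain_map R X Y f}"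
  by (simp add: Kb_def htpy_arr_def triangle_closure_def)

lemma standard_triangle:
  assumes "bounded_cpx R X" "bounded_cpx R Y" "chain_map R X Y f"
  shows "is_triangle (Kb R) (X, Y, cone_cpx X Y f, htpy_arr X Y f, incl_arr X Y f, proj_arr X Y f)"
    and "(X, Y, cone_cpx X Y f, htpy_arr X Y f, incl_arr X Y f, proj_arr X Y f) \<in> Tri (Kb R)"
proof -
  show 1: "is_triangle (Kb R) (X, Y, cone_cpx X Y f, htpy_arr X Y f, incl_arr X Y f, proj_arr X Y f)"
    unfolding is_triangle_def prod.case K.hom_iff
    using assms cone_bounded[OF assms] cone_incl[OF assms] cone_proj[OF assms] shift_bounded by simp
  show "(X, Y, cone_cpx X Y f, htpy_arr X Y f, incl_arr X Y f, proj_arr X Y f) \<in> Tri (Kb R)"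
    unfolding Tri_Kb by (rule K.triangle_closureI[OF _ 1]) (use assms in blast)
qed

lemma Tri_KbE:
  assumes "(X, Y, Z, \<phi>, \<psi>, \<chi>) \<in> Tri (Kb R)"
  obtains X' Y' f a b c where "bounded_cpx R X'" "bounded_cpx R Y'" "chain_map R X' Y' f"
    "is_iso (Kb R) X X' a" "is_iso (Kb R) Y Y' b" "is_iso (Kb R) Z (cone_cpx X' Y' f) c"
    "Cmp (Kb R) b \<phi> = Cmp (Kb R) (htpy_arr X' Y' f) a" "\<phi> \<in> Hom (Kb R) X Y"
proof -
  obtain X' Y' f where f: "bounded_cpx R X'" "bounded_cpx R Y'" "chain_map R X' Y' f"
    and t: "is_triangle (Kb R) (X, Y, Z, \<phi>, \<psi>, \<chi>)"
      "triangle_iso (Kb R) (X, Y, Z, \<phi>, \<psi>, \<chi>) (X', Y', cone_cpx X' Y' f, htpy_arr X' Y' f, incl_arr X' Y' f, proj_arr X' Y' f)"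
    using assms unfolding Tri_Kb triangle_closure_def by blast
  obtain a b c where "is_iso (Kb R) X X' a" "is_iso (Kb R) Y Y' b" "is_iso (Kb R) Z (cone_cpx X' Y' f) c"
    "Cmp (Kb R) b \<phi> = Cmp (Kb R) (htpy_arr X' Y' f) a"
    using t(2) unfolding triangle_iso_def prod.case by (elim exE conjE)
  moreover have "\<phi> \<in> Hom (Kb R) X Y" using t(1) unfolding is_triangle_def prod.case by simp
  ultimately show thesis using that f by blast
qed

lemma Kb_iso_N:
  assumes "is_iso (Kb R) X Y \<phi>" "cone_class R N" shows "X \<in> N \<longleftrightarrow> Y \<in> N"
proof -
  interpret N: cone_class R N by fact
  have "K.arr \<phi>" "src \<phi> = X" "tgt \<phi> = Y" using assms(1) by (auto simp: K.is_iso_iff K.hom_iff)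
  then obtain f where "\<phi> = htpy_arr X Y f" "bounded_cpx R X" "bounded_cpx R Y" "chain_map R X Y f"
    using arr_KbE by metis
  then show ?thesis using Kb_iso_qis[OF assms(1)] N.N_qis[of X Y f] by (simp add: qis_def)
qed

text \<open>A triangle with acyclic third term is isomorphic to a standard one of a quasi-isomorphism, and
  isomorphisms of the homotopy category are quasi-isomorphisms; so its first arrow is one as well.\<close>

lemma verdier_W_Acyc: "verdier_W (Kb R) (Acyc R) = A.cone_arrows"
proof (intro equalityI subsetI)
  fix \<phi> assume "\<phi> \<in> A.cone_arrows"
  then obtain X Y f where f: "bounded_cpx R X" "bounded_cpx R Y" "chain_map R X Y f" "\<phi> = htpy_arr X Y f"
    "cone_cpx X Y f \<in> Acyc R" by (auto simp: A.cone_arrows_def)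
  then show "\<phi> \<in> verdier_W (Kb R) (Acyc R)"
    using standard_triangle(2)[OF f(1-3)] unfolding verdier_W_def by blast
next
  fix \<phi> assume "\<phi> \<in> verdier_W (Kb R) (Acyc R)"
  then obtain X Y Z \<psi> \<chi> where t: "(X, Y, Z, \<phi>, \<psi>, \<chi>) \<in> Tri (Kb R)" and Z: "Z \<in> Acyc R"
    unfolding verdier_W_def by blast
  obtain X' Y' f a b c where f: "bounded_cpx R X'" "bounded_cpx R Y'" "chain_map R X' Y' f"
    and i: "is_iso (Kb R) X X' a" "is_iso (Kb R) Y Y' b" "is_iso (Kb R) Z (cone_cpx X' Y' f) c"
    and e: "Cmp (Kb R) b \<phi> = Cmp (Kb R) (htpy_arr X' Y' f) a" "\<phi> \<in> Hom (Kb R) X Y"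
    using t by (rule Tri_KbE)
  have "cone_cpx X' Y' f \<in> Acyc R" using Kb_iso_N[OF i(3) Acyc_cone_class] Z by simp
  then have q: "hinj_arr (htpy_arr X' Y' f)" "hsurj_arr (htpy_arr X' Y' f)"
    using cone_acyclic_iff[OF f] f by (simp_all add: Acyc_def qis_def)
  have h: "K.arr a" "tgt a = X'" "src a = X" "K.arr b" "src b = Y" "K.arr \<phi>" "src \<phi> = X" "tgt \<phi> = Y" "K.arr (htpy_arr X' Y' f)"
    using i e f by (auto simp: K.is_iso_iff K.hom_iff)
  have "hinj_arr (Cmp (Kb R) b \<phi>)" "hsurj_arr (Cmp (Kb R) b \<phi>)" unfolding e
    using hinj_arr_comp_iff(1,2)[of a "htpy_arr X' Y' f"] q Kb_iso_qis[OF i(1)] h by simp_all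
  then show "\<phi> \<in> A.cone_arrows"
    using qis_arr hinj_arr_comp_iff(3,6)[of \<phi> b] Kb_iso_qis[OF i(2)] h by simp
qed

sublocale V: verdier_fractions "Kb R" "Acyc R"
  unfolding verdier_fractions_def verdier_W_Acyc by (rule A.cone_arrows_right_fractions)

sublocale T: two_step_fractions "Kb R" "Acyc R" P.cone_arrows
proof -
  interpret RP: right_fractions "Kb R" P.cone_arrows by (rule P.cone_arrows_right_fractions)
  show "two_step_fractions (Kb R) (Acyc R) P.cone_arrows"
  proof
    fix s assume s: "s \<in> verdier_W (Kb R) (Acyc R)" "K.arr s"
    then obtain X Y f where f: "s = htpy_arr X Y f" "bounded_cpx R X" "bounded_cpx R Y" "chain_map R X Y f"
      by (auto simp: arr_Kb)
    then show "s \<in> P.cone_arrows"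
      using s(1) htpy_arr_qis_arr P.htpy_arr_cone_arrows P.N_cone_of_qis by (simp add: verdier_W_Acyc)
  next
    fix s s' g g'
    assume *: "s \<in> verdier_W (Kb R) (Acyc R)" "s' \<in> verdier_W (Kb R) (Acyc R)" "g \<in> P.cone_arrows"
      "K.arr s" "K.arr s'" "K.arr g" "K.arr g'" "src s = tgt g'" "src g = tgt s'" "src s' = src g'"
      "Cmp (Kb R) s g' = Cmp (Kb R) g s'"
    have "tgt s = tgt g" using K.arr_Cmp(3)[of g' s] K.arr_Cmp(3)[of s' g] * by simp
    then obtain X' X Y' Y sm s'm gm g'm where
      a: "s = htpy_arr Y' Y sm" "s' = htpy_arr X' X s'm" "g = htpy_arr X Y gm" "g' = htpy_arr X' Y' g'm"
      "bounded_cpx R X'" "bounded_cpx R X" "bounded_cpx R Y'" "bounded_cpx R Y"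
      "chain_map R Y' Y sm" "chain_map R X' X s'm" "chain_map R X Y gm" "chain_map R X' Y' g'm"
      using * by (auto simp: arr_Kb)
    have q: "qis X' X s'm" "qis Y' Y sm" using * a htpy_arr_qis_arr by (simp_all add: verdier_W_Acyc)
    have "homotopic R X' Y (\<lambda>i x. sm i (g'm i x)) (\<lambda>i x. gm i (s'm i x))"
      using *(11) a by (simp add: Cmp_htpy_arr htpy_arr_eq_iff chain_map_comp)
    moreover have "cone_cpx X Y gm \<in> {X. perfect_cpx X}" using *(3) a P.htpy_arr_cone_arrows by blast
    ultimately have "cone_cpx X' Y' g'm \<in> {X. perfect_cpx X}"
      using P.N_cone_descend[OF a(5-8) q a(11,12)] by blast
    then show "g' \<in> P.cone_arrows" using P.htpy_arr_cone_arrows a by simp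
  qed
qed

lemma W_qis: "K.arr s \<Longrightarrow> s \<in> verdier_W (Kb R) (Acyc R) \<longleftrightarrow> hinj_arr s \<and> hsurj_arr s"
  using qis_arr by (simp add: verdier_W_Acyc)

text \<open>Let \<open>g t\<^sup>-\<^sup>1\<close> be the inverse of \<open>f s\<^sup>-\<^sup>1\<close>. That the two composites are identities gives
  quasi-isomorphisms that end in \<open>f\<close>, whence surjectivity on homology, and some that end in \<open>g\<close>;
  the latter give injectivity by way of the Ore square \<open>t f' = f s'\<close>.\<close>

lemma Db_iso_numerator:
  assumes r: "V.roof X Y s f" and iso: "is_iso (Db R) X Y (V.frac X Y s f)"
  shows "f \<in> verdier_W (Kb R) (Acyc R)"
proof -
  note h = r[unfolded V.roof_def]
  obtain \<gamma> where \<gamma>: "\<gamma> \<in> Hom V.D Y X" "Cmp V.D \<gamma> (V.frac X Y s f) = Idt V.D X" "Cmp V.D (V.frac X Y s f) \<gamma> = Idt V.D Y"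
    using iso by (auto simp: Db_def V.D.is_iso_iff)
  obtain t g where r2: "V.roof Y X t g" and e: "\<gamma> = V.frac Y X t g"
    using \<gamma>(1) by (auto simp: V.Hom_verdier)
  note h2 = r2[unfolded V.roof_def]
  obtain s' f' where c: "V.completes f t s' f'" using V.completes_exists[OF r r2] by blast
  note h3 = c[unfolded V.completes_def]
  have "V.frac X X (Cmp (Kb R) s s') (Cmp (Kb R) g f') = V.frac X X (Idt (Kb R) X) (Idt (Kb R) X)"
    using \<gamma>(2) V.Cmp_frac[OF r r2 c] V.verdier_simps(4) unfolding e by metis
  then obtain u v where uv: "V.refines (Cmp (Kb R) s s') (Cmp (Kb R) g f') (Idt (Kb R) X) (Idt (Kb R) X) u v"
    using V.frac_eq_iff[OF V.roof_comp[OF r r2 c]] by blast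
  obtain t' g' where c2: "V.completes g s t' g'" using V.completes_exists[OF r2 r] by blast
  note h4 = c2[unfolded V.completes_def]
  have "V.frac Y Y (Cmp (Kb R) t t') (Cmp (Kb R) f g') = V.frac Y Y (Idt (Kb R) Y) (Idt (Kb R) Y)"
    using \<gamma>(3) V.Cmp_frac[OF r2 r c2] V.verdier_simps(4) unfolding e by metis
  then obtain w z where wz: "V.refines (Cmp (Kb R) t t') (Cmp (Kb R) f g') (Idt (Kb R) Y) (Idt (Kb R) Y) w z"
    using V.frac_eq_iff[OF V.roof_comp[OF r2 r c2]] by blast
  note h5 = uv[unfolded V.refines_def] wz[unfolded V.refines_def]
  let ?c = "Cmp (Kb R)"
  have Y: "X \<in> Ob (Kb R)" "Y \<in> Ob (Kb R)" using V.roof_Ob[OF r] by auto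
  have ar: "K.arr s" "K.arr f" "K.arr t" "K.arr g" "K.arr s'" "K.arr f'" "K.arr t'" "K.arr g'" "K.arr u" "K.arr w"
    "src f = src s" "tgt s = X" "tgt f = Y" "src g = src t" "tgt t = Y" "tgt g = X" "src s' = src f'" "tgt s' = src f"
    "tgt f' = src t" "src t' = src g'" "tgt t' = src g" "tgt g' = src s" "tgt u = src s'" "tgt w = src t'"
    using h h2 h3 h4 h5 K.arr_Cmp(2)[of s' s] K.arr_Cmp(2)[of t' t] by auto
  have e1: "?c (?c s s') u = ?c (?c g f') u" and e2: "?c (?c t t') w = ?c (?c f g') w"
    using h5 by simp_all
  have W1: "?c s (?c s' u) \<in> V.W" and W2: "?c t (?c t' w) \<in> V.W"
    using h5 K.Cmp_assoc[of u s' s] K.Cmp_assoc[of w t' t] ar by auto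
  have e1': "?c s (?c s' u) = ?c g (?c f' u)" using e1 ar by (simp del: Kb_simps)
  have e2': "?c t (?c t' w) = ?c f (?c g' w)" using e2 ar by (simp del: Kb_simps)
  have e3: "?c t (?c f' u) = ?c f (?c s' u)"
    by (rule K.Cmp_eq_extend) (use h3 ar in auto)
  have q: "hinj_arr (?c g (?c f' u))" "hsurj_arr (?c f (?c g' w))" "hinj_arr (?c s (?c s' u))" "hsurj_arr (?c s (?c s' u))"
    using W1 W2 unfolding e1'[symmetric] e2'[symmetric] using W_qis ar by auto
  have qs: "hinj_arr s" "hinj_arr t" using W_qis[of s] W_qis[of t] h h2 by simp_all
  have "hsurj_arr f" using hinj_arr_comp_iff(4)[of "?c g' w" f] q(2) ar by auto
  moreover have "hinj_arr (?c f' u)" using hinj_arr_comp_iff(3)[of "?c f' u" g] q(1) ar by auto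
  then have "hinj_arr (?c f (?c s' u))"
    unfolding e3[symmetric] using hinj_arr_comp_iff(1)[of "?c f' u" t] qs ar by auto
  moreover have "hsurj_arr (?c s' u)" using hinj_arr_comp_iff(6)[of "?c s' u" s] q qs ar by auto
  ultimately have "hinj_arr f" "hsurj_arr f" using hinj_arr_comp_iff(5)[of "?c s' u" f] ar by auto
  then show ?thesis using W_qis ar by simp
qed

lemma Db_iso_WP_fracs:
  assumes "is_iso (Db R) X Y \<phi>" shows "\<phi> \<in> T.WP_fracs"
proof -
  have "\<phi> \<in> Hom V.D X Y" using assms by (auto simp: Db_def V.D.is_iso_iff)
  then obtain s f where r: "V.roof X Y s f" and e: "\<phi> = V.frac X Y s f" by (auto simp: V.Hom_verdier)
  then have "f \<in> V.W" using Db_iso_numerator assms by blast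
  then show ?thesis using T.WP_fracsI[OF r] T.W_sub_WP r by (auto simp: e V.roof_def)
qed

text \<open>An isomorphism in the derived category is a fraction \<open>Q \<leftarrow> L \<rightarrow> X\<close> of quasi-isomorphisms, and
  perfectness passes along both.\<close>

lemma Perf_eq: "Perf R = {X. perfect_cpx X}"
proof (intro equalityI subsetI)
  fix X assume "X \<in> {X. perfect_cpx X}"
  then obtain Q \<theta> where Q: "bounded_cpx R X" "bounded_cpx R Q" "\<forall>i. projective_mod R (cmod Q i)" "qis Q X \<theta>"
    unfolding perfect_cpx_def by blast
  have c: "chain_map R Q X \<theta>" using Q by (simp add: qis_def)
  then have "is_iso (Db R) Q X (V.Q (htpy_arr Q X \<theta>))"
    using V.Q_iso[of "htpy_arr Q X \<theta>"] Q by (simp add: Db_def verdier_W_Acyc htpy_arr_qis_arr)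
  then have "isomorphic (Db R) Q X" unfolding isomorphic_def by (rule exI)
  then have "isomorphic (Db R) X Q" unfolding Db_def by (rule V.D.isomorphic_sym)
  then show "X \<in> Perf R" unfolding Perf_def using Q(2,3) by blast
next
  fix X assume "X \<in> Perf R"
  then obtain Q \<phi> where Q: "bounded_cpx R Q" "\<forall>i. projective_mod R (cmod Q i)" and iso: "is_iso (Db R) X Q \<phi>"
    unfolding Perf_def isomorphic_def by blast
  have "\<phi> \<in> Hom V.D X Q" using iso by (auto simp: Db_def V.D.is_iso_iff)
  then obtain s f where r: "V.roof X Q s f" and e: "\<phi> = V.frac X Q s f" by (auto simp: V.Hom_verdier)
  have f: "f \<in> V.W" using Db_iso_numerator r iso e by blast
  obtain L sm fm where a: "s = htpy_arr L X sm" "f = htpy_arr L Q fm" "bounded_cpx R L" "bounded_cpx R X"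
    "chain_map R L X sm" "chain_map R L Q fm" using r by (auto simp: V.roof_def arr_Kb)
  have q: "qis L X sm" "qis L Q fm" using a f Q r by (auto simp: V.roof_def verdier_W_Acyc htpy_arr_qis_arr)
  have "perfect_cpx Q" using Q qis_id unfolding perfect_cpx_def by blast
  then show "X \<in> {X. perfect_cpx X}"
    using P.N_qis[OF a(3,4) q(1)] P.N_qis[OF a(3) Q(1) q(2)] by blast
qed

lemma Db_iso_perfect:
  assumes "isomorphic (Db R) X Y" "X \<in> {X. perfect_cpx X}" shows "Y \<in> {X. perfect_cpx X}"
proof -
  have "X \<in> Perf R" using assms Perf_eq by simp
  then obtain Q where "bounded_cpx R Q" "\<forall>i. projective_mod R (cmod Q i)" "isomorphic (Db R) X Q"
    unfolding Perf_def by blast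
  moreover from this(3) have "isomorphic (Db R) Y Q"
    using V.D.isomorphic_trans[OF V.D.isomorphic_sym[OF assms(1)[unfolded Db_def]]] unfolding Db_def by blast
  ultimately show ?thesis unfolding Perf_eq[symmetric] Perf_def by blast
qed

text \<open>A fraction \<open>f s\<^sup>-\<^sup>1\<close> is isomorphic, as an arrow, to the image of \<open>f\<close> by means of \<open>s\<close>, so it has a
  triangle with the cone of \<open>f\<close>. Conversely, an arrow with a triangle whose third term is perfect is
  the image of a chain map with perfect cone, up to isomorphisms on both sides; isomorphisms of the
  derived category are themselves fractions in \<open>WP_fracs\<close>, which is closed under composition.\<close>

lemma verdier_W_Perf: "verdier_W (Db R) (Perf R) = T.WP_fracs"
proof (intro equalityI subsetI)
  fix \<alpha> assume "\<alpha> \<in> T.WP_fracs"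
  then obtain X Y s f where r: "V.roof X Y s f" "f \<in> P.cone_arrows" and e: "\<alpha> = V.frac X Y s f"
    by (auto simp: T.WP_fracs_def)
  note h = r[unfolded V.roof_def]
  obtain L fm where a: "f = htpy_arr L Y fm" "bounded_cpx R L" "bounded_cpx R Y" "chain_map R L Y fm"
    using h by (auto simp: arr_Kb)
  have L: "src s = L" "src f = L" using a h by auto
  have c: "cone_cpx L Y fm \<in> {X. perfect_cpx X}" using r(2) P.htpy_arr_cone_arrows a by blast
  have Y: "Y \<in> Ob V.D" "cone_cpx L Y fm \<in> Ob V.D" using a cone_bounded by simp_all
  let ?a = "V.frac X L s (Idt (Kb R) L)"
  have r': "V.roof X L s (Idt (Kb R) L)" using h L a(2) K.arr_Idt[of L] by (simp add: V.roof_def del: Kb_simps(3))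
  have ia: "inverse_arrows V.D X L ?a (V.Q s)"
    unfolding inverse_arrows_def using V.frac_Idt_inverse[of s] h L V.D.hom_iff[of "V.Q s"] by simp
  have "(X, Y, cone_cpx L Y fm, Cmp V.D (Idt V.D Y) (Cmp V.D (V.Q f) ?a), Cmp V.D (Idt V.D (cone_cpx L Y fm)) (Cmp V.D (V.Q (incl_arr L Y fm)) (Idt V.D Y)),
    Cmp V.D (ShA V.D (V.Q s)) (Cmp V.D (V.Q (proj_arr L Y fm)) (Idt V.D (cone_cpx L Y fm)))) \<in> Tri V.D"
    unfolding a(1)
    by (rule V.Tri_verdierI[OF standard_triangle(2)[OF a(2-4)] standard_triangle(1)[OF a(2-4)] ia
        V.D.inverse_arrows_Idt[OF Y(1)] V.D.inverse_arrows_Idt[OF Y(2)]])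
  moreover have "Cmp V.D (Idt V.D Y) (Cmp V.D (V.Q f) ?a) = \<alpha>"
  proof -
    have 1: "Cmp V.D (V.Q f) ?a = \<alpha>"
      using V.Cmp_Q_frac[OF r', of f] h L K.Idt_right[of f L] e by (simp del: Kb_simps(3))
    have "\<alpha> \<in> Hom V.D X Y" unfolding e V.Hom_verdier using r by blast
    then show ?thesis unfolding 1 by (rule V.D.Idt_left_hom)
  qed
  ultimately show "\<alpha> \<in> verdier_W (Db R) (Perf R)"
    using c unfolding verdier_W_def Perf_eq Db_def by blast
next
  fix \<alpha> assume "\<alpha> \<in> verdier_W (Db R) (Perf R)"
  then obtain X Y Z \<beta> \<gamma> where t: "(X, Y, Z, \<alpha>, \<beta>, \<gamma>) \<in> Tri V.D" and Z: "Z \<in> {X. perfect_cpx X}"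
    unfolding verdier_W_def Db_def Perf_eq[unfolded Db_def] by blast
  interpret W: right_fractions V.D T.WP_fracs by (rule T.WP_fracs_right_fractions)
  from t obtain X' Y' Z' f g h a b c where t': "(X', Y', Z', f, g, h) \<in> Tri (Kb R)"
    and i: "is_iso V.D X X' a" "is_iso V.D Y Y' b" "is_iso V.D Z Z' c"
    and e: "Cmp V.D b \<alpha> = Cmp V.D (V.Q f) a" and \<alpha>: "\<alpha> \<in> Hom V.D X Y" and Qf: "V.Q f \<in> Hom V.D X' Y'"
    by (rule V.Tri_verdierE)
  from t' obtain X2 Y2 F a2 b2 c2 where F: "bounded_cpx R X2" "bounded_cpx R Y2" "chain_map R X2 Y2 F"
    and i2: "is_iso (Kb R) X' X2 a2" "is_iso (Kb R) Y' Y2 b2" "is_iso (Kb R) Z' (cone_cpx X2 Y2 F) c2"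
    and e2: "Cmp (Kb R) b2 f = Cmp (Kb R) (htpy_arr X2 Y2 F) a2" and f: "f \<in> Hom (Kb R) X' Y'"
    by (rule Tri_KbE)
  have "isomorphic (Db R) Z (cone_cpx X2 Y2 F)"
    using V.D.is_iso_Cmp[OF i(3) V.Q_is_iso[OF i2(3)]] by (auto simp: isomorphic_def Db_def)
  then have "cone_cpx X2 Y2 F \<in> {X. perfect_cpx X}" using Db_iso_perfect Z by blast
  then have WF: "V.Q (htpy_arr X2 Y2 F) \<in> T.WP_fracs"
    using T.Q_WP_fracs[of "htpy_arr X2 Y2 F"] P.htpy_arr_cone_arrows[OF F] F by simp
  let ?A = "Cmp V.D (V.Q a2) a" and ?B = "Cmp V.D (V.Q b2) b"
  have iA: "is_iso V.D X X2 ?A" and iB: "is_iso V.D Y Y2 ?B"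
    using V.D.is_iso_Cmp[OF i(1) V.Q_is_iso[OF i2(1)]] V.D.is_iso_Cmp[OF i(2) V.Q_is_iso[OF i2(2)]] by auto
  then obtain B' where B': "inverse_arrows V.D Y Y2 ?B B'" by (auto simp: V.D.is_iso_inverse_arrows)
  have "is_iso V.D Y2 Y B'" using V.D.inverse_arrows_sym[OF B'] V.D.is_iso_inverse_arrows by blast
  then have WB: "B' \<in> T.WP_fracs" using Db_iso_WP_fracs by (simp add: Db_def)
  have WA: "?A \<in> T.WP_fracs" using Db_iso_WP_fracs iA by (simp add: Db_def)
  have i2': "a2 \<in> Hom (Kb R) X' X2" "b2 \<in> Hom (Kb R) Y' Y2" using i2 by (auto simp: is_iso_def)
  have i': "a \<in> Hom V.D X X'" "b \<in> Hom V.D Y Y'" using i by (auto simp: is_iso_def)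
  note ar = i'[unfolded V.D.hom_iff] i2'[unfolded K.hom_iff] \<alpha>[unfolded V.D.hom_iff] f[unfolded K.hom_iff]
    B'[unfolded inverse_arrows_def V.D.hom_iff]
  have "Cmp V.D ?B \<alpha> = Cmp V.D (V.Q b2) (Cmp V.D b \<alpha>)"
    using ar by simp
  also have "\<dots> = Cmp V.D (Cmp V.D (V.Q b2) (V.Q f)) a" unfolding e using ar by simp
  also have "Cmp V.D (V.Q b2) (V.Q f) = V.Q (Cmp (Kb R) (htpy_arr X2 Y2 F) a2)"
    unfolding e2[symmetric] using V.Q_Cmp[of f b2] ar by simp
  also have "\<dots> = Cmp V.D (V.Q (htpy_arr X2 Y2 F)) (V.Q a2)" using V.Q_Cmp[of a2 "htpy_arr X2 Y2 F"] ar F by simp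
  also have "Cmp V.D \<dots> a = Cmp V.D (V.Q (htpy_arr X2 Y2 F)) ?A" using ar F by simp
  finally have eq: "Cmp V.D ?B \<alpha> = Cmp V.D (V.Q (htpy_arr X2 Y2 F)) ?A" .
  have "\<alpha> = Cmp V.D (Cmp V.D B' ?B) \<alpha>" using ar V.D.Idt_left[of \<alpha> Y] by metis
  also have "\<dots> = Cmp V.D B' (Cmp V.D ?B \<alpha>)" by (rule V.D.Cmp_assoc) (use ar in auto)
  finally have "\<alpha> = Cmp V.D B' (Cmp V.D (V.Q (htpy_arr X2 Y2 F)) ?A)" unfolding eq .
  moreover have "Cmp V.D (V.Q (htpy_arr X2 Y2 F)) ?A \<in> T.WP_fracs"
    by (rule W.W_Cmp[OF WA WF]) (use ar F in auto)
  then have "Cmp V.D B' (Cmp V.D (V.Q (htpy_arr X2 Y2 F)) ?A) \<in> T.WP_fracs"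
    by (rule W.W_Cmp[OF _ WB]) (use ar F in auto)
  ultimately show "\<alpha> \<in> T.WP_fracs" by simp
qed

sublocale S: verdier_fractions "Db R" "Perf R"
  unfolding verdier_fractions_def verdier_W_Perf unfolding Db_def by (rule T.WP_fracs_right_fractions)

end

section \<open>The singularity category\<close>

context derived_cring
begin

lemma Dsg_eq: "Dsg R = S.D"
  by (simp add: Dsg_def)

lemma S_arr: "S.arr = V.D.arr"
  unfolding Db_def ..

definition dsg_arr :: "'a cpx \<Rightarrow> 'a cpx \<Rightarrow> (int \<Rightarrow> 'a mel \<Rightarrow> 'a mel) \<Rightarrow> ('a cpx, 'a dsg_mor) arr" where
  "dsg_arr X Y f = S.Q (V.Q (htpy_arr X Y f))"

lemma Q_htpy_arr [simp]:
  assumes "bounded_cpx R X" "bounded_cpx R Y" "chain_map R X Y f"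
  shows "S.arr (V.Q (htpy_arr X Y f))" "src (V.Q (htpy_arr X Y f)) = X" "tgt (V.Q (htpy_arr X Y f)) = Y"
  using assms V.Q_arr[of "htpy_arr X Y f"] by (simp_all add: S_arr)

lemma dsg_arr_hom:
  assumes "bounded_cpx R X" "bounded_cpx R Y" "chain_map R X Y f"
  shows "dsg_arr X Y f \<in> Hom (Dsg R) X Y"
  using S.Q_arr[OF Q_htpy_arr(1)[OF assms]] Q_htpy_arr[OF assms] by (simp add: dsg_arr_def Dsg_eq S.D.hom_iff)

lemma dsg_arr_Cmp:
  assumes "bounded_cpx R X" "bounded_cpx R Y" "bounded_cpx R Z" "chain_map R X Y f" "chain_map R Y Z g"
  shows "Cmp (Dsg R) (dsg_arr Y Z g) (dsg_arr X Y f) = dsg_arr X Z (\<lambda>i x. g i (f i x))"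
proof -
  have "V.Q (htpy_arr X Z (\<lambda>i x. g i (f i x))) = Cmp (Db R) (V.Q (htpy_arr Y Z g)) (V.Q (htpy_arr X Y f))"
    using V.Q_Cmp[of "htpy_arr X Y f" "htpy_arr Y Z g"] assms by (simp add: Cmp_htpy_arr Db_def)
  then show ?thesis
    using S.Q_Cmp[of "V.Q (htpy_arr X Y f)" "V.Q (htpy_arr Y Z g)"] assms by (simp add: dsg_arr_def Dsg_eq)
qed

lemma dsg_arr_Add:
  assumes "bounded_cpx R X" "bounded_cpx R Y" "chain_map R X Y f" "chain_map R X Y g"
  shows "Add (Dsg R) (dsg_arr X Y f) (dsg_arr X Y g) = dsg_arr X Y (\<lambda>i x. f i x \<oplus>\<^bsub>cmod Y i\<^esub> g i x)"
proof -
  have "V.Q (htpy_arr X Y (\<lambda>i x. f i x \<oplus>\<^bsub>cmod Y i\<^esub> g i x)) = Add (Db R) (V.Q (htpy_arr X Y f)) (V.Q (htpy_arr X Y g))"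
    using V.Q_Add[of "htpy_arr X Y f" "htpy_arr X Y g"] assms by (simp add: Add_htpy_arr Db_def)
  then show ?thesis
    using S.Q_Add[of "V.Q (htpy_arr X Y f)" "V.Q (htpy_arr X Y g)"] assms by (simp add: dsg_arr_def Dsg_eq)
qed

lemma dsg_arr_Idt:
  assumes "bounded_cpx R X" shows "dsg_arr X X (\<lambda>i x. x) = Idt (Dsg R) X"
  using S.Q_Idt[of X] V.Q_Idt[of X] assms by (simp add: dsg_arr_def Dsg_eq Db_def del: V.verdier_simps(4) S.verdier_simps(4))

lemma dsg_arr_Nul:
  assumes "bounded_cpx R X" "bounded_cpx R Y"
  shows "dsg_arr X Y (\<lambda>i x. \<zero>\<^bsub>cmod Y i\<^esub>) = Nul (Dsg R) X Y"
  using S.Q_Nul[of X Y] V.Q_Nul[of X Y] assms by (simp add: dsg_arr_def Dsg_eq Db_def del: V.verdier_simps(3) S.verdier_simps(3))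

lemma dsg_arr_eqI:
  assumes "bounded_cpx R X" "bounded_cpx R Y" "chain_map R X Y f" "chain_map R X Y g" "homotopic R X Y f g"
  shows "dsg_arr X Y f = dsg_arr X Y g"
  using htpy_arr_eq_iff[OF assms(1-4)] assms(5) by (simp add: dsg_arr_def)

lemma dsg_arr_iso:
  assumes X: "bounded_cpx R X" and Y: "bounded_cpx R Y" and f: "chain_map R X Y f"
    and p: "perfect_cpx (cone_cpx X Y f)"
  shows "is_iso (Dsg R) X Y (dsg_arr X Y f)"
proof -
  have "htpy_arr X Y f \<in> P.cone_arrows" using P.htpy_arr_cone_arrows[OF X Y f] p by simp
  then have "V.Q (htpy_arr X Y f) \<in> verdier_W (Db R) (Perf R)"
    unfolding verdier_W_Perf using T.Q_WP_fracs X Y f by simp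
  then show ?thesis using S.Q_iso[of "V.Q (htpy_arr X Y f)"] X Y f by (simp add: dsg_arr_def Dsg_eq)
qed

lemma dsg_arr_qis_iso:
  assumes X: "bounded_cpx R X" and Y: "bounded_cpx R Y" and f: "qis X Y f"
  shows "is_iso (Dsg R) X Y (dsg_arr X Y f)"
  using dsg_arr_iso[OF X Y] P.N_cone_of_qis[OF X Y f] f by (simp add: qis_def)

lemma isomorphic_of_qis:
  "bounded_cpx R X \<Longrightarrow> bounded_cpx R Y \<Longrightarrow> qis X Y f \<Longrightarrow> isomorphic (Dsg R) X Y"
  unfolding isomorphic_def by (rule exI) (rule dsg_arr_qis_iso)

lemma Ob_Dsg: "Ob (Dsg R) = {X. bounded_cpx R X}"
  by (simp add: Dsg_eq) (simp add: Db_def)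

text \<open>The equation of roofs provides an arrow \<open>\<tau>\<close> of the derived category with perfect cone and \<open>f \<tau> = 0\<close>.
  Multiplying with its denominator gives a chain map \<open>u\<close> with the same property, and an equation in
  the derived category becomes a homotopy after composing with a quasi-isomorphism \<open>t\<close>.\<close>

lemma dsg_arr_eq_NulD:
  assumes X: "bounded_cpx R X" and f: "chain_map R X Y f" and Y: "bounded_cpx R Y"
    and e: "dsg_arr X Y f = Nul (Dsg R) X Y"
  shows "\<exists>V w. bounded_cpx R V \<and> chain_map R V X w \<and> perfect_cpx (cone_cpx V X w) \<and>
    homotopic R V Y (\<lambda>i x. f i (w i x)) (\<lambda>i x. \<zero>\<^bsub>cmod Y i\<^esub>)"
proof -
  let ?f = "htpy_arr X Y f" and ?z = "htpy_arr X Y (\<lambda>i x. \<zero>\<^bsub>cmod Y i\<^esub>)"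
  have z: "chain_map R X Y (\<lambda>i x. \<zero>\<^bsub>cmod Y i\<^esub>)" by (rule chain_map_zero[OF X Y])
  have "S.Q (V.Q ?f) = S.Q (V.Q ?z)" using e dsg_arr_Nul[OF X Y] by (simp add: dsg_arr_def)
  then obtain \<tau> where \<tau>: "S.arr \<tau>" "\<tau> \<in> verdier_W (Db R) (Perf R)" "tgt \<tau> = X"
    "Cmp (Db R) (V.Q ?f) \<tau> = Cmp (Db R) (V.Q ?z) \<tau>"
    using S.Q_eq_iff[of "V.Q ?f" "V.Q ?z"] X Y f z by auto
  obtain X' L s u where r: "V.roof L X' s u" "u \<in> P.cone_arrows" and e\<tau>: "\<tau> = V.frac L X' s u"
    using \<tau>(2) unfolding verdier_W_Perf T.WP_fracs_def by blast
  have X': "X' = X" using \<tau>(3) e\<tau> by simp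
  note h = r(1)[unfolded V.roof_def X']
  have "V.D.arr \<tau>" "src \<tau> = L" using \<tau>(1) e\<tau> by (simp_all add: S_arr)
  then have 1: "Cmp V.D (Cmp V.D (V.Q g) \<tau>) (V.Q s) = V.Q (Cmp (Kb R) g u)"
    if "K.arr g" "src g = X" for g
    using that h V.frac_Cmp_denominator[OF r(1)] V.D.Cmp_assoc[of "V.Q s" \<tau> "V.Q g"] \<tau>(3)
    by (simp add: V.Q_Cmp flip: e\<tau>)
  have "V.Q (Cmp (Kb R) ?f u) = V.Q (Cmp (Kb R) ?z u)"
    using 1[of ?f] 1[of ?z] \<tau>(4) X Y f z by (simp add: Db_def)
  then obtain t where t: "K.arr t" "t \<in> V.W" "tgt t = src u" "Cmp (Kb R) (Cmp (Kb R) ?f u) t = Cmp (Kb R) (Cmp (Kb R) ?z u) t"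
    using V.Q_eq_iff[of "Cmp (Kb R) ?f u" "Cmp (Kb R) ?z u"] h X Y f z by auto
  let ?w = "Cmp (Kb R) u t"
  have ar: "K.arr ?w" "src ?w = src t" "tgt ?w = X" using t h by auto
  then obtain V w where w: "?w = htpy_arr V X w" "bounded_cpx R V" "chain_map R V X w" by (auto simp: arr_Kb)
  have "?w \<in> P.cone_arrows"
    using T.P.W_Cmp[of t u] T.W_sub_WP[OF t(2,1)] r(2) t h by auto
  then have "perfect_cpx (cone_cpx V X w)" using P.htpy_arr_cone_arrows[OF w(2) X w(3)] w(1) by simp
  moreover have "Cmp (Kb R) ?f ?w = Cmp (Kb R) ?z ?w" using t h X Y f z by simp
  then have "homotopic R V Y (\<lambda>i x. f i (w i x)) (\<lambda>i x. \<zero>\<^bsub>cmod Y i\<^esub>)"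
    unfolding w(1) using w X Y f z
      htpy_arr_eq_iff[OF w(2) Y chain_map_comp[OF w(3) f w(2) X Y] chain_map_zero[OF w(2) Y]]
    by (simp add: Cmp_htpy_arr)
  ultimately show ?thesis using w by blast
qed

text \<open>Transport of the image of a standard triangle along isomorphisms at the second and third vertex: the
  middle object is wanted up to isomorphism, and the third is found in its class in another model.\<close>

lemma star_Dsg_I:
  assumes X: "bounded_cpx R X" and E: "bounded_cpx R E" and u: "chain_map R X E u"
    and A: "X \<in> AA" and B: "Z \<in> BB" and i: "isomorphic (Dsg R) E' E" "isomorphic (Dsg R) Z (cone_cpx X E u)"
  shows "E' \<in> star (Dsg R) AA BB"
proof -
  let ?Z = "cone_cpx X E u"
  have Z: "bounded_cpx R ?Z" by (rule cone_bounded[OF X E u])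
  note st = standard_triangle[OF X E u]
  have Id: "inverse_arrows V.D Y Y (Idt V.D Y) (Idt V.D Y)" if "bounded_cpx R Y" for Y
    using that by (intro V.D.inverse_arrows_Idt) simp
  obtain f g h where t: "(X, E, ?Z, f, g, h) \<in> Tri (Db R)"
    using V.Tri_verdierI[OF st(2,1) Id[OF X] Id[OF E] Id[OF Z]] unfolding Db_def by blast
  have "is_triangle (Db R) (X, E, ?Z, f, g, h)"
    using t unfolding Db_def verdier_def with_triangles_simps is_triangle_with_triangles triangle_closure_def by blast
  moreover have "inverse_arrows S.D X X (Idt S.D X) (Idt S.D X)"
  proof (rule S.D.inverse_arrows_Idt)
    show "X \<in> Ob S.D" unfolding Dsg_eq[symmetric] Ob_Dsg using X by simp
  qed
  moreover obtain b b' where "inverse_arrows S.D E' E b b'"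
    using i(1) by (auto simp: isomorphic_def Dsg_eq S.D.is_iso_inverse_arrows)
  moreover obtain c c' where "inverse_arrows S.D Z ?Z c c'"
    using i(2) by (auto simp: isomorphic_def Dsg_eq S.D.is_iso_inverse_arrows)
  ultimately have "\<exists>f g h. (X, E', Z, f, g, h) \<in> Tri (Dsg R)"
    using S.Tri_verdierI[OF t] unfolding Dsg_eq by blast
  moreover have "E' \<in> Ob (Dsg R)" using i(1) by (auto simp: isomorphic_def is_iso_def)
  ultimately show ?thesis using A B unfolding star_def by blast
qed

abbreviation mult_map :: "'a \<Rightarrow> 'a cpx \<Rightarrow> int \<Rightarrow> 'a mel \<Rightarrow> 'a mel" where
  "mult_map a X \<equiv> (\<lambda>i v. a \<odot>\<^bsub>cmod X i\<^esub> v)"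

lemma Dsg_mult_eq: "Dsg_mult R a X = dsg_arr X X (mult_map a X)"
  by (simp add: Dsg_mult_def dsg_arr_def htpy_arr_def)

text \<open>The map \<open>(x, y) \<mapsto> (y, 0)\<close> is a null-homotopy of the multiplication by \<open>a\<close> on its cone.\<close>

lemma cone_mult_Csub:
  assumes X: "bounded_cpx R X" and a: "a \<in> carrier R"
  shows "cone_cpx X X (mult_map a X) \<in> Csub R a"
proof -
  note [simp] = cpx_simps[OF X] a
  let ?C = "cone_cpx X X (mult_map a X)"
  have m: "chain_map R X X (mult_map a X)" by (rule chain_map_smult[OF a X])
  have C: "bounded_cpx R ?C" by (rule cone_bounded[OF X X m])
  have mC: "chain_map R ?C ?C (mult_map a ?C)" by (rule chain_map_smult[OF a C])
  have h: "htpy_maps ?C ?C (\<lambda>i p. Pair (psnd p) \<zero>\<^bsub>cmod X (i - 1)\<^esub>)"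
    by (rule htpy_mapsI) (auto elim!: mod_dsum_cases)
  have "homotopic R ?C ?C (mult_map a ?C) (\<lambda>i x. \<zero>\<^bsub>cmod ?C i\<^esub>)"
    by (rule homotopicI[OF h])
      (auto elim!: mod_dsum_cases simp: cpxD_pred[OF X] cpx_ac[OF X])
  then have "dsg_arr ?C ?C (mult_map a ?C) = Nul (Dsg R) ?C ?C"
    using dsg_arr_eqI[OF C C mC chain_map_zero[OF C C]] dsg_arr_Nul[OF C C] by simp
  then show ?thesis using C by (simp add: Csub_def Ob_Dsg Dsg_mult_eq)
qed

text \<open>The first of the cones in the octahedron of \<open>c = b \<circ> a\<close> is killed by \<open>a\<close>.\<close>

lemma cone_mult_star:
  assumes X: "bounded_cpx R X" and a: "a \<in> carrier R" and b: "b \<in> carrier R" and c: "c = a \<otimes> b"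
    and B: "cone_cpx X X (mult_map b X) \<in> BB" and E: "isomorphic (Dsg R) E (cone_cpx X X (mult_map c X))"
  shows "E \<in> star (Dsg R) (Csub R a) BB"
proof -
  have cR: "c \<in> carrier R" using a b c by simp
  note m = chain_map_smult[OF a X] chain_map_smult[OF b X] chain_map_smult[OF cR X]
  have e: "c \<odot>\<^bsub>cmod X i\<^esub> v = b \<odot>\<^bsub>cmod X i\<^esub> (a \<odot>\<^bsub>cmod X i\<^esub> v)" if "v \<in> carrier (cmod X i)" for i v
  proof -
    interpret M: module R "cmod X i" by (rule cpxD(1)[OF X])
    show ?thesis using that a b by (simp add: c M.smult_assoc1[symmetric] m_comm)
  qed
  let ?u = "cone_map (\<lambda>i x. x) (mult_map b X)"
  have u: "chain_map R (cone_cpx X X (mult_map a X)) (cone_cpx X X (mult_map c X)) ?u"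
    by (rule P.cone_factor_qis(1)[OF X X X m e])
  note bd = cone_bounded[OF X X m(1)] cone_bounded[OF X X m(2)] cone_bounded[OF X X m(3)]
  have "\<exists>F. bounded_cpx R F \<and>
      (\<exists>\<theta>. qis (cone_cpx (cone_cpx X X (mult_map a X)) (cone_cpx X X (mult_map c X)) ?u) F \<theta>) \<and>
      (\<exists>\<theta>. qis (cone_cpx X X (mult_map b X)) F \<theta>)"
    by (rule P.cone_factor_qis(2)[OF X X X m e])
  then obtain F \<theta> \<theta>' where F: "bounded_cpx R F" "qis (cone_cpx (cone_cpx X X (mult_map a X)) (cone_cpx X X (mult_map c X)) ?u) F \<theta>"
    "qis (cone_cpx X X (mult_map b X)) F \<theta>'"
    by (elim exE conjE)
  have "isomorphic (Dsg R) (cone_cpx X X (mult_map b X)) (cone_cpx (cone_cpx X X (mult_map a X)) (cone_cpx X X (mult_map c X)) ?u)"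
    using S.D.isomorphic_trans[OF isomorphic_of_qis[OF bd(2) F(1,3), unfolded Dsg_eq]
      S.D.isomorphic_sym[OF isomorphic_of_qis[OF cone_bounded[OF bd(1,3) u] F(1,2), unfolded Dsg_eq]]]
    by (simp add: Dsg_eq)
  then show ?thesis
    by (rule star_Dsg_I[OF bd(1,3) u cone_mult_Csub[OF X a] B E])
qed

text \<open>The statement is for objects isomorphic to the cone because the direct sum that contains \<open>X\<close> will
  only be isomorphic to it. The isomorphism is absorbed by a triangle, which is why there are at
  least two factors: for a single one the star is the class itself.\<close>

lemma cone_mult_star_list:
  assumes X: "bounded_cpx R X" and x: "\<And>i. i \<in> {1..n} \<Longrightarrow> x i \<in> carrier R"
    and k: "1 \<le> k" "k < n" and E: "isomorphic (Dsg R) E (cone_cpx X X (mult_map (finprod R x {k..n}) X))"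
  shows "E \<in> star_list (Dsg R) (map (\<lambda>i. Csub R (x i)) [k..<Suc n])"
  using k E
proof (induction "n - k" arbitrary: k E)
  case 0
  then show ?case by simp
next
  case (Suc d)
  define c where "c = finprod R x {Suc k..n}"
  have cl: "finprod R x {j..n} \<in> carrier R" if "1 \<le> j" for j
    using x that by (intro finprod_closed) auto
  have ins: "{k..n} = insert k {Suc k..n}" using Suc.prems by auto
  have p: "finprod R x {k..n} = x k \<otimes> c" unfolding ins c_def
    using x Suc.prems by (subst finprod_insert) auto
  have C: "bounded_cpx R (cone_cpx X X (mult_map c X))"
    using cone_bounded[OF X X chain_map_smult[OF cl X]] unfolding c_def by simp
  have "cone_cpx X X (mult_map c X) \<in> star_list (Dsg R) (map (\<lambda>i. Csub R (x i)) [Suc k..<Suc n])"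
  proof (cases "Suc k = n")
    case True
    have "c = x n" using x Suc.prems True unfolding c_def by simp
    then show ?thesis using True cone_mult_Csub[OF X, of c] x Suc.prems by simp
  next
    case False
    have "isomorphic (Dsg R) (cone_cpx X X (mult_map c X)) (cone_cpx X X (mult_map c X))"
      using isomorphic_of_qis[OF C C qis_id[OF C]] .
    then show ?thesis unfolding c_def
      using Suc False by (intro Suc.hyps(1)) auto
  qed
  then have "E \<in> star (Dsg R) (Csub R (x k)) (star_list (Dsg R) (map (\<lambda>i. Csub R (x i)) [Suc k..<Suc n]))"
    using cone_mult_star[OF X _ _ p] Suc.prems cl x unfolding c_def by simp
  moreover have "[k..<Suc n] = k # Suc k # [Suc (Suc k)..<Suc n]" "[Suc k..<Suc n] = Suc k # [Suc (Suc k)..<Suc n]"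
    using Suc.prems by (simp_all add: upt_conv_Cons)
  ultimately show ?case by simp
qed

text \<open>The cone of the zero map is the direct sum of the target and the shifted source already as a
  complex.\<close>

lemma biproduct_cone_zero:
  assumes V: "bounded_cpx R V" and X: "bounded_cpx R X"
  shows "biproduct (Dsg R) X (shift_cpx V) (cone_cpx V X (\<lambda>i x. \<zero>\<^bsub>cmod X i\<^esub>))"
proof -
  note [simp] = cpx_simps[OF V] cpx_simps[OF X]
  let ?E = "cone_cpx V X (\<lambda>i x. \<zero>\<^bsub>cmod X i\<^esub>)"
  have z: "chain_map R V X (\<lambda>i x. \<zero>\<^bsub>cmod X i\<^esub>)" by (rule chain_map_zero[OF V X])
  have E: "bounded_cpx R ?E" by (rule cone_bounded[OF V X z])
  have S: "bounded_cpx R (shift_cpx V)" by (rule shift_bounded[OF V])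
  have i: "chain_map R X ?E (\<lambda>i y. Pair \<zero>\<^bsub>cmod V (i + 1)\<^esub> y)" by (rule cone_incl[OF V X z])
  have q: "chain_map R ?E (shift_cpx V) (\<lambda>i. pfst)" by (rule cone_proj[OF V X z])
  have p: "chain_map R ?E X (\<lambda>i. psnd)" by (rule chain_mapI) (auto elim!: mod_dsum_cases)
  have j: "chain_map R (shift_cpx V) ?E (\<lambda>i v. Pair v \<zero>\<^bsub>cmod X i\<^esub>)" by (rule chain_mapI) auto
  have eqs: "dsg_arr X X (\<lambda>i x. psnd (Pair \<zero>\<^bsub>cmod V (i + 1)\<^esub> x)) = Idt (Dsg R) X"
    "dsg_arr (shift_cpx V) (shift_cpx V) (\<lambda>i x. pfst (Pair x \<zero>\<^bsub>cmod X i\<^esub>)) = Idt (Dsg R) (shift_cpx V)"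
    "dsg_arr (shift_cpx V) X (\<lambda>i x. psnd (Pair x \<zero>\<^bsub>cmod X i\<^esub>)) = Nul (Dsg R) (shift_cpx V) X"
    using dsg_arr_Idt[OF X] dsg_arr_Idt[OF S] dsg_arr_Nul[OF S X] by simp_all
  have eq4: "dsg_arr X (shift_cpx V) (\<lambda>i x. pfst (Pair \<zero>\<^bsub>cmod V (i + 1)\<^esub> x)) = Nul (Dsg R) X (shift_cpx V)"
    using dsg_arr_Nul[OF X S] by simp
  have ip: "chain_map R ?E ?E (\<lambda>i x. Pair \<zero>\<^bsub>cmod V (i + 1)\<^esub> (psnd x))"
    and jq: "chain_map R ?E ?E (\<lambda>i x. Pair (pfst x) \<zero>\<^bsub>cmod X i\<^esub>)"
    using chain_map_comp[OF p i E X E] chain_map_comp[OF q j E S E] by simp_all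
  have "homotopic R ?E ?E (\<lambda>i x. Pair \<zero>\<^bsub>cmod V (i + 1)\<^esub> (psnd x) \<oplus>\<^bsub>cmod ?E i\<^esub> Pair (pfst x) \<zero>\<^bsub>cmod X i\<^esub>) (\<lambda>i x. x)"
    by (rule homotopic_eqI[OF E E chain_map_add[OF ip jq E E]]) (auto elim!: mod_dsum_cases)
  then have "Add (Dsg R) (dsg_arr ?E ?E (\<lambda>i x. Pair \<zero>\<^bsub>cmod V (i + 1)\<^esub> (psnd x))) (dsg_arr ?E ?E (\<lambda>i x. Pair (pfst x) \<zero>\<^bsub>cmod X i\<^esub>))
      = Idt (Dsg R) ?E"
    using dsg_arr_Add[OF E E ip jq] dsg_arr_eqI[OF E E chain_map_add[OF ip jq E E] chain_map_id] dsg_arr_Idt[OF E] by simp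
  then show ?thesis unfolding biproduct_def
    by (intro bexI[OF _ dsg_arr_hom[OF X E i]] bexI[OF _ dsg_arr_hom[OF E X p]] bexI[OF _ dsg_arr_hom[OF S E j]]
        bexI[OF _ dsg_arr_hom[OF E S q]] conjI)
      (simp_all only: dsg_arr_Cmp[OF X E X i p] dsg_arr_Cmp[OF S E S j q] dsg_arr_Cmp[OF S E X j p] dsg_arr_Cmp[OF X E S i q]
        dsg_arr_Cmp[OF E X E p i] dsg_arr_Cmp[OF E S E q j] eqs eq4)
qed

theorem Dsg_eq_smd_star_list:
  assumes n: "n \<ge> 1" and x: "\<And>i. i \<in> {1..n} \<Longrightarrow> x i \<in> carrier R"
    and ann: "finprod R x {1..n} \<in> ann_Dsg R"
  shows "Ob (Dsg R) = smd (Dsg R) (star_list (Dsg R) (map (\<lambda>i. Csub R (x i)) [1..<Suc n]))"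
proof
  define a where "a = finprod R x {1..n}"
  have a: "a \<in> carrier R" and Ca: "Csub R a = Ob (Dsg R)" using ann by (auto simp: a_def ann_Dsg_def)
  show "smd (Dsg R) (star_list (Dsg R) (map (\<lambda>i. Csub R (x i)) [1..<Suc n])) \<subseteq> Ob (Dsg R)"
    by (auto simp: smd_def)
  show "Ob (Dsg R) \<subseteq> smd (Dsg R) (star_list (Dsg R) (map (\<lambda>i. Csub R (x i)) [1..<Suc n]))"
  proof
    fix X assume "X \<in> Ob (Dsg R)"
    then have X: "bounded_cpx R X" and "X \<in> Csub R a" using Ca by (simp_all add: Ob_Dsg)
    then have "dsg_arr X X (mult_map a X) = Nul (Dsg R) X X" by (simp add: Csub_def Dsg_mult_eq)
    note m = chain_map_smult[OF a X]
    obtain V w where V: "bounded_cpx R V" and w: "chain_map R V X w" and p: "perfect_cpx (cone_cpx V X w)"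
      and h: "homotopic R V X (\<lambda>i v. a \<odot>\<^bsub>cmod X i\<^esub> w i v) (\<lambda>i x. \<zero>\<^bsub>cmod X i\<^esub>)"
      using dsg_arr_eq_NulD[OF X m X \<open>dsg_arr X X (mult_map a X) = Nul (Dsg R) X X\<close>] by blast
    let ?D = "cone_cpx V X (\<lambda>i x. \<zero>\<^bsub>cmod X i\<^esub>)" and ?F = "cone_cpx V X (\<lambda>i v. a \<odot>\<^bsub>cmod X i\<^esub> w i v)"
      and ?E = "cone_cpx X X (mult_map a X)"
    have z: "chain_map R V X (\<lambda>i x. \<zero>\<^bsub>cmod X i\<^esub>)" by (rule chain_map_zero[OF V X])
    have aw: "chain_map R V X (\<lambda>i v. a \<odot>\<^bsub>cmod X i\<^esub> w i v)" by (rule chain_map_comp[OF w m V X X])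
    note bd = cone_bounded[OF V X z] cone_bounded[OF V X aw] cone_bounded[OF X X m]
    obtain \<theta> where "qis ?D ?F \<theta>"
      using cone_homotopic_qis[OF V X z aw homotopic_sym[OF V X z h]] by blast
    then have "isomorphic (Dsg R) ?D ?F" by (rule isomorphic_of_qis[OF bd(1,2)])
    moreover have "isomorphic (Dsg R) ?F ?E"
    proof -
      have v: "chain_map R ?F ?E (cone_map w (\<lambda>i x. x))"
        by (rule cone_map_chain[OF V X X X aw m w chain_map_id]) simp
      have "cone_cpx X X (\<lambda>i x. x) \<in> {X. perfect_cpx X}" by (rule P.N_cone_of_qis[OF X X qis_id[OF X]])
      then have "cone_cpx ?F ?E (cone_map w (\<lambda>i x. x)) \<in> {X. perfect_cpx X}"
        by (intro P.N_cone_map[OF V X X X aw m w chain_map_id]) (use p in simp_all)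
      then show ?thesis using dsg_arr_iso[OF bd(2,3) v] unfolding isomorphic_def by blast
    qed
    ultimately have E: "isomorphic (Dsg R) ?D ?E" unfolding Dsg_eq by (rule S.D.isomorphic_trans)
    have "?D \<in> star_list (Dsg R) (map (\<lambda>i. Csub R (x i)) [1..<Suc n])"
    proof (cases "n = 1")
      case True
      \<comment> \<open>Then \<open>a\<close> is the only element, and its class consists of all objects.\<close>
      then have "a = x 1" using x by (simp add: a_def)
      then show ?thesis using True Ca bd(1) by (simp add: Ob_Dsg)
    next
      case False
      show ?thesis
        by (rule cone_mult_star_list[OF X]) (use x n False E in \<open>auto simp: a_def\<close>)
    qed
    then show "X \<in> smd (Dsg R) (star_list (Dsg R) (map (\<lambda>i. Csub R (x i)) [1..<Suc n]))"
      unfolding smd_def Ob_Dsg mem_Collect_eq Bex_def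
      by (intro conjI X exI[of _ ?D] exI[of _ "shift_cpx V"] shift_bounded[OF V] biproduct_cone_zero[OF V X])
  qed
qed

end

theorem theorem1:
  fixes R :: "('a, 'b) ring_scheme" and x :: "nat \<Rightarrow> 'a" and n :: nat
  assumes "cring R" and "noetherian_ring R"
    and "n \<ge> 1"
    and "\<And>i. i \<in> {1..n} \<Longrightarrow> x i \<in> carrier R"
    and "finprod R x {1..n} \<in> ann_Dsg R"
  shows "Ob (Dsg R) = smd (Dsg R) (star_list (Dsg R) (map (\<lambda>i. Csub R (x i)) [1..<Suc n]))"
proof -
  interpret cring R by fact
  interpret derived_cring R ..
  show ?thesis by (rule Dsg_eq_smd_star_list) (use assms in auto)
qed

end
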